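(* Let $m>1$, $p>d$, $\epsilon>0$, let $u_0\in L^1(\mathbb{R}^d)\cap L^\infty(\mathbb{R}^d)$ be nonnegative, and let $V^\epsilon=V_1^\epsilon+V_2^\epsilon$ be an admissible vector field, where $V_1^\epsilon,V_2^\epsilon:\mathbb{R}^d\to\mathbb{R}^d$ are smooth with $\|V_1^\epsilon\|_{L^\infty(\mathbb{R}^d)}+\|V_2^\epsilon\|_{L^p(\mathbb{R}^d)}<\infty$. Let $\varphi_\epsilon(x):=x^m+\epsilon x$ and, for large $r>0$, let $u=u_{\epsilon,r}$ solve, for every $T>0$, $$\begin{cases}\partial_t u=\Delta\varphi_\epsilon(u)+\nabla\cdot(uV^\epsilon)&\text{in }B_r\times[0,T],\\ (\nabla\varphi_\epsilon(u)+uV^\epsilon)\cdot\nu=0&\text{on }\partial B_r\times[0,T],\\ u(x,0)=u_0(x)&\text{on }B_r,\end{cases}$$ where $\nu$ is the outward unit normal on $\partial B_r$. Then $u(x,t)$ is uniformly bounded for all $(x,t)\in B_r\times[0,\infty)$. The bound only depends on $m$, $d$, $p$, $\|V_1^\epsilon\|_{L^\infty}$, $\|V_2^\epsilon\|_{L^p}$, $\|u_0\|_{L^1}$ and $\|u_0\|_{L^\infty}$.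
   Context: $B_r$ is the ball of radius $r$ centered at the origin in $\mathbb{R}^d$. A vector field $V:\mathbb{R}^d\to\mathbb{R}^d$ is admissible if it is integrable and $V=V_1+V_2$ with $\|V_1\|_{L^\infty(\mathbb{R}^d)}+\|V_2\|_{L^p(\mathbb{R}^d)}<\infty$ for some $p>d$. The problem is a uniformly parabolic quasilinear equation with smooth coefficients, whose solution is taken to exist and to be smooth. *)

theory Defs
  imports "HOL-Analysis.Analysis" "HOL-Probability.Essential_Supremum"
begin

definition in_Lp :: "'a measure \<Rightarrow> real \<Rightarrow> ('a \<Rightarrow> 'b::euclidean_space) \<Rightarrow> bool" where
  "in_Lp M p f \<longleftrightarrow>
     f \<in> borel_measurable M \<and> integrable M (\<lambda>x. norm (f x) powr p)"

text \<open>The real number below is the norm only for members of the space (the Bochner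
  integral of a non-integrable function is 0).\<close>

definition Lp_norm :: "'a measure \<Rightarrow> real \<Rightarrow> ('a \<Rightarrow> 'b::euclidean_space) \<Rightarrow> real" where
  "Lp_norm M p f = (\<integral>x. norm (f x) powr p \<partial>M) powr (1 / p)"

definition in_Linf :: "'a measure \<Rightarrow> ('a \<Rightarrow> 'b::euclidean_space) \<Rightarrow> bool" where
  "in_Linf M f \<longleftrightarrow>
     f \<in> borel_measurable M \<and> esssup M (\<lambda>x. ereal (norm (f x))) < \<infinity>"

definition Linf_norm :: "'a measure \<Rightarrow> ('a \<Rightarrow> 'b::euclidean_space) \<Rightarrow> real" where
  "Linf_norm M f = real_of_ereal (esssup M (\<lambda>x. ereal (norm (f x))))"

text \<open>Smoothness. On an open set, \<open>k_times_diff k\<close> says that all directional derivatives of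
  order less than \<open>k\<close> are Frechet differentiable and those of order \<open>k\<close> are continuous. A function
  is smooth on an arbitrary set if it agrees there with a smooth function on an open neighbourhood;
  this is how smoothness up to the boundary of a ball is expressed.\<close>

primrec k_times_diff ::
    "nat \<Rightarrow> 'a::real_normed_vector set \<Rightarrow> ('a \<Rightarrow> 'b::real_normed_vector) \<Rightarrow> bool" where
  "k_times_diff 0 S f \<longleftrightarrow> continuous_on S f"
| "k_times_diff (Suc k) S f \<longleftrightarrow>
     (\<forall>x\<in>S. f differentiable (at x)) \<and>
     (\<forall>v. k_times_diff k S (\<lambda>x. frechet_derivative f (at x) v))"

definition smooth_on :: "'a::real_normed_vector set \<Rightarrow> ('a \<Rightarrow> 'b::real_normed_vector) \<Rightarrow> bool" where
  "smooth_on S f \<longleftrightarrow>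
     (\<exists>U g. open U \<and> S \<subseteq> U \<and> (\<forall>k. k_times_diff k U g) \<and> (\<forall>x\<in>S. g x = f x))"

text \<open>The filter argument is \<open>at x\<close> in the interior of the domain \<open>S\<close> and \<open>at x within S\<close> on its
  boundary.\<close>

definition gradient :: "('a::euclidean_space \<Rightarrow> real) \<Rightarrow> 'a filter \<Rightarrow> 'a" where
  "gradient f F = (\<Sum>b\<in>Basis. frechet_derivative f F b *\<^sub>R b)"

definition divergence :: "('a::euclidean_space \<Rightarrow> 'a) \<Rightarrow> 'a \<Rightarrow> real" where
  "divergence G x = (\<Sum>b\<in>Basis. frechet_derivative G (at x) b \<bullet> b)"

definition laplacian :: "('a::euclidean_space \<Rightarrow> real) \<Rightarrow> 'a \<Rightarrow> real" where
  "laplacian f x = divergence (\<lambda>y. gradient f (at y)) x"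

definition admissible :: "('a::euclidean_space \<Rightarrow> 'a) \<Rightarrow> bool" where
  "admissible V \<longleftrightarrow>
     integrable lebesgue V \<and>
     (\<exists>p V1 V2. p > real DIM('a) \<and> (\<forall>x. V x = V1 x + V2 x) \<and>
        in_Linf lebesgue V1 \<and> in_Lp lebesgue p V2)"

definition phi :: "real \<Rightarrow> real \<Rightarrow> real \<Rightarrow> real" where
  "phi m \<epsilon> x = x powr m + \<epsilon> * x"

text \<open>\<open>u x t\<close> is a nonnegative solution of the no-flux problem on the ball of radius \<open>r\<close> for all
  times, smooth up to the lateral boundary for positive times. Nonnegativity is part of the notion
  because \<^term>\<open>phi m \<epsilon>\<close> is meaningful only on \<open>[0, \<infinity>)\<close> for real exponents.
  The initial datum is merely in \<open>L\<^sup>1 \<inter> L\<^sup>\<infinity>\<close>, so smoothness cannot be asked at time 0: the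
  datum is attained strongly in every \<open>L\<^sup>q\<close> of the ball with \<open>q\<close> finite, and the value at time 0
  is the datum almost everywhere. A solution that is smooth on the closed cylinder including time 0
  and equal to the datum there satisfies this.\<close>

definition is_solution ::
    "real \<Rightarrow> real \<Rightarrow> ('a::euclidean_space \<Rightarrow> 'a) \<Rightarrow> ('a \<Rightarrow> real) \<Rightarrow> real \<Rightarrow> ('a \<Rightarrow> real \<Rightarrow> real) \<Rightarrow> bool" where
  "is_solution m \<epsilon> V u0 r u \<longleftrightarrow>
     smooth_on (cball 0 r \<times> {0<..}) (\<lambda>(x, t). u x t) \<and>
     (\<forall>x\<in>cball 0 r. \<forall>t>0. u x t \<ge> 0) \<and>
     (\<forall>x\<in>ball 0 r. \<forall>t>0.
        ((\<lambda>s. u x s) has_real_derivative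
           laplacian (\<lambda>y. phi m \<epsilon> (u y t)) x + divergence (\<lambda>y. u y t *\<^sub>R V y) x) (at t)) \<and>
     (\<forall>x\<in>sphere 0 r. \<forall>t>0.
        (gradient (\<lambda>y. phi m \<epsilon> (u y t)) (at x within cball 0 r) + u x t *\<^sub>R V x)
           \<bullet> (x /\<^sub>R norm x) = 0) \<and>
     (AE x in lebesgue. x \<in> ball 0 r \<longrightarrow> u x 0 = u0 x) \<and>
     (\<forall>q\<ge>1. ((\<lambda>t. Lp_norm (lebesgue_on (ball 0 r)) q (\<lambda>x. u x t - u0 x)) \<longlongrightarrow> 0) (at_right 0))"

end

theory Submission
  imports Defs
begin

text \<open>Where \<open>u > 1\<close> the diffusivity \<open>\<phi>'(u)\<close> is at least 1, uniformly in \<open>\<epsilon>\<close>. Hence testing the equation with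
  \<open>v\<^sup>q\<^sup>-\<^sup>1\<close>, \<open>v = (u - 1)\<^sub>+\<close>, controls \<open>\<nabla>v\<^sup>q\<^sup>/\<^sup>2\<close> in \<open>L\<^sup>2\<close> up to \<open>q\<^sup>2 \<integral> |V|\<^sup>2 v\<^sup>q\<close>. For \<open>d \<ge> 2\<close> the drift satisfies the
  Morrey condition \<open>\<integral>\<^bsub>B(z,\<rho>)\<^esub> |V|\<^sup>2 \<le> \<Lambda> \<rho>\<^sup>d\<^sup>-\<^sup>2\<^sup>+\<^sup>2\<^sup>\<alpha>\<close> with \<open>\<alpha> = 1 - d/p\<close>, and a Poincare type inequality bounds the
  error by a small multiple of \<open>\<integral> |\<nabla>v\<^sup>q\<^sup>/\<^sup>2|\<^sup>2\<close> plus a power of \<open>q\<close> times \<open>(\<integral> v\<^sup>q\<^sup>/\<^sup>2)\<^sup>2\<close>, uniformly in the radius. Since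
  the mass does not increase, doubling \<open>q\<close> repeatedly bounds \<open>\<integral> v\<^sup>q\<close> by \<open>N\<^sup>q\<close> for all times, hence
  \<open>v \<le> N\<close>. For \<open>d = 1\<close> and \<open>p < 2\<close> the square of \<open>V\<close> is not locally integrable with uniform bounds; there
  \<open>V = B' + W\<close> with \<open>B\<close> and \<open>W\<close> bounded, and the same argument applies to \<open>\<zeta> = \<Phi>\<^sup>-\<^sup>1(\<Phi>(u) + B)\<close> with
  \<open>\<Phi>'(s) = \<phi>'(s) / s\<close>, for which \<open>\<nabla>\<phi>(u) + u V = (u / \<zeta>) \<nabla>\<phi>(\<zeta>) + u W\<close>.\<close>

subsection \<open>Continuously differentiable maps\<close>

text \<open>The form of the argument follows from what the bound may not depend on. As for
  \<epsilon>: near zero values it is the only ellipticity, so the energy estimates live on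
  \<open>v > 0\<close>; the one quantitative constant with \<epsilon> in it occurs in the mass
  estimate, multiplied by a parameter sent to zero. As for the radius: the Poincare type inequality
  averages along segments whose base point contracts towards the origin, so no chart or extension
  across the sphere is involved, and the constant term produced where v is small is integrated only
  over g \<ge> 1, a set of measure at most the mass. For m < 2 the power \<open>s powr m\<close> is
  not twice differentiable at 0; hence test functions vanish for small g, and identities are glued
  from two open sets. The datum is attained only in integral norms, so initial bounds are stated at
  some arbitrarily small time. Truncated powers are C1 only from exponent two on, so the doubling
  starts at q = 4, and getting from the mass to q = 4 is a separate interpolation.\<close>

lemma continuous_on_compact_bound:
  fixes f :: "'a::metric_space \<Rightarrow> 'b::real_normed_vector"
  assumes "compact K" "continuous_on K f"
  obtains L where "L > 0" "\<And>x. x \<in> K \<Longrightarrow> norm (f x) \<le> L"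
proof -
  have "bounded (f ` K)"
    using assms by (intro compact_imp_bounded compact_continuous_image)
  then obtain L where "L > 0" "\<forall>y\<in>f ` K. norm y \<le> L"
    unfolding bounded_pos by blast
  then show ?thesis using that by blast
qed

text \<open>Continuity is asked for one direction at a time; in finite dimension this is continuity
  of the derivative, and it is exactly the form of \<open>k_times_diff (Suc 0)\<close>.\<close>

definition C1_on :: "'a::euclidean_space set \<Rightarrow> ('a \<Rightarrow> 'b::real_normed_vector) \<Rightarrow> bool" where
  "C1_on S f \<longleftrightarrow> (\<forall>x\<in>S. f differentiable (at x)) \<and>
     (\<forall>v. continuous_on S (\<lambda>x. frechet_derivative f (at x) v))"

lemma C1_onI:
  assumes "\<And>x. x \<in> S \<Longrightarrow> (f has_derivative D x) (at x)"
    and "\<And>v. continuous_on S (\<lambda>x. D x v)"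
  shows "C1_on S f"
proof -
  have *: "frechet_derivative f (at x) = D x" if "x \<in> S" for x
    using frechet_derivative_at[OF assms(1)[OF that]] by simp
  have "continuous_on S (\<lambda>x. frechet_derivative f (at x) v)" for v
    using assms(2)[of v] by (rule continuous_on_eq) (simp add: *)
  then show ?thesis
    using assms(1) by (auto simp: C1_on_def differentiable_def)
qed

lemma C1_on_has_derivative:
  assumes "C1_on S f" "x \<in> S"
  shows "(f has_derivative frechet_derivative f (at x)) (at x)"
  using assms by (simp add: C1_on_def frechet_derivative_works[symmetric])

lemma C1_on_continuous_deriv:
  "C1_on S f \<Longrightarrow> continuous_on S (\<lambda>x. frechet_derivative f (at x) v)"
  by (simp add: C1_on_def)

lemma C1_on_imp_continuous_on: "C1_on S f \<Longrightarrow> continuous_on S f"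
  by (meson C1_on_has_derivative continuous_at_imp_continuous_on has_derivative_continuous)

lemma C1_on_subset: "C1_on S f \<Longrightarrow> T \<subseteq> S \<Longrightarrow> C1_on T f"
  by (auto simp: C1_on_def intro: continuous_on_subset)

text \<open>Truncated functions are differentiable for different reasons where the unknown is
  positive and where it is small; this glues the two open regions.\<close>

lemma C1_on_Un:
  assumes "open S" "open T" "C1_on S f" "C1_on T f"
  shows "C1_on (S \<union> T) f"
  using assms by (auto simp: C1_on_def intro: continuous_on_open_Un)

lemma C1_on_cong:
  assumes "open S" "C1_on S f" "\<And>x. x \<in> S \<Longrightarrow> f x = g x"
  shows "C1_on S g"
proof (rule C1_onI)
  fix x assume "x \<in> S"
  then show "(g has_derivative frechet_derivative f (at x)) (at x)"
    using assms has_derivative_transform_within_open[OF C1_on_has_derivative] by blast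
qed (use assms in \<open>auto simp: C1_on_def\<close>)

lemma C1_on_const: "C1_on S (\<lambda>x. c)"
  by (rule C1_onI[where D = "\<lambda>x v. 0"]) auto

lemma C1_on_add:
  assumes "C1_on S f" "C1_on S g"
  shows "C1_on S (\<lambda>x. f x + g x)"
proof (rule C1_onI)
  show "((\<lambda>x. f x + g x) has_derivative
      (\<lambda>v. frechet_derivative f (at x) v + frechet_derivative g (at x) v)) (at x)" if "x \<in> S" for x
    using that assms by (intro has_derivative_add C1_on_has_derivative)
  show "continuous_on S (\<lambda>x. frechet_derivative f (at x) v + frechet_derivative g (at x) v)" for v
    using assms by (intro continuous_intros C1_on_continuous_deriv)
qed

lemma C1_on_scaleR:
  fixes f :: "'a::euclidean_space \<Rightarrow> real"
  assumes "C1_on S f" "C1_on S g"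
  shows "C1_on S (\<lambda>x. f x *\<^sub>R g x)"
proof (rule C1_onI)
  show "((\<lambda>x. f x *\<^sub>R g x) has_derivative
      (\<lambda>v. f x *\<^sub>R frechet_derivative g (at x) v + frechet_derivative f (at x) v *\<^sub>R g x)) (at x)"
    if "x \<in> S" for x
    using that assms by (intro has_derivative_scaleR C1_on_has_derivative)
  show "continuous_on S (\<lambda>x. f x *\<^sub>R frechet_derivative g (at x) v + frechet_derivative f (at x) v *\<^sub>R g x)" for v
    using assms by (intro continuous_intros C1_on_continuous_deriv C1_on_imp_continuous_on)
qed

lemma C1_on_sum:
  assumes "\<And>i. i \<in> I \<Longrightarrow> C1_on S (f i)"
  shows "C1_on S (\<lambda>x. \<Sum>i\<in>I. f i x)"
proof (cases "finite I")
  case True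
  then show ?thesis using assms
    by (induction I rule: finite_induct) (auto intro: C1_on_const C1_on_add)
next
  case False
  then show ?thesis by (simp add: C1_on_const)
qed

lemma C1_on_linear_compose:
  assumes "bounded_linear L" "C1_on S f"
  shows "C1_on S (\<lambda>x. L (f x))"
proof (rule C1_onI)
  show "((\<lambda>x. L (f x)) has_derivative (\<lambda>v. L (frechet_derivative f (at x) v))) (at x)"
    if "x \<in> S" for x
    by (rule bounded_linear.has_derivative[OF assms(1) C1_on_has_derivative[OF assms(2) that]])
  show "continuous_on S (\<lambda>x. L (frechet_derivative f (at x) v))" for v
    by (rule bounded_linear.continuous_on[OF assms(1) C1_on_continuous_deriv[OF assms(2)]])
qed

lemma C1_on_real_compose:
  fixes f :: "'a::euclidean_space \<Rightarrow> real" and h :: "real \<Rightarrow> real"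
  assumes "C1_on S f" "\<And>y. y \<in> T \<Longrightarrow> (h has_real_derivative h' y) (at y)"
    "continuous_on T h'" "f ` S \<subseteq> T"
  shows "C1_on S (\<lambda>x. h (f x))"
proof (rule C1_onI)
  show "((\<lambda>x. h (f x)) has_derivative (\<lambda>v. frechet_derivative f (at x) v * h' (f x))) (at x)"
    if "x \<in> S" for x
  proof -
    have "(h has_derivative (*) (h' (f x))) (at (f x))"
      using assms(2)[of "f x"] that assms(4) by (auto simp: has_field_derivative_def)
    from has_derivative_compose[OF C1_on_has_derivative[OF assms(1) that] this]
    show ?thesis by (simp add: mult.commute)
  qed
  show "continuous_on S (\<lambda>x. frechet_derivative f (at x) v * h' (f x))" for v
    using assms by (intro continuous_intros C1_on_continuous_deriv
        continuous_on_compose2[OF assms(3)] C1_on_imp_continuous_on)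
qed

lemma C1_on_slice:
  assumes "C1_on U g"
  shows "C1_on {x. (x, t) \<in> U} (\<lambda>x. g (x, t))"
proof (rule C1_onI)
  show "((\<lambda>x. g (x, t)) has_derivative (\<lambda>v. frechet_derivative g (at (x, t)) (v, 0))) (at x)"
    if "x \<in> {x. (x, t) \<in> U}" for x
  proof (rule has_derivative_compose[of "\<lambda>x. (x, t)" "\<lambda>v. (v, 0)" x UNIV g, simplified])
    show "((\<lambda>x. (x, t)) has_derivative (\<lambda>v. (v, 0))) (at x)"
      by (intro derivative_intros)
    show "(g has_derivative frechet_derivative g (at (x, t))) (at (x, t))"
      using that C1_on_has_derivative[OF assms] by simp
  qed
  show "continuous_on {x. (x, t) \<in> U} (\<lambda>x. frechet_derivative g (at (x, t)) (v, 0))" for v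
    by (rule continuous_on_compose2[OF C1_on_continuous_deriv[OF assms]])
       (auto intro!: continuous_intros)
qed

section \<open>Gradient and divergence in coordinates\<close>

lemma frechet_derivative_sum_Basis:
  fixes D :: "'a::euclidean_space \<Rightarrow> real"
  assumes "linear D"
  shows "D v = (\<Sum>b\<in>Basis. (v \<bullet> b) * D b)"
  using linear_sum[OF assms, of "\<lambda>b. (v \<bullet> b) *\<^sub>R b" Basis]
  by (simp add: euclidean_representation linear_cmul[OF assms])

lemma gradient_inner:
  fixes f :: "'a::euclidean_space \<Rightarrow> real"
  assumes "f differentiable (at x)"
  shows "gradient f (at x) \<bullet> v = frechet_derivative f (at x) v"
proof -
  have "linear (frechet_derivative f (at x))"
    using assms by (rule linear_frechet_derivative)
  from frechet_derivative_sum_Basis[OF this, of v] show ?thesis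
    by (simp add: gradient_def inner_sum_left inner_commute[of v] mult.commute)
qed

lemma gradientI:
  fixes f :: "'a::euclidean_space \<Rightarrow> real"
  assumes "(f has_derivative (\<lambda>v. w \<bullet> v)) (at x)"
  shows "gradient f (at x) = w"
proof -
  have "frechet_derivative f (at x) = (\<lambda>v. w \<bullet> v)"
    using frechet_derivative_at[OF assms] by simp
  then show ?thesis
    by (simp add: gradient_def euclidean_representation)
qed

lemma C1_on_gradient:
  fixes f :: "'a::euclidean_space \<Rightarrow> real"
  assumes "C1_on S f" "x \<in> S"
  shows "(f has_derivative (\<lambda>v. gradient f (at x) \<bullet> v)) (at x)"
proof -
  have "f differentiable (at x)" using assms by (simp add: C1_on_def)
  then have "(\<lambda>v. gradient f (at x) \<bullet> v) = frechet_derivative f (at x)"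
    by (simp add: gradient_inner fun_eq_iff)
  then show ?thesis using C1_on_has_derivative[OF assms] by simp
qed

lemma continuous_on_gradient:
  fixes f :: "'a::euclidean_space \<Rightarrow> real"
  assumes "C1_on S f"
  shows "continuous_on S (\<lambda>x. gradient f (at x))"
  unfolding gradient_def
  by (intro continuous_intros C1_on_continuous_deriv assms)

lemma divergence_eq:
  assumes "(G has_derivative D) (at x)"
  shows "divergence G x = (\<Sum>b\<in>Basis. D b \<bullet> b)"
  using frechet_derivative_at[OF assms] by (simp add: divergence_def)

lemma divergence_scaleR:
  fixes f :: "'a::euclidean_space \<Rightarrow> real" and G :: "'a \<Rightarrow> 'a"
  assumes "(f has_derivative (\<lambda>v. w \<bullet> v)) (at x)" "G differentiable (at x)"
  shows "divergence (\<lambda>y. f y *\<^sub>R G y) x = f x * divergence G x + w \<bullet> G x"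
proof -
  obtain D where D: "(G has_derivative D) (at x)"
    using assms(2) by (auto simp: differentiable_def)
  have "((\<lambda>y. f y *\<^sub>R G y) has_derivative (\<lambda>v. f x *\<^sub>R D v + (w \<bullet> v) *\<^sub>R G x)) (at x)"
    by (rule has_derivative_scaleR[OF assms(1) D])
  from divergence_eq[OF this] divergence_eq[OF D] show ?thesis
    by (simp add: inner_add_left sum.distrib sum_distrib_left euclidean_inner[of w "G x"] mult.commute)
qed

lemma divergence_add:
  assumes "F differentiable (at x)" "G differentiable (at x)"
  shows "divergence (\<lambda>y. F y + G y) x = divergence F x + divergence G x"
proof -
  obtain D E where D: "(F has_derivative D) (at x)" and E: "(G has_derivative E) (at x)"
    using assms by (auto simp: differentiable_def)
  from divergence_eq[OF has_derivative_add[OF D E]] divergence_eq[OF D] divergence_eq[OF E]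
  show ?thesis by (simp add: inner_add_left sum.distrib)
qed

text \<open>Both sides choose a derivative from the same predicate, so they agree even at points
  where no derivative exists.\<close>

lemma divergence_cong:
  assumes "open S" "x \<in> S" "\<And>y. y \<in> S \<Longrightarrow> F y = G y"
  shows "divergence F x = divergence G x"
proof -
  have "(F has_derivative D) (at x) \<longleftrightarrow> (G has_derivative D) (at x)" for D
    using assms has_derivative_transform_within_open[of F D x UNIV S G]
      has_derivative_transform_within_open[of G D x UNIV S F] by auto
  then show ?thesis by (simp add: divergence_def frechet_derivative_def)
qed

lemma gradient_cong:
  fixes f :: "'a::euclidean_space \<Rightarrow> real"
  assumes "open S" "x \<in> S" "\<And>y. y \<in> S \<Longrightarrow> f y = g y"
  shows "gradient f (at x) = gradient g (at x)"
proof -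
  have "(f has_derivative D) (at x) \<longleftrightarrow> (g has_derivative D) (at x)" for D
    using assms has_derivative_transform_within_open[of f D x UNIV S g]
      has_derivative_transform_within_open[of g D x UNIV S f] by auto
  then show ?thesis by (simp add: gradient_def frechet_derivative_def)
qed

subsection \<open>Vector fields tangential to the sphere\<close>

text \<open>By translation invariance the difference quotients of \<open>f\<close> integrate to 0.\<close>

lemma integral_directional_derivative_zero:
  fixes f :: "'a::euclidean_space \<Rightarrow> real"
  assumes f: "C1_on UNIV f" and supp: "\<And>x. norm x \<ge> r \<Longrightarrow> f x = 0"
  shows "integrable lborel (\<lambda>x. frechet_derivative f (at x) b)"
    and "(\<integral>x. frechet_derivative f (at x) b \<partial>lborel) = 0"
proof -
  define f' where "f' = (\<lambda>x. frechet_derivative f (at x) b)"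
  have cf: "continuous_on UNIV f" and cf': "continuous_on UNIV f'"
    using f C1_on_imp_continuous_on by (auto simp: f'_def C1_on_def)
  have der: "((\<lambda>h. f (x + h *\<^sub>R b)) has_real_derivative f' (x + h *\<^sub>R b)) (at h)" for x h
  proof -
    have *: "((\<lambda>h. x + h *\<^sub>R b) has_derivative (\<lambda>k. k *\<^sub>R b)) (at h)"
      by (auto intro!: derivative_eq_intros)
    have lin: "linear (frechet_derivative f (at y))" for y
      using f by (intro linear_frechet_derivative) (simp add: C1_on_def)
    have eq: "(\<lambda>k. frechet_derivative f (at (x + h *\<^sub>R b)) (k *\<^sub>R b)) = (*) (f' (x + h *\<^sub>R b))"
      by (rule ext) (simp add: f'_def linear_cmul[OF lin])
    show ?thesis
      using has_derivative_compose[OF * C1_on_has_derivative[OF f UNIV_I]]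
      unfolding has_field_derivative_def eq .
  qed
  have f'0: "f' x = 0" if "norm x > r" for x
  proof -
    have "(f has_derivative (\<lambda>v. 0)) (at x)"
    proof (rule has_derivative_transform_within_open[of "\<lambda>x. 0" _ _ UNIV "- cball 0 r"])
      show "0 = f y" if "y \<in> - cball 0 r" for y using supp[of y] that by simp
    qed (use that in auto)
    from frechet_derivative_at[OF this] show ?thesis unfolding f'_def by metis
  qed
  obtain L where L: "L > 0" "\<And>x. x \<in> cball 0 r \<Longrightarrow> norm (f' x) \<le> L"
    using continuous_on_compact_bound[OF compact_cball[of 0 r] continuous_on_subset[OF cf' subset_UNIV]]
    by blast
  have L': "\<bar>f' x\<bar> \<le> L" for x
  proof (cases "norm x \<le> r")
    case True
    then show ?thesis using L(2)[of x] by simp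
  next
    case False
    then show ?thesis using L(1) f'0[of x] by simp
  qed
  have lip: "\<bar>f (x + h *\<^sub>R b) - f x\<bar> \<le> L * h" if h: "h > 0" for x h
  proof -
    have "\<exists>z>0. z < h \<and> f (x + h *\<^sub>R b) - f (x + 0 *\<^sub>R b) = (h - 0) * f' (x + z *\<^sub>R b)"
      by (rule MVT2[OF h]) (rule der)
    then obtain z where "f (x + h *\<^sub>R b) - f x = h * f' (x + z *\<^sub>R b)" by auto
    then show ?thesis using L'[of "x + z *\<^sub>R b"] h by (simp add: abs_mult mult.commute)
  qed
  \<comment> \<open>For steps of length at most one times b, every difference quotient vanishes
    outside this radius, so a multiple of one indicator dominates all of them.\<close>
  define R where "R = r + norm b"
  define s where "s = (\<lambda>n x. (f (x + (1 / real (Suc n)) *\<^sub>R b) - f x) * real (Suc n))"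
  have mf[measurable]: "f \<in> borel_measurable borel"
    using cf by (simp add: borel_measurable_continuous_onI)
  have mf'[measurable]: "f' \<in> borel_measurable borel"
    using cf' by (simp add: borel_measurable_continuous_onI)
  have ind: "integrable lborel (\<lambda>x::'a. c * indicator (cball 0 \<rho>) x :: real)" for c \<rho>
    using emeasure_lborel_cball_finite[of "0::'a" \<rho>]
    by (intro integrable_mult_right integrable_real_indicator) auto
  have intf: "integrable lborel f"
  proof -
    obtain K where K: "K > 0" "\<And>x. x \<in> cball 0 r \<Longrightarrow> norm (f x) \<le> K"
      using continuous_on_compact_bound[OF compact_cball[of 0 r] continuous_on_subset[OF cf subset_UNIV]]
      by blast
    show ?thesis
    proof (rule Bochner_Integration.integrable_bound)
      show "integrable lborel (\<lambda>x::'a. K * indicator (cball 0 r) x :: real)"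
        by (rule ind)
      show "AE x in lborel. norm (f x) \<le> norm (K * indicator (cball 0 r) x :: real)"
      proof (rule AE_I2)
        show "norm (f x) \<le> norm (K * indicator (cball 0 r) x :: real)" for x
          using K(2)[of x] K(1) supp[of x] by (cases "norm x \<le> r") auto
      qed
    qed simp
  qed
  have shift: "integrable lborel (\<lambda>x. f (x + c))" "(\<integral>x. f (x + c) \<partial>lborel) = (\<integral>x. f x \<partial>lborel)" for c
  proof -
    have "integrable (distr lborel borel ((+) c)) f"
      using intf by (simp add: lborel_distr_plus)
    then show "integrable lborel (\<lambda>x::'a. f (x + c))"
      by (simp add: integrable_distr_eq add.commute)
    have "(\<integral>x. f x \<partial>distr lborel borel ((+) c)) = (\<integral>x. f (c + x) \<partial>lborel)"
      by (rule integral_distr) auto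
    then show "(\<integral>x. f (x + c) \<partial>lborel) = (\<integral>x. f x \<partial>lborel)"
      by (simp add: lborel_distr_plus add.commute)
  qed
  have s0: "(\<integral>x. s n x \<partial>lborel) = 0" for n
    unfolding s_def using shift intf by simp
  have "(\<lambda>n. \<integral>x. s n x \<partial>lborel) \<longlonglongrightarrow> (\<integral>x. f' x \<partial>lborel)"
  proof (rule integral_dominated_convergence[where w = "\<lambda>x::'a. L * indicator (cball 0 R) x"])
    show "integrable lborel (\<lambda>x::'a. L * indicator (cball 0 R) x :: real)"
      by (rule ind)
    show "AE x in lborel. (\<lambda>n. s n x) \<longlonglongrightarrow> f' x"
    proof (rule AE_I2)
      fix x
      have "((\<lambda>h. (f (x + h *\<^sub>R b) - f x) / h) \<longlongrightarrow> f' x) (at 0)"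
        using der[of x 0] by (simp add: has_field_derivative_iff)
      moreover have "filterlim (\<lambda>n. 1 / real (Suc n)) (at 0) sequentially"
        using LIMSEQ_Suc[OF lim_1_over_n[where 'a=real]] by (auto simp: filterlim_at simp del: of_nat_Suc)
      ultimately have "((\<lambda>n. (f (x + (1 / real (Suc n)) *\<^sub>R b) - f x) / (1 / real (Suc n))) \<longlongrightarrow> f' x) sequentially"
        by (rule filterlim_compose)
      then show "(\<lambda>n. s n x) \<longlonglongrightarrow> f' x" by (simp add: s_def del: of_nat_Suc)
    qed
    show "AE x in lborel. norm (s n x) \<le> L * indicator (cball 0 R) x" for n
    proof (rule AE_I2)
      fix x :: 'a
      have "\<bar>f (x + (1 / real (Suc n)) *\<^sub>R b) - f x\<bar> * real (Suc n)
          \<le> L * (1 / real (Suc n)) * real (Suc n)"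
        by (intro mult_right_mono lip) auto
      then have le: "norm (s n x) \<le> L"
        unfolding s_def real_norm_def abs_mult by simp
      have "s n x = 0" if "norm x > R"
      proof -
        have "norm ((1 / real (Suc n)) *\<^sub>R b) \<le> norm b"
          using mult_right_le_one_le[of "norm b" "1 / real (Suc n)"] by (simp del: of_nat_Suc add: field_simps mult_le_cancel_right1) 
        then have "norm (x + (1 / real (Suc n)) *\<^sub>R b) \<ge> r"
          using that norm_diff_ineq[of x "(1 / real (Suc n)) *\<^sub>R b"] unfolding R_def by linarith
        moreover have "norm x \<ge> r" using that norm_ge_zero[of b] unfolding R_def by linarith
        ultimately show ?thesis using supp by (simp add: s_def)
      qed
      then show "norm (s n x) \<le> L * indicator (cball 0 R) x"
        using le by (cases "norm x > R") auto
    qed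
  qed (auto simp: s_def)
  then show "(\<integral>x. frechet_derivative f (at x) b \<partial>lborel) = 0"
    using s0 LIMSEQ_unique[OF _ tendsto_const] by (simp add: f'_def)
  have "integrable lborel f'"
  proof (rule Bochner_Integration.integrable_bound[OF ind[of L r]])
    show "AE x in lborel. norm (f' x) \<le> norm (L * indicator (cball 0 r) x :: real)"
    proof (rule AE_I2)
      show "norm (f' x) \<le> norm (L * indicator (cball 0 r) x :: real)" for x
        using L(2)[of x] L(1) f'0[of x] by (cases "norm x \<le> r") auto
    qed
  qed simp
  then show "integrable lborel (\<lambda>x. frechet_derivative f (at x) b)"
    by (simp add: f'_def)
qed

section \<open>Truncated powers and rational cut-offs\<close>

lemma has_real_derivative_max_power:
  assumes "n \<ge> 2"
  shows "((\<lambda>x::real. max 0 x ^ n) has_real_derivative real n * max 0 x ^ (n - 1)) (at x)"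
proof -
  consider "x > 0" | "x < 0" | "x = 0" by linarith
  then show ?thesis
  proof cases
    case 1
    have "((\<lambda>x::real. x ^ n) has_real_derivative real n * x ^ (n - 1)) (at x)"
      by (auto intro!: derivative_eq_intros)
    then have "((\<lambda>x::real. max 0 x ^ n) has_real_derivative real n * x ^ (n - 1)) (at x)"
      by (rule has_field_derivative_transform_within_open[where S = "{0<..}"]) (use 1 in auto)
    then show ?thesis using 1 by simp
  next
    case 2
    have "((\<lambda>x::real. 0) has_real_derivative 0) (at x)" by simp
    then have "((\<lambda>x::real. max 0 x ^ n) has_real_derivative 0) (at x)"
      by (rule has_field_derivative_transform_within_open[where S = "{..<0}"])
         (use 2 assms in auto)
    then show ?thesis using 2 assms by (simp add: power_0_left)
  next
    case 3
    \<comment> \<open>At the kink the quotient is at most |h|^(n - 1), and \<open>n \<ge> 2\<close>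
      sends this to zero.\<close>
    have "((\<lambda>h. max 0 h ^ n / h) \<longlongrightarrow> 0) (at (0::real))"
    proof (rule Lim_null_comparison)
      have "norm (max 0 h ^ n / h) \<le> \<bar>h\<bar> ^ (n - 1)" if "h \<noteq> 0" for h :: real
      proof -
        have "n = Suc (n - 1)" using assms by simp
        then have "norm (max 0 h ^ n) \<le> \<bar>h\<bar> ^ Suc (n - 1)"
          by (metis abs_ge_self abs_ge_zero max.bounded_iff max.cobounded1 norm_power power_mono real_norm_def abs_of_nonneg)
        then show ?thesis using that by (simp add: field_simps)
      qed
      then show "\<forall>\<^sub>F h in at 0. norm (max 0 h ^ n / h) \<le> \<bar>h\<bar> ^ (n - 1)"
        by (auto simp: eventually_at_filter)
      have "((\<lambda>h::real. \<bar>h\<bar> ^ (n - 1)) \<longlongrightarrow> \<bar>0\<bar> ^ (n - 1)) (at 0)"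
        by (intro tendsto_intros)
      then show "((\<lambda>h::real. \<bar>h\<bar> ^ (n - 1)) \<longlongrightarrow> 0) (at 0)"
        using assms by (simp add: zero_power)
    qed
    then show ?thesis using 3 assms
      by (simp add: has_field_derivative_iff power_0_left)
  qed
qed

lemma has_real_derivative_max_power_shift:
  assumes "n \<ge> 2"
  shows "((\<lambda>x::real. max 0 (x - k) ^ n) has_real_derivative real n * max 0 (x - k) ^ (n - 1)) (at x)"
proof -
  have "((\<lambda>x. x - k) has_real_derivative 1) (at x)"
    by (auto intro!: derivative_eq_intros)
  from DERIV_chain2[where f = "\<lambda>x. max 0 x ^ n" and g = "\<lambda>x. x - k",
      OF has_real_derivative_max_power[OF assms] this]
  show ?thesis by simp
qed

text \<open>A C1 approximation of the indicator of (0, \<infinity>) as d tends to zero. It serves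
  twice: as a boundary layer on the ball and as the test function for the mass.\<close>

lemma has_real_derivative_square_cutoff:
  assumes "d > 0"
  shows "((\<lambda>s::real. (max 0 s)\<^sup>2 / ((max 0 s)\<^sup>2 + d)) has_real_derivative
    2 * max 0 s * d / ((max 0 s)\<^sup>2 + d)\<^sup>2) (at s)"
proof -
  have 1: "((\<lambda>s::real. (max 0 s)\<^sup>2) has_real_derivative 2 * max 0 s) (at s)"
    using has_real_derivative_max_power[of 2 s] by simp
  have 2: "(max 0 s)\<^sup>2 + d \<noteq> 0"
    using assms zero_le_power2[of "max 0 s"] by linarith
  have "((\<lambda>s. (max 0 s)\<^sup>2 / ((max 0 s)\<^sup>2 + d)) has_real_derivative
      (2 * max 0 s * ((max 0 s)\<^sup>2 + d) - (max 0 s)\<^sup>2 * (2 * max 0 s + 0)) /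
      (((max 0 s)\<^sup>2 + d) * ((max 0 s)\<^sup>2 + d))) (at s)"
    by (intro DERIV_divide DERIV_add 1 DERIV_const 2)
  moreover have "(2 * max 0 s * ((max 0 s)\<^sup>2 + d) - (max 0 s)\<^sup>2 * (2 * max 0 s + 0)) /
      (((max 0 s)\<^sup>2 + d) * ((max 0 s)\<^sup>2 + d)) = 2 * max 0 s * d / ((max 0 s)\<^sup>2 + d)\<^sup>2"
    by (simp add: power2_eq_square algebra_simps)
  ultimately show ?thesis by simp
qed

section \<open>Integration over a ball\<close>

lemma integral_lebesgue_on_eq_lborel:
  fixes f :: "'a::euclidean_space \<Rightarrow> 'b::euclidean_space"
  assumes "(\<lambda>x. indicator S x *\<^sub>R f x) \<in> borel_measurable borel" "S \<in> sets borel"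
  shows "(\<integral>x. f x \<partial>lebesgue_on S) = (\<integral>x. indicator S x *\<^sub>R f x \<partial>lborel)"
proof -
  have "(\<integral>x. f x \<partial>lebesgue_on S) = (\<integral>x. indicator S x *\<^sub>R f x \<partial>lebesgue)"
    using assms(2) by (subst integral_restrict_space) auto
  also have "\<dots> = (\<integral>x. indicator S x *\<^sub>R f x \<partial>lborel)"
    using assms(1) by (intro integral_completion) simp
  finally show ?thesis .
qed

lemma borel_measurable_indicator_continuous_on:
  fixes f :: "'a::euclidean_space \<Rightarrow> 'b::euclidean_space"
  assumes "continuous_on S f" "S \<in> sets borel"
  shows "(\<lambda>x. indicator S x *\<^sub>R f x) \<in> borel_measurable borel"
  using borel_measurable_continuous_on_indicator[OF assms(2,1)] .

lemma finite_measure_lebesgue_on_ball: "finite_measure (lebesgue_on (ball (0::'a::euclidean_space) r))"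
  by (rule finite_measureI) (simp add: emeasure_restrict_space emeasure_lborel_ball_finite[unfolded infinity_ennreal_def] less_top)

lemma integrable_lebesgue_on_ball:
  fixes f :: "'a::euclidean_space \<Rightarrow> 'b::euclidean_space"
  assumes "continuous_on (ball 0 r) f" "\<And>x. x \<in> ball 0 r \<Longrightarrow> norm (f x) \<le> K"
  shows "integrable (lebesgue_on (ball 0 r)) f"
proof -
  interpret finite_measure "lebesgue_on (ball (0::'a) r)"
    by (rule finite_measure_lebesgue_on_ball)
  show ?thesis
  proof (rule integrable_const_bound)
    show "AE x in lebesgue_on (ball 0 r). norm (f x) \<le> K"
      using assms(2) by (intro AE_I2) (auto simp: space_restrict_space)
    show "f \<in> borel_measurable (lebesgue_on (ball 0 r))"
      using assms(1) by (intro continuous_imp_measurable_on_sets_lebesgue) auto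
  qed
qed

lemma continuous_cball_integrable_lebesgue_on_ball:
  fixes f :: "'a::euclidean_space \<Rightarrow> 'b::euclidean_space"
  assumes "continuous_on (cball 0 r) f"
  shows "integrable (lebesgue_on (ball 0 r)) f"
proof -
  obtain K where "\<And>x. x \<in> cball 0 r \<Longrightarrow> norm (f x) \<le> K"
    using continuous_on_compact_bound[OF compact_cball assms] by metis
  then show ?thesis
    using continuous_on_subset[OF assms, of "ball 0 r"]
    by (intro integrable_lebesgue_on_ball[where K=K]) auto
qed

text \<open>Convexity of the ball turns bounds for the derivatives along the basis into a Lipschitz
  bound.\<close>

lemma C1_on_cball_lipschitz:
  fixes F :: "'a::euclidean_space \<Rightarrow> 'b::real_normed_vector"
  assumes "C1_on \<Omega> F" "cball 0 r \<subseteq> \<Omega>"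
  obtains L where "L > 0" "\<And>x y. x \<in> cball 0 r \<Longrightarrow> y \<in> cball 0 r \<Longrightarrow> norm (F x - F y) \<le> L * norm (x - y)"
proof -
  have "\<exists>L>0. \<forall>x\<in>cball 0 r. norm (frechet_derivative F (at x) b) \<le> L" for b
    using continuous_on_compact_bound[OF compact_cball
        continuous_on_subset[OF C1_on_continuous_deriv[OF assms(1)] assms(2)], of b] by metis
  then obtain L where L: "\<And>b. L b > 0"
    "\<And>b x. x \<in> cball 0 r \<Longrightarrow> norm (frechet_derivative F (at x) b) \<le> L b" by metis
  define M where "M = (\<Sum>b\<in>(Basis::'a set). L b) + 1"
  have M: "M > 0" unfolding M_def using L(1) by (simp add: add_nonneg_pos sum_nonneg less_imp_le)
  have "norm (F x - F y) \<le> M * norm (x - y)" if "x \<in> cball 0 r" "y \<in> cball 0 r" for x y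
  proof (rule differentiable_bound[OF convex_cball _ _ that])
    fix z :: 'a assume z: "z \<in> cball 0 r"
    then show "(F has_derivative frechet_derivative F (at z)) (at z within cball 0 r)"
      using C1_on_has_derivative[OF assms(1), of z] assms(2) by (blast intro: has_derivative_at_withinI)
    have lin: "linear (frechet_derivative F (at z))"
      using assms z by (intro linear_frechet_derivative) (auto simp: C1_on_def)
    show "onorm (frechet_derivative F (at z)) \<le> M"
    proof (rule onorm_le)
      fix v :: 'a
      have "frechet_derivative F (at z) v = (\<Sum>b\<in>Basis. (v \<bullet> b) *\<^sub>R frechet_derivative F (at z) b)"
        using linear_sum[OF lin, of "\<lambda>b. (v \<bullet> b) *\<^sub>R b" Basis]
        by (simp add: euclidean_representation linear_cmul[OF lin])
      also have "norm \<dots> \<le> (\<Sum>b\<in>Basis. norm v * L b)"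
        using L(2)[OF z] by (intro sum_norm_le) (auto intro!: mult_mono Basis_le_norm)
      also have "\<dots> \<le> M * norm v"
        by (simp only: M_def sum_distrib_left[symmetric]) (simp add: algebra_simps)
      finally show "norm (frechet_derivative F (at z) v) \<le> M * norm v" .
    qed
  qed
  then show ?thesis using M that by blast
qed

text \<open>No surface integral enters. Multiply F by a cut-off \<open>k d (e x)\<close> of the
  defining function e of the ball; the product has compact support, so its divergence integrates to
  zero. As d tends to zero, the term with the derivative of the cut-off disappears by dominated
  convergence: near the sphere the normal component of F is of order e, while
  \<open>k' d s * s\<close> is at most 1.\<close>

lemma integral_divergence_zero:
  fixes F :: "'a::euclidean_space \<Rightarrow> 'a"
  assumes r: "r > 0" and \<Omega>: "open \<Omega>" "cball 0 r \<subseteq> \<Omega>" and F: "C1_on \<Omega> F"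
    and bc: "\<And>x. norm x = r \<Longrightarrow> F x \<bullet> x = 0"
  shows "(\<integral>x. divergence F x \<partial>lebesgue_on (ball 0 r)) = 0"
proof -
  define e where "e = (\<lambda>x::'a. 1 - (x \<bullet> x) / r\<^sup>2)"
  define k where "k = (\<lambda>d s::real. (max 0 s)\<^sup>2 / ((max 0 s)\<^sup>2 + d))"
  define k' where "k' = (\<lambda>d s::real. 2 * max 0 s * d / ((max 0 s)\<^sup>2 + d)\<^sup>2)"
  \<comment> \<open>\<open>T d\<close> is the divergence of the field cut off at scale d, written
    out by the product rule.\<close>
  define T where "T = (\<lambda>d x. k d (e x) * divergence F x + ((k' d (e x) * (- 2 / r\<^sup>2)) *\<^sub>R x) \<bullet> F x)"
  have e_der: "(e has_derivative (\<lambda>v. ((- 2 / r\<^sup>2) *\<^sub>R x) \<bullet> v)) (at x)" for x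
  proof -
    have "((\<lambda>x. 1 - (1 / r\<^sup>2) * (x \<bullet> x)) has_derivative
        (\<lambda>v. 0 - (1 / r\<^sup>2) * (x \<bullet> v + v \<bullet> x))) (at x)"
      by (intro derivative_intros)
    then show ?thesis using r by (simp add: e_def inner_commute)
  qed
  have e_C1: "C1_on UNIV e"
    by (rule C1_onI[OF e_der]) (use r in \<open>auto intro!: continuous_intros\<close>)
  have k_der: "(k d has_real_derivative k' d s) (at s)" if "d > 0" for d s
    unfolding k_def k'_def by (rule has_real_derivative_square_cutoff[OF that])
  have k_pos: "(max 0 s)\<^sup>2 + d \<noteq> 0" if "d > 0" for d s :: real
    using that zero_le_power2[of "max 0 s"] by linarith
  have k'_cont: "continuous_on UNIV (k' d)" if "d > 0" for d
    unfolding k'_def using k_pos[OF that] by (intro continuous_intros) auto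
  have e_neg: "e x \<le> 0" if "norm x \<ge> r" for x
  proof -
    have "r\<^sup>2 \<le> x \<bullet> x"
      using that r by (metis less_imp_le power2_norm_eq_inner power_mono)
    then have "1 \<le> (x \<bullet> x) / r\<^sup>2"
      using r zero_less_power[OF r, of 2] by (subst le_divide_eq_1_pos) auto
    then show ?thesis by (simp add: e_def)
  qed
  have k0: "k d s = 0" "k' d s = 0" if "s \<le> 0" for d s
    using that by (auto simp: k_def k'_def)
  have zero: "(\<integral>x. T d x \<partial>lebesgue_on (ball 0 r)) = 0"
    and intT: "integrable (lebesgue_on (ball 0 r)) (T d)" if d: "d > 0" for d
  proof -
    \<comment> \<open>Off \<Omega> the field F is arbitrary, so the product is redefined as zero
      there; both descriptions agree on the overlap, which makes f C1 on the whole space.\<close>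
    define f where "f = (\<lambda>x. if x \<in> \<Omega> then k d (e x) *\<^sub>R F x else 0)"
    have keC1: "C1_on S (\<lambda>x. k d (e x))" for S
      using C1_on_real_compose[OF e_C1 k_der[OF d] k'_cont[OF d]] by (auto intro: C1_on_subset)
    have f_out: "f x = 0" if "norm x \<ge> r" for x
      using k0 e_neg[OF that] by (simp add: f_def)
    have "C1_on (\<Omega> \<union> - cball 0 r) f"
    proof (rule C1_on_Un)
      show "C1_on \<Omega> f"
        by (rule C1_on_cong[OF \<Omega>(1) C1_on_scaleR[OF keC1 F]]) (simp add: f_def)
      show "C1_on (- cball 0 r) f"
        by (rule C1_on_cong[OF _ C1_on_const[of _ 0]]) (auto simp: f_out)
    qed (use \<Omega> in auto)
    moreover have "\<Omega> \<union> - cball 0 r = UNIV" using \<Omega>(2) by auto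
    ultimately have fC1: "C1_on UNIV f" by simp
    have bl: "bounded_linear (\<lambda>y. y \<bullet> b)" for b :: 'a by (rule bounded_linear_inner_left)
    have fb: "frechet_derivative (\<lambda>x. f x \<bullet> b) (at x) b = frechet_derivative f (at x) b \<bullet> b" for x b
    proof -
      have "((\<lambda>x. f x \<bullet> b) has_derivative (\<lambda>v. frechet_derivative f (at x) v \<bullet> b)) (at x)"
        by (rule bounded_linear.has_derivative[OF bl C1_on_has_derivative[OF fC1 UNIV_I]])
      from frechet_derivative_at[OF this] show ?thesis by metis
    qed
    have "integrable lborel (\<lambda>x. frechet_derivative f (at x) b \<bullet> b)"
        "(\<integral>x. frechet_derivative f (at x) b \<bullet> b \<partial>lborel) = 0" for b
      using integral_directional_derivative_zero[OF C1_on_linear_compose[OF bl[of b] fC1], of r b] f_out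
      by (simp_all add: fb)
    then have div0: "integrable lborel (divergence f)" "(\<integral>x. divergence f x \<partial>lborel) = 0"
      unfolding divergence_def by (simp_all add: integrable_sum integral_sum)
    have div_eq: "divergence f x = indicator (ball 0 r) x *\<^sub>R T d x" for x
    proof (cases "x \<in> \<Omega>")
      case True
      have "((\<lambda>x. k d (e x)) has_derivative (\<lambda>v. ((k' d (e x) * (- 2 / r\<^sup>2)) *\<^sub>R x) \<bullet> v)) (at x)"
        using has_derivative_compose[OF e_der, of "k d" "(*) (k' d (e x))" x] k_der[OF d, of "e x"]
        by (simp add: has_field_derivative_def mult.assoc)
      then have "divergence (\<lambda>x. k d (e x) *\<^sub>R F x) x = T d x"
        unfolding T_def using F True
        by (intro divergence_scaleR) (auto simp: C1_on_def)
      moreover have "divergence f x = divergence (\<lambda>x. k d (e x) *\<^sub>R F x) x"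
        by (rule divergence_cong[OF \<Omega>(1) True]) (simp add: f_def)
      moreover have "T d x = 0" if "norm x \<ge> r"
        using k0 e_neg[OF that] by (simp add: T_def)
      ultimately show ?thesis by (cases "norm x \<ge> r") auto
    next
      case False
      then have out: "x \<notin> cball 0 r" using \<Omega>(2) by auto
      have "divergence f x = divergence (\<lambda>x. 0) x"
        by (rule divergence_cong[of "- cball 0 r"]) (use out f_out in auto)
      also have "\<dots> = 0" using divergence_eq[OF has_derivative_const] by simp
      finally show ?thesis using out by simp
    qed
    have meas: "(\<lambda>x. indicator (ball 0 r) x *\<^sub>R T d x) \<in> borel_measurable borel"
      using borel_measurable_integrable[OF div0(1)] by (simp add: div_eq[abs_def])
    have "(\<integral>x. T d x \<partial>lebesgue_on (ball 0 r)) = (\<integral>x. indicator (ball 0 r) x *\<^sub>R T d x \<partial>lborel)"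
      by (rule integral_lebesgue_on_eq_lborel[OF meas]) simp
    then show "(\<integral>x. T d x \<partial>lebesgue_on (ball 0 r)) = 0"
      using div0(2) by (simp add: div_eq[abs_def])
    have "integrable lebesgue (\<lambda>x. indicator (ball 0 r) x *\<^sub>R T d x)"
      using div0(1) meas by (subst integrable_completion) (simp_all add: div_eq[abs_def])
    then show "integrable (lebesgue_on (ball 0 r)) (T d)"
      by (subst integrable_restrict_space) auto
  qed
  have cdiv: "continuous_on (cball 0 r) (divergence F)"
    unfolding divergence_def
    using continuous_on_subset[OF C1_on_continuous_deriv[OF F] \<Omega>(2)] by (intro continuous_intros) auto
  obtain K where K: "K > 0" "\<And>x. x \<in> cball 0 r \<Longrightarrow> norm (divergence F x) \<le> K"
    using continuous_on_compact_bound[OF compact_cball cdiv] by blast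
  obtain L where L: "L > 0" "\<And>x y. x \<in> cball 0 r \<Longrightarrow> y \<in> cball 0 r \<Longrightarrow> norm (F x - F y) \<le> L * norm (x - y)"
    using C1_on_cball_lipschitz[OF F \<Omega>(2)] by blast
  have e_pos: "e x > 0" "e x \<ge> (r - norm x) / r" if "x \<in> ball 0 r" for x
  proof -
    have n: "norm x < r" using that by simp
    have "e x = (r - norm x) * (r + norm x) / r\<^sup>2"
      using r by (simp add: e_def power2_norm_eq_inner[symmetric] field_simps power2_eq_square)
    moreover have "(r - norm x) * (r + norm x) / r\<^sup>2 \<ge> (r - norm x) * r / r\<^sup>2"
      using n r by (intro divide_right_mono mult_left_mono) auto
    moreover have "(r - norm x) * r / r\<^sup>2 = (r - norm x) / r" using r by (simp add: power2_eq_square)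
    ultimately show "e x \<ge> (r - norm x) / r" by simp
    moreover have "(r - norm x) / r > 0" using n r by simp
    ultimately show "e x > 0" by linarith
  qed
  have normal: "\<bar>x \<bullet> F x\<bar> \<le> r\<^sup>2 * L * e x" if x: "x \<in> ball 0 r" for x
  proof (cases "x = 0")
    case True
    then show ?thesis using e_pos[OF x] L r by simp
  next
    case False
    \<comment> \<open>Compare with the radial projection p to the sphere, where the normal component
      vanishes; the distance to p is \<open>r - norm x\<close>, which \<open>e\<close>
      controls.\<close>
    define p where "p = (r / norm x) *\<^sub>R x"
    have p: "norm p = r" using False r by (simp add: p_def)
    have n: "norm x < r" using x by simp
    have "x \<bullet> F p = 0"
      using bc[OF p] False r by (simp add: p_def inner_commute)
    then have "\<bar>x \<bullet> F x\<bar> = \<bar>x \<bullet> (F x - F p)\<bar>" by (simp add: inner_diff_right)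
    also have "\<dots> \<le> norm x * norm (F x - F p)" by (rule Cauchy_Schwarz_ineq2)
    also have "\<dots> \<le> r * (L * norm (x - p))"
      using n p r x by (intro mult_mono L(2)) auto
    also have "norm (x - p) = r - norm x"
    proof -
      have "x - p = ((norm x - r) / norm x) *\<^sub>R x"
        using False by (simp add: p_def algebra_simps diff_divide_distrib)
      then show ?thesis using False n by simp
    qed
    also have "r * (L * (r - norm x)) = r\<^sup>2 * L * ((r - norm x) / r)"
      using r by (simp add: power2_eq_square)
    also have "\<dots> \<le> r\<^sup>2 * L * e x"
      using e_pos(2)[OF x] L by (intro mult_left_mono) auto
    finally show ?thesis .
  qed
  define \<delta> where "\<delta> = (\<lambda>n. 1 / real (Suc n))"
  have \<delta>: "\<delta> n > 0" for n by (simp add: \<delta>_def)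
  have \<delta>0: "\<delta> \<longlonglongrightarrow> 0" unfolding \<delta>_def by (rule LIMSEQ_Suc[OF lim_1_over_n])
  have k'_bound: "k' d s * s \<le> 1" "k' d s \<ge> 0" if "d > 0" "s > 0" for d s
  proof -
    have "(s\<^sup>2 + d)\<^sup>2 = 2 * s * d * s + (s\<^sup>2)\<^sup>2 + d\<^sup>2"
      by (simp add: power2_eq_square algebra_simps)
    then have "2 * s * d * s \<le> (s\<^sup>2 + d)\<^sup>2" by simp
    moreover have "(s\<^sup>2 + d)\<^sup>2 > 0" using that by (intro zero_less_power add_pos_pos) auto
    ultimately show "k' d s * s \<le> 1" using that by (simp add: k'_def)
    show "k' d s \<ge> 0" using that by (simp add: k'_def)
  qed
  have "(\<lambda>n. \<integral>x. T (\<delta> n) x \<partial>lebesgue_on (ball 0 r)) \<longlonglongrightarrow> (\<integral>x. divergence F x \<partial>lebesgue_on (ball 0 r))"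
  proof (rule integral_dominated_convergence[where w = "\<lambda>x. K + 2 * L"])
    show "integrable (lebesgue_on (ball (0::'a) r)) (\<lambda>x. K + 2 * L)"
      by (rule continuous_cball_integrable_lebesgue_on_ball) auto
    show "divergence F \<in> borel_measurable (lebesgue_on (ball 0 r))"
      using continuous_cball_integrable_lebesgue_on_ball[OF cdiv] by auto
    show "T (\<delta> n) \<in> borel_measurable (lebesgue_on (ball 0 r))" for n
      using intT[OF \<delta>] by auto
    show "AE x in lebesgue_on (ball 0 r). (\<lambda>n. T (\<delta> n) x) \<longlonglongrightarrow> divergence F x"
    proof (rule AE_I2)
      fix x :: 'a assume "x \<in> space (lebesgue_on (ball 0 r))"
      then have x: "x \<in> ball 0 r" by (simp add: space_restrict_space)
      let ?s = "max 0 (e x)"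
      have s: "?s > 0" using e_pos[OF x] by simp
      have a: "(\<lambda>n. k (\<delta> n) (e x)) \<longlonglongrightarrow> ?s\<^sup>2 / (?s\<^sup>2 + 0)"
        unfolding k_def using s by (intro tendsto_intros \<delta>0) auto
      have b: "(\<lambda>n. k' (\<delta> n) (e x)) \<longlonglongrightarrow> 2 * ?s * 0 / (?s\<^sup>2 + 0)\<^sup>2"
        unfolding k'_def using s by (intro tendsto_intros \<delta>0) auto
      have "(\<lambda>n. T (\<delta> n) x) \<longlonglongrightarrow> 1 * divergence F x + ((0 * (- 2 / r\<^sup>2)) *\<^sub>R x) \<bullet> F x"
        unfolding T_def using a b s by (intro tendsto_intros) (auto split: if_splits)
      then show "(\<lambda>n. T (\<delta> n) x) \<longlonglongrightarrow> divergence F x" by simp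
    qed
    show "AE x in lebesgue_on (ball 0 r). norm (T (\<delta> n) x) \<le> K + 2 * L" for n
    proof (rule AE_I2)
      fix x :: 'a assume "x \<in> space (lebesgue_on (ball 0 r))"
      then have x: "x \<in> ball 0 r" by (simp add: space_restrict_space)
      let ?k' = "k' (\<delta> n) (e x)"
      note kb = k'_bound[OF \<delta>[of n] e_pos(1)[OF x]]
      have "0 \<le> k (\<delta> n) (e x)" "k (\<delta> n) (e x) \<le> 1"
        using \<delta>[of n] zero_le_power2[of "max 0 (e x)"] by (auto simp: k_def divide_le_eq_1 add_nonneg_pos)
      then have 1: "\<bar>k (\<delta> n) (e x) * divergence F x\<bar> \<le> K"
        using mult_mono[of "\<bar>k (\<delta> n) (e x)\<bar>" 1 "\<bar>divergence F x\<bar>" K] K(2)[of x] x by (auto simp: abs_mult)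
      have "\<bar>((?k' * (- 2 / r\<^sup>2)) *\<^sub>R x) \<bullet> F x\<bar> = ?k' * (2 / r\<^sup>2) * \<bar>x \<bullet> F x\<bar>"
        using kb(2) by (simp add: abs_mult)
      also have "\<dots> \<le> ?k' * (2 / r\<^sup>2) * (r\<^sup>2 * L * e x)"
        using kb(2) normal[OF x] by (intro mult_left_mono) auto
      also have "\<dots> = (?k' * e x) * (2 * L)" using r by simp
      also have "\<dots> \<le> 1 * (2 * L)" using kb(1) L by (intro mult_right_mono) auto
      finally show "norm (T (\<delta> n) x) \<le> K + 2 * L"
        using 1 unfolding T_def real_norm_def by linarith
    qed
  qed
  then show ?thesis using zero[OF \<delta>] LIMSEQ_unique[OF _ tendsto_const] by auto
qed

subsection \<open>A Morrey--Poincare inequality on balls\<close>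

lemma nn_integral_ball_affine:
  fixes f :: "'a::euclidean_space \<Rightarrow> ennreal"
  assumes [measurable]: "f \<in> borel_measurable borel" and s: "s > 0"
  shows "(\<integral>\<^sup>+\<omega>. f (c + s *\<^sub>R \<omega>) * indicator (ball 0 1) \<omega> \<partial>lborel) =
    ennreal (1 / s ^ DIM('a)) * (\<integral>\<^sup>+z. f z * indicator (ball c s) z \<partial>lborel)"
proof -
  let ?T = "\<lambda>\<omega>::'a. c + s *\<^sub>R \<omega>"
  have [measurable]: "ball c s \<in> sets borel" by simp
  have fm: "(\<lambda>z. f z * indicator (ball c s) z) \<in> borel_measurable borel" by measurable
  have ind: "indicator (ball c s) (?T \<omega>) = (indicator (ball 0 1) \<omega> :: ennreal)" for \<omega>
    using s by (auto simp: indicator_def dist_norm)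
  have "(\<integral>\<^sup>+z. f z * indicator (ball c s) z \<partial>lborel) =
      (\<integral>\<^sup>+z. f z * indicator (ball c s) z \<partial>density (distr lborel borel ?T) (\<lambda>_. ennreal (\<bar>s\<bar> ^ DIM('a))))"
    using s by (subst lborel_affine[of s c]) auto
  also have "\<dots> = ennreal (s ^ DIM('a)) * (\<integral>\<^sup>+z. f z * indicator (ball c s) z \<partial>distr lborel borel ?T)"
    using s fm by (subst nn_integral_density) (auto intro!: nn_integral_cmult)
  also have "(\<integral>\<^sup>+z. f z * indicator (ball c s) z \<partial>distr lborel borel ?T) =
      (\<integral>\<^sup>+\<omega>. f (?T \<omega>) * indicator (ball 0 1) \<omega> \<partial>lborel)"
    using fm by (subst nn_integral_distr) (auto simp: ind)
  finally have "(\<integral>\<^sup>+z. f z * indicator (ball c s) z \<partial>lborel) =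
      ennreal (s ^ DIM('a)) * (\<integral>\<^sup>+\<omega>. f (?T \<omega>) * indicator (ball 0 1) \<omega> \<partial>lborel)" .
  then show ?thesis
    using s by (simp add: mult.assoc[symmetric] ennreal_mult[symmetric])
qed

text \<open>The map \<open>x \<mapsto> (1 - s / r) x + s \<omega>\<close> keeps the ball of radius \<open>r\<close> invariant and moves points
  by less than \<open>2 s\<close>, so averages over \<open>\<omega>\<close> never leave the domain.\<close>

lemma shrink_in_ball:
  fixes x \<omega> :: "'a::real_normed_vector"
  assumes "r \<ge> 1" "0 \<le> s" "s \<le> 1" "norm x < r" "norm \<omega> < 1"
  shows "norm ((1 - s / r) *\<^sub>R x + s *\<^sub>R \<omega>) < r"
proof -
  have "s / r \<le> 1" using assms by simp
  have "norm ((1 - s / r) *\<^sub>R x + s *\<^sub>R \<omega>) \<le> (1 - s / r) * norm x + s * norm \<omega>"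
    using norm_triangle_ineq[of "(1 - s / r) *\<^sub>R x" "s *\<^sub>R \<omega>"] assms \<open>s / r \<le> 1\<close> by simp
  also have "\<dots> < r"
  proof (cases "s = 0")
    case False
    have "(1 - s / r) * norm x \<le> (1 - s / r) * r"
      using assms \<open>s / r \<le> 1\<close> by (intro mult_left_mono) auto
    also have "\<dots> = r - s" using assms by (simp add: field_simps)
    finally have "(1 - s / r) * norm x \<le> r - s" .
    moreover have "s * norm \<omega> < s * 1" using False assms by (intro mult_strict_left_mono) auto
    ultimately show ?thesis by simp
  qed (use assms in auto)
  finally show ?thesis .
qed

text \<open>For fixed x the averaging points z fill a ball of radius s about
  \<open>(1 - s / r) *\<^sub>R x\<close>, hence lie within 2 s of x when \<open>norm x < r\<close>.
  Passing from \<omega> to z costs the Jacobian \<open>1 / s ^ DIM('a)\<close>; after Fubini the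
  weight G is integrated over \<open>ball z (2 * s)\<close>, where C bounds it.\<close>

lemma nn_integral_shrink_average:
  fixes G f :: "'a::euclidean_space \<Rightarrow> ennreal"
  assumes [measurable]: "f \<in> borel_measurable borel" "G \<in> borel_measurable borel"
    and r: "r \<ge> 1" and s: "0 < s" "s \<le> 1"
    and C: "\<And>z. (\<integral>\<^sup>+x. G x * indicator (ball z (2 * s)) x \<partial>lborel) \<le> C"
    and supp: "\<And>x. norm x \<ge> r \<Longrightarrow> G x = 0"
  shows "(\<integral>\<^sup>+x. G x * (\<integral>\<^sup>+\<omega>. f ((1 - s / r) *\<^sub>R x + s *\<^sub>R \<omega>) * indicator (ball 0 1) \<omega> \<partial>lborel) \<partial>lborel)
    \<le> ennreal (1 / s ^ DIM('a)) * C * (\<integral>\<^sup>+z. f z \<partial>lborel)"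
proof -
  let ?c = "ennreal (1 / s ^ DIM('a))"
  have [measurable]: "ball z (2 * s) \<in> sets borel" for z :: 'a by simp
  define I :: "'a \<Rightarrow> 'a \<Rightarrow> ennreal" where "I = (\<lambda>x z. if norm (x - z) < 2 * s then 1 else 0)"
  have [measurable]: "(\<lambda>(x, z). I x z) \<in> borel_measurable (borel \<Otimes>\<^sub>M borel)"
    unfolding I_def by measurable
  have I_ind: "I x z = indicator (ball z (2 * s)) x" for x z
    by (auto simp: I_def indicator_def dist_norm norm_minus_commute)
  have inner: "G x * (\<integral>\<^sup>+\<omega>. f ((1 - s / r) *\<^sub>R x + s *\<^sub>R \<omega>) * indicator (ball 0 1) \<omega> \<partial>lborel)
      \<le> ?c * (\<integral>\<^sup>+z. G x * (f z * I x z) \<partial>lborel)" for x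
  proof (cases "norm x < r")
    case True
    have "(\<integral>\<^sup>+\<omega>. f ((1 - s / r) *\<^sub>R x + s *\<^sub>R \<omega>) * indicator (ball 0 1) \<omega> \<partial>lborel)
        = ?c * (\<integral>\<^sup>+z. f z * indicator (ball ((1 - s / r) *\<^sub>R x) s) z \<partial>lborel)"
      by (rule nn_integral_ball_affine) (use s in auto)
    also have "\<dots> \<le> ?c * (\<integral>\<^sup>+z. f z * I x z \<partial>lborel)"
    proof (rule mult_left_mono[OF nn_integral_mono])
      fix z
      have "norm (x - z) < 2 * s" if "z \<in> ball ((1 - s / r) *\<^sub>R x) s"
      proof -
        have "x - z = (s / r) *\<^sub>R x + ((1 - s / r) *\<^sub>R x - z)" by (simp add: algebra_simps)
        then have "norm (x - z) \<le> norm ((s / r) *\<^sub>R x) + norm ((1 - s / r) *\<^sub>R x - z)"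
          by (metis norm_triangle_ineq)
        moreover have "norm ((s / r) *\<^sub>R x) \<le> s"
          using True r s by (simp add: field_simps)
        moreover have "norm ((1 - s / r) *\<^sub>R x - z) < s"
          using that by (simp add: dist_norm)
        ultimately show ?thesis by simp
      qed
      then show "f z * indicator (ball ((1 - s / r) *\<^sub>R x) s) z \<le> f z * I x z"
        by (auto simp: I_def indicator_def)
    qed auto
    finally have "G x * (\<integral>\<^sup>+\<omega>. f ((1 - s / r) *\<^sub>R x + s *\<^sub>R \<omega>) * indicator (ball 0 1) \<omega> \<partial>lborel)
      \<le> G x * (?c * (\<integral>\<^sup>+z. f z * I x z \<partial>lborel))" by (rule mult_left_mono) simp
    also have "\<dots> = ?c * (\<integral>\<^sup>+z. G x * (f z * I x z) \<partial>lborel)"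
      by (subst nn_integral_cmult) (auto simp: ac_simps)
    finally show ?thesis .
  qed (use supp[of x] in simp)
  have "(\<integral>\<^sup>+x. G x * (\<integral>\<^sup>+\<omega>. f ((1 - s / r) *\<^sub>R x + s *\<^sub>R \<omega>) * indicator (ball 0 1) \<omega> \<partial>lborel) \<partial>lborel)
      \<le> (\<integral>\<^sup>+x. ?c * (\<integral>\<^sup>+z. G x * (f z * I x z) \<partial>lborel) \<partial>lborel)"
    by (rule nn_integral_mono) (rule inner)
  also have "\<dots> = ?c * (\<integral>\<^sup>+x. (\<integral>\<^sup>+z. G x * (f z * I x z) \<partial>lborel) \<partial>lborel)"
    by (rule nn_integral_cmult) measurable
  also have "(\<integral>\<^sup>+x. (\<integral>\<^sup>+z. G x * (f z * I x z) \<partial>lborel) \<partial>lborel) =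
      (\<integral>\<^sup>+z. (\<integral>\<^sup>+x. G x * (f z * I x z) \<partial>lborel) \<partial>lborel)"
    by (rule lborel_pair.Fubini'[symmetric]) measurable
  also have "\<dots> = (\<integral>\<^sup>+z. f z * (\<integral>\<^sup>+x. G x * indicator (ball z (2 * s)) x \<partial>lborel) \<partial>lborel)"
  proof (rule nn_integral_cong)
    fix z
    have "(\<integral>\<^sup>+x. G x * (f z * I x z) \<partial>lborel) = (\<integral>\<^sup>+x. f z * (G x * indicator (ball z (2 * s)) x) \<partial>lborel)"
      by (simp add: I_ind ac_simps)
    also have "\<dots> = f z * (\<integral>\<^sup>+x. G x * indicator (ball z (2 * s)) x \<partial>lborel)"
      by (rule nn_integral_cmult) measurable
    finally show "(\<integral>\<^sup>+x. G x * (f z * I x z) \<partial>lborel) =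
      f z * (\<integral>\<^sup>+x. G x * indicator (ball z (2 * s)) x \<partial>lborel)" .
  qed
  also have "\<dots> \<le> (\<integral>\<^sup>+z. f z * C \<partial>lborel)"
    by (intro nn_integral_mono mult_left_mono C) auto
  also have "\<dots> = C * (\<integral>\<^sup>+z. f z \<partial>lborel)"
    by (subst nn_integral_multc) (auto simp: mult.commute)
  finally show ?thesis by (simp add: mult.assoc mult_left_mono)
qed

text \<open>Doubling the larger summand gives the factor 4 and avoids differences, which are
  truncated in \<open>ennreal\<close>.\<close>

lemma ennreal_add_square_le: "(a + b :: ennreal)\<^sup>2 \<le> 4 * a\<^sup>2 + 4 * b\<^sup>2"
proof (cases "a \<le> b")
  case True
  then have "(a + b)\<^sup>2 \<le> (b + b)\<^sup>2" by (intro power_mono add_right_mono) auto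
  also have "\<dots> = 4 * b\<^sup>2" by (simp add: mult_2[symmetric] power_mult_distrib)
  also have "\<dots> \<le> 4 * a\<^sup>2 + 4 * b\<^sup>2" by simp
  finally show ?thesis .
next
  case False
  then have "(a + b)\<^sup>2 \<le> (a + a)\<^sup>2" by (intro power_mono add_left_mono) auto
  also have "\<dots> = 4 * a\<^sup>2" by (simp add: mult_2[symmetric] power_mult_distrib)
  also have "\<dots> \<le> 4 * a\<^sup>2 + 4 * b\<^sup>2" by simp
  finally show ?thesis .
qed

lemma nn_integral_powr_interval:
  assumes "a > -1" "h \<ge> 0"
  shows "(\<integral>\<^sup>+s. ennreal (s powr a) * indicator {0<..h} s \<partial>lborel) = ennreal (h powr (a + 1) / (a + 1))"
proof -
  have "((\<lambda>s. s powr a) has_integral (h powr (a+1) / (a+1))) {0..h}"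
    by (rule has_integral_powr_from_0) (use assms in auto)
  then have "((\<lambda>s. if s \<in> {0..h} then s powr a else 0) has_integral (h powr (a+1) / (a+1))) UNIV"
    by (subst has_integral_restrict_UNIV)
  moreover have "(\<lambda>s. if s \<in> {0..h} then s powr a else 0) = (\<lambda>s. s powr a * indicator {0<..h} s)"
    by (auto simp: fun_eq_iff indicator_def)
  ultimately have "((\<lambda>s. s powr a * indicator {0<..h} s) has_integral (h powr (a+1) / (a+1))) UNIV"
    by simp
  then have "(\<integral>\<^sup>+s. ennreal (s powr a * indicator {0<..h} s) \<partial>lborel) = ennreal (h powr (a + 1) / (a + 1))"
    by (intro nn_integral_has_integral_lborel) auto
  then show ?thesis by (simp add: ennreal_mult' ennreal_indicator)
qed

text \<open>The curve has constant velocity \<open>\<omega> - x /\<^sub>R r\<close>, of norm at most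
  2, and stays in the ball, so the fundamental theorem of calculus applies along it. Nonnegativity
  of w at the endpoint allows the passage to \<open>ennreal\<close>.\<close>

lemma segment_bound:
  fixes w :: "'a::euclidean_space \<Rightarrow> real"
  assumes w: "C1_on \<Omega> w" and \<Omega>: "cball 0 r \<subseteq> \<Omega>" and r: "r \<ge> 1" and h: "0 < h" "h \<le> 1"
    and wpos: "\<And>x. x \<in> ball 0 r \<Longrightarrow> w x \<ge> 0"
    and x: "norm x < r" and \<omega>: "norm \<omega> < 1"
  defines "\<gamma> \<equiv> (\<lambda>s. (1 - s / r) *\<^sub>R x + s *\<^sub>R \<omega>)"
  shows "ennreal (w x) \<le> ennreal (w (\<gamma> h)) +
    (\<integral>\<^sup>+s. ennreal (2 * norm (gradient w (at (\<gamma> s)))) * indicator {0<..h} s \<partial>lborel)"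
proof -
  let ?g = "\<lambda>s. 2 * norm (gradient w (at (\<gamma> s)))"
  have in_ball: "\<gamma> s \<in> ball 0 r" if "s \<in> {0..h}" for s
    using shrink_in_ball[OF r _ _ x \<omega>, of s] that h by (simp add: \<gamma>_def)
  then have in_\<Omega>: "\<gamma> s \<in> \<Omega>" if "s \<in> {0..h}" for s
    using that \<Omega> ball_subset_cball by blast
  define D where "D = (\<lambda>s. gradient w (at (\<gamma> s)) \<bullet> (\<omega> - x /\<^sub>R r))"
  have \<gamma>_cont: "continuous_on {0..h} \<gamma>"
    using r unfolding \<gamma>_def by (intro continuous_intros) auto
  have g_cont: "continuous_on {0..h} ?g"
    using continuous_on_compose2[OF continuous_on_gradient[OF w] \<gamma>_cont] in_\<Omega>
    by (intro continuous_intros) blast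
  have "(D has_integral w (\<gamma> h) - w (\<gamma> 0)) {0..h}"
  proof (rule fundamental_theorem_of_calculus)
    fix s assume s: "s \<in> {0..h}"
    have "(\<gamma> has_derivative (\<lambda>k. k *\<^sub>R (\<omega> - x /\<^sub>R r))) (at s within {0..h})"
      using r unfolding \<gamma>_def
      by (auto intro!: derivative_eq_intros simp: algebra_simps divide_inverse)
    from has_derivative_compose[OF this C1_on_gradient[OF w in_\<Omega>[OF s]]]
    show "((\<lambda>s. w (\<gamma> s)) has_vector_derivative D s) (at s within {0..h})"
      by (simp add: has_vector_derivative_def D_def)
  qed (use h in auto)
  then have 1: "((\<lambda>s. - D s) has_integral - (w (\<gamma> h) - w (\<gamma> 0))) {0..h}"
    by (rule has_integral_neg)
  have 2: "(?g has_integral integral {0..h} ?g) {0..h}"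
    using integrable_continuous_interval[OF g_cont] by (rule integrable_integral)
  have le: "- D s \<le> ?g s" for s
  proof -
    have "norm (\<omega> - x /\<^sub>R r) \<le> norm \<omega> + norm (x /\<^sub>R r)" by (rule norm_triangle_ineq4)
    also have "\<dots> \<le> 1 + 1"
      using \<omega> x r by (intro add_mono) (auto simp: field_simps)
    finally have n: "norm (\<omega> - x /\<^sub>R r) \<le> 2" by simp
    have "- D s \<le> norm (gradient w (at (\<gamma> s))) * norm (\<omega> - x /\<^sub>R r)"
      unfolding D_def using Cauchy_Schwarz_ineq2[of "gradient w (at (\<gamma> s))" "\<omega> - x /\<^sub>R r"] by linarith
    also have "\<dots> \<le> norm (gradient w (at (\<gamma> s))) * 2"
      using n by (intro mult_left_mono) auto
    finally show ?thesis by simp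
  qed
  have "- (w (\<gamma> h) - w (\<gamma> 0)) \<le> integral {0..h} ?g"
    by (rule has_integral_le[OF 1 2 le])
  then have "w x \<le> w (\<gamma> h) + integral {0..h} ?g" by (simp add: \<gamma>_def)
  moreover have "w (\<gamma> h) \<ge> 0" using in_ball[of h] h wpos by auto
  moreover have "integral {0..h} ?g \<ge> 0" by (intro Henstock_Kurzweil_Integration.integral_nonneg integrable_continuous_interval g_cont) auto
  ultimately have "ennreal (w x) \<le> ennreal (w (\<gamma> h)) + ennreal (integral {0..h} ?g)"
    by (simp add: ennreal_plus[symmetric] ennreal_leI del: ennreal_plus)
  also have "ennreal (integral {0..h} ?g) = (\<integral>\<^sup>+s. ennreal (?g s) * indicator {0<..h} s \<partial>lborel)"
  proof -
    have "((\<lambda>s. indicator {0..h} s *\<^sub>R ?g s) has_integral integral {0..h} ?g) UNIV"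
    proof -
      have "((\<lambda>s. if s \<in> {0..h} then ?g s else 0) has_integral integral {0..h} ?g) UNIV"
        using 2 by (subst has_integral_restrict_UNIV)
      moreover have "(\<lambda>s. if s \<in> {0..h} then ?g s else 0) = (\<lambda>s. indicator {0..h} s *\<^sub>R ?g s)"
        by (auto simp: fun_eq_iff indicator_def)
      ultimately show ?thesis by simp
    qed
    then have "(\<integral>\<^sup>+s. ennreal (indicator {0..h} s *\<^sub>R ?g s) \<partial>lborel) = ennreal (integral {0..h} ?g)"
      by (intro nn_integral_has_integral_lborel borel_measurable_continuous_on_indicator g_cont) auto
    moreover have "(\<integral>\<^sup>+s. ennreal (indicator {0..h} s *\<^sub>R ?g s) \<partial>lborel) =
        (\<integral>\<^sup>+s. ennreal (?g s) * indicator {0<..h} s \<partial>lborel)"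
    proof (rule nn_integral_cong_AE)
      show "AE s in lborel. ennreal (indicator {0..h} s *\<^sub>R ?g s) = ennreal (?g s) * indicator {0<..h} s"
        using AE_lborel_singleton[of 0] by eventually_elim (auto simp: indicator_def)
    qed
    ultimately show ?thesis by simp
  qed
  finally show ?thesis .
qed

lemma nn_integral_ball_eq_integral:
  fixes f :: "'a::euclidean_space \<Rightarrow> real"
  assumes "continuous_on (cball 0 r) f" "\<And>x. x \<in> ball 0 r \<Longrightarrow> f x \<ge> 0"
  shows "(\<integral>\<^sup>+x. ennreal (f x) * indicator (ball 0 r) x \<partial>lborel) =
    ennreal (\<integral>x. f x \<partial>lebesgue_on (ball 0 r))"
proof -
  have "(\<integral>\<^sup>+x. ennreal (f x) * indicator (ball 0 r) x \<partial>lborel) =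
      (\<integral>\<^sup>+x. ennreal (f x) * indicator (ball 0 r) x \<partial>lebesgue)"
    by (rule nn_integral_completion[symmetric])
  also have "\<dots> = (\<integral>\<^sup>+x. ennreal (f x) \<partial>lebesgue_on (ball 0 r))"
    by (rule nn_integral_restrict_space[symmetric]) simp
  also have "\<dots> = ennreal (\<integral>x. f x \<partial>lebesgue_on (ball 0 r))"
    using assms by (intro nn_integral_eq_integral continuous_cball_integrable_lebesgue_on_ball AE_I2)
      (auto simp: space_restrict_space)
  finally show ?thesis .
qed

text \<open>Average \<open>segment_bound\<close> over \<omega> in the unit ball: \<beta> w is at
  most a + 2 b, where a averages w at scale h and b integrates the averages c of the gradient over
  all scales s below h. The Morrey bound for G at radius 2 s against the Jacobian
  \<open>1 / s ^ DIM('a)\<close> leaves s to the power 2 \<alpha> - 2. Cauchy--Schwarz in s with the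
  weight \<open>s powr (\<alpha> - 1)\<close> turns this into an integrable singularity; here
  \<alpha> > 0 is essential.\<close>

lemma morrey_poincare_nn:
  fixes w :: "'a::euclidean_space \<Rightarrow> real" and G :: "'a \<Rightarrow> ennreal"
  assumes w: "C1_on \<Omega> w" and \<Omega>: "cball 0 r \<subseteq> \<Omega>" and r: "r \<ge> 1" and h: "0 < h" "h \<le> 1"
    and wpos: "\<And>x. x \<in> ball 0 r \<Longrightarrow> w x \<ge> 0"
    and \<alpha>: "0 < \<alpha>" and \<Lambda>: "\<Lambda> \<ge> 0"
    and Gm[measurable]: "G \<in> borel_measurable borel"
    and G0: "\<And>x. norm x \<ge> r \<Longrightarrow> G x = 0"
    and GM: "\<And>z \<rho>. 0 < \<rho> \<Longrightarrow> \<rho> \<le> 2 \<Longrightarrow> (\<integral>\<^sup>+x. G x * indicator (ball z \<rho>) x \<partial>lborel)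
      \<le> ennreal (\<Lambda> * \<rho> powr (real DIM('a) - 2 + 2 * \<alpha>))"
  defines "\<beta> \<equiv> unit_ball_vol (real DIM('a))"
    and "\<kappa> \<equiv> real DIM('a) - 2 + 2 * \<alpha>"
    and "S \<equiv> ball (0::'a) r"
  shows "ennreal (\<beta>\<^sup>2) * (\<integral>\<^sup>+x. G x * (ennreal (w x))\<^sup>2 \<partial>lborel) \<le>
    ennreal (4 * \<Lambda> * 2 powr \<kappa> * h powr (\<kappa> - 2 * real DIM('a))) * (\<integral>\<^sup>+x. ennreal (w x) * indicator S x \<partial>lborel)\<^sup>2 +
    ennreal (16 * \<Lambda> * 2 powr \<kappa> * \<beta> * (h powr \<alpha> / \<alpha>)\<^sup>2) *
      (\<integral>\<^sup>+x. ennreal ((norm (gradient w (at x)))\<^sup>2) * indicator S x \<partial>lborel)"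
proof -
  let ?d = "DIM('a)"
  let ?B = "ball (0::'a) 1"
  define T where "T = (\<lambda>s x \<omega>. (1 - s / r) *\<^sub>R x + s *\<^sub>R (\<omega>::'a))"
  define W where "W = (\<lambda>z. ennreal (w z) * indicator S z)"
  define g where "g = (\<lambda>z. ennreal (norm (gradient w (at z))) * indicator S z)"
  have S[measurable]: "S \<in> sets borel" and B[measurable]: "?B \<in> sets borel" "?B \<in> sets lborel" by (auto simp: S_def)
  have S\<Omega>: "S \<subseteq> \<Omega>" using \<Omega> unfolding S_def by (meson ball_subset_cball order_trans)
  have Wm[measurable]: "W \<in> borel_measurable borel"
  proof -
    have "(\<lambda>z. indicator S z *\<^sub>R w z) \<in> borel_measurable borel"
      by (intro borel_measurable_indicator_continuous_on S
          continuous_on_subset[OF C1_on_imp_continuous_on[OF w] S\<Omega>])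
    then have "(\<lambda>z. ennreal (indicator S z *\<^sub>R w z)) \<in> borel_measurable borel" by measurable
    moreover have "(\<lambda>z. ennreal (indicator S z *\<^sub>R w z)) = W"
      by (auto simp: W_def indicator_def fun_eq_iff)
    ultimately show ?thesis by simp
  qed
  have gm[measurable]: "g \<in> borel_measurable borel"
  proof -
    have "(\<lambda>z. indicator S z *\<^sub>R norm (gradient w (at z))) \<in> borel_measurable borel"
      by (intro borel_measurable_indicator_continuous_on S continuous_on_norm
          continuous_on_subset[OF continuous_on_gradient[OF w] S\<Omega>])
    then have "(\<lambda>z. ennreal (indicator S z *\<^sub>R norm (gradient w (at z)))) \<in> borel_measurable borel"
      by measurable
    moreover have "(\<lambda>z. ennreal (indicator S z *\<^sub>R norm (gradient w (at z)))) = g"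
      by (auto simp: g_def indicator_def fun_eq_iff)
    ultimately show ?thesis by metis
  qed
  have Tm[measurable]: "(\<lambda>(s, \<omega>). T s x \<omega>) \<in> borel_measurable (borel \<Otimes>\<^sub>M borel)" for x
    unfolding T_def by measurable
  have Tm2[measurable]: "(\<lambda>(x, \<omega>). T s x \<omega>) \<in> borel_measurable (borel \<Otimes>\<^sub>M borel)" for s
    unfolding T_def by measurable
  have Tm3[measurable]: "(\<lambda>p. T (snd (fst p)) (fst (fst p)) (snd p)) \<in> borel_measurable ((borel \<Otimes>\<^sub>M borel) \<Otimes>\<^sub>M borel)"
    unfolding T_def by measurable
  have Tm4[measurable]: "T s x \<in> borel_measurable borel" for s x
    unfolding T_def by measurable
  define c where "c = (\<lambda>s x. \<integral>\<^sup>+\<omega>. g (T s x \<omega>) * indicator ?B \<omega> \<partial>lborel)"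
  define c2 where "c2 = (\<lambda>s x. \<integral>\<^sup>+\<omega>. (g (T s x \<omega>))\<^sup>2 * indicator ?B \<omega> \<partial>lborel)"
  define a where "a = (\<lambda>x. \<integral>\<^sup>+\<omega>. W (T h x \<omega>) * indicator ?B \<omega> \<partial>lborel)"
  define b where "b = (\<lambda>x. \<integral>\<^sup>+s. c s x * indicator {0<..h} s \<partial>lborel)"
  have cm[measurable]: "(\<lambda>(x, s). c s x) \<in> borel_measurable (borel \<Otimes>\<^sub>M borel)"
    unfolding c_def by measurable
  have c2m[measurable]: "(\<lambda>(x, s). c2 s x) \<in> borel_measurable (borel \<Otimes>\<^sub>M borel)"
    unfolding c2_def by measurable
  have am[measurable]: "a \<in> borel_measurable borel" unfolding a_def by measurable
  have bm[measurable]: "b \<in> borel_measurable borel" unfolding b_def by measurable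
  have \<beta>0: "\<beta> > 0" unfolding \<beta>_def by (rule unit_ball_vol_pos) simp
  have vol: "emeasure lborel ?B = ennreal \<beta>"
    using emeasure_ball[of 1 "0::'a"] by (simp add: \<beta>_def)
  have pointwise: "ennreal \<beta> * ennreal (w x) \<le> a x + 2 * b x" if x: "x \<in> S" for x
  proof -
    have "ennreal \<beta> * ennreal (w x) = (\<integral>\<^sup>+\<omega>. ennreal (w x) * indicator ?B \<omega> \<partial>lborel)"
      by (simp add: nn_integral_cmult_indicator vol mult.commute)
    also have "\<dots> \<le> (\<integral>\<^sup>+\<omega>. W (T h x \<omega>) * indicator ?B \<omega> +
        (\<integral>\<^sup>+s. 2 * (g (T s x \<omega>) * indicator {0<..h} s * indicator ?B \<omega>) \<partial>lborel) \<partial>lborel)"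
    proof (rule nn_integral_mono)
      fix \<omega> :: 'a
      show "ennreal (w x) * indicator ?B \<omega> \<le> W (T h x \<omega>) * indicator ?B \<omega> +
        (\<integral>\<^sup>+s. 2 * (g (T s x \<omega>) * indicator {0<..h} s * indicator ?B \<omega>) \<partial>lborel)"
      proof (cases "\<omega> \<in> ?B")
        case True
        then have n: "norm \<omega> < 1" "norm x < r" using x by (auto simp: S_def)
        have inS: "T s x \<omega> \<in> S" if "0 < s" "s \<le> h" for s
          using shrink_in_ball[OF r _ _ n(2,1), of s] that h by (simp add: T_def S_def)
        have "ennreal (w x) \<le> ennreal (w (T h x \<omega>)) +
          (\<integral>\<^sup>+s. ennreal (2 * norm (gradient w (at (T s x \<omega>)))) * indicator {0<..h} s \<partial>lborel)"
          unfolding T_def by (rule segment_bound[OF w \<Omega> r h wpos n(2,1)])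
        also have "ennreal (w (T h x \<omega>)) = W (T h x \<omega>)"
          using inS[of h] h by (simp add: W_def)
        also have "(\<integral>\<^sup>+s. ennreal (2 * norm (gradient w (at (T s x \<omega>)))) * indicator {0<..h} s \<partial>lborel) =
          (\<integral>\<^sup>+s. 2 * (g (T s x \<omega>) * indicator {0<..h} s * indicator ?B \<omega>) \<partial>lborel)"
          by (intro nn_integral_cong) (use inS True in \<open>auto simp: g_def indicator_def ennreal_mult\<close>)
        finally show ?thesis using True by simp
      qed simp
    qed
    also have "\<dots> = a x + (\<integral>\<^sup>+\<omega>. (\<integral>\<^sup>+s. 2 * (g (T s x \<omega>) * indicator {0<..h} s * indicator ?B \<omega>) \<partial>lborel) \<partial>lborel)"
      unfolding a_def by (rule nn_integral_add) measurable
    also have "(\<integral>\<^sup>+\<omega>. (\<integral>\<^sup>+s. 2 * (g (T s x \<omega>) * indicator {0<..h} s * indicator ?B \<omega>) \<partial>lborel) \<partial>lborel) =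
      (\<integral>\<^sup>+s. (\<integral>\<^sup>+\<omega>. 2 * (g (T s x \<omega>) * indicator {0<..h} s * indicator ?B \<omega>) \<partial>lborel) \<partial>lborel)"
      by (rule lborel_pair.Fubini') measurable
    also have "\<dots> = (\<integral>\<^sup>+s. 2 * (c s x * indicator {0<..h} s) \<partial>lborel)"
    proof (rule nn_integral_cong)
      fix s
      have "(\<integral>\<^sup>+\<omega>. 2 * (g (T s x \<omega>) * indicator {0<..h} s * indicator ?B \<omega>) \<partial>lborel) =
        (\<integral>\<^sup>+\<omega>. (2 * indicator {0<..h} s) * (g (T s x \<omega>) * indicator ?B \<omega>) \<partial>lborel)"
        by (simp add: ac_simps)
      also have "\<dots> = (2 * indicator {0<..h} s) * c s x"
        unfolding c_def by (rule nn_integral_cmult) measurable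
      finally show "(\<integral>\<^sup>+\<omega>. 2 * (g (T s x \<omega>) * indicator {0<..h} s * indicator ?B \<omega>) \<partial>lborel) =
        2 * (c s x * indicator {0<..h} s)" by (simp add: ac_simps)
    qed
    also have "\<dots> = 2 * b x" unfolding b_def by (rule nn_integral_cmult) measurable
    finally show ?thesis .
  qed
  have c_sq: "(c s x)\<^sup>2 \<le> ennreal \<beta> * c2 s x" for s x
  proof -
    have "(c s x)\<^sup>2 = (\<integral>\<^sup>+\<omega>. indicator ?B \<omega> * (g (T s x \<omega>) * indicator ?B \<omega>) \<partial>lborel)\<^sup>2"
      unfolding c_def by (intro arg_cong[where f="\<lambda>x. x\<^sup>2"] nn_integral_cong) (auto simp: indicator_def)
    also have "\<dots> \<le> (\<integral>\<^sup>+\<omega>. (indicator ?B \<omega>)\<^sup>2 \<partial>lborel) * (\<integral>\<^sup>+\<omega>. (g (T s x \<omega>) * indicator ?B \<omega>)\<^sup>2 \<partial>lborel)"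
      by (rule Cauchy_Schwarz_nn_integral) measurable
    also have "(\<integral>\<^sup>+\<omega>. (indicator ?B \<omega>)\<^sup>2 \<partial>lborel) = (\<integral>\<^sup>+\<omega>. indicator ?B \<omega> \<partial>lborel)"
      by (intro nn_integral_cong) (auto simp: indicator_def)
    also have "\<dots> = ennreal \<beta>" using vol by simp
    also have "(\<integral>\<^sup>+\<omega>. (g (T s x \<omega>) * indicator ?B \<omega>)\<^sup>2 \<partial>lborel) = c2 s x"
      unfolding c2_def by (intro nn_integral_cong) (auto simp: indicator_def)
    finally show ?thesis .
  qed
  define H where "H = ennreal (h powr \<alpha> / \<alpha>)"
  have H: "(\<integral>\<^sup>+s. ennreal (s powr (\<alpha> - 1)) * indicator {0<..h} s \<partial>lborel) = H"
    using nn_integral_powr_interval[of "\<alpha> - 1" h] \<alpha> h by (simp add: H_def)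
  \<comment> \<open>The factor one is split as the product of
    \<open>s powr ((\<alpha> - 1) / 2)\<close> and its inverse; squared, the first of them
    integrates to H.\<close>
  have b_sq: "(b x)\<^sup>2 \<le> H * (\<integral>\<^sup>+s. ennreal (s powr (1 - \<alpha>)) * (ennreal \<beta> * c2 s x) * indicator {0<..h} s \<partial>lborel)" for x
  proof -
    let ?f = "\<lambda>s. ennreal (s powr ((\<alpha> - 1) / 2)) * indicator {0<..h} s"
    let ?k = "\<lambda>s. ennreal (s powr ((1 - \<alpha>) / 2)) * c s x * indicator {0<..h} s"
    have "b x = (\<integral>\<^sup>+s. ?f s * ?k s \<partial>lborel)"
      unfolding b_def
    proof (rule nn_integral_cong)
      fix s :: real
      have "ennreal (s powr ((\<alpha> - 1) / 2)) * ennreal (s powr ((1 - \<alpha>) / 2)) = 1" if "s > 0"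
        using that by (simp add: ennreal_mult[symmetric] powr_add[symmetric] add_divide_distrib[symmetric])
      then show "c s x * indicator {0<..h} s = ?f s * ?k s"
        by (auto simp: indicator_def mult.assoc[symmetric])
    qed
    then have "(b x)\<^sup>2 = (\<integral>\<^sup>+s. ?f s * ?k s \<partial>lborel)\<^sup>2" by simp
    also have "\<dots> \<le> (\<integral>\<^sup>+s. (?f s)\<^sup>2 \<partial>lborel) * (\<integral>\<^sup>+s. (?k s)\<^sup>2 \<partial>lborel)"
      by (rule Cauchy_Schwarz_nn_integral) measurable
    also have "(\<integral>\<^sup>+s. (?f s)\<^sup>2 \<partial>lborel) = (\<integral>\<^sup>+s. ennreal (s powr (\<alpha> - 1)) * indicator {0<..h} s \<partial>lborel)"
    proof (rule nn_integral_cong)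
      fix s :: real
      have "(ennreal (s powr ((\<alpha> - 1) / 2)))\<^sup>2 = ennreal (s powr (\<alpha> - 1))"
        by (simp add: power2_eq_square ennreal_mult[symmetric] powr_add[symmetric])
      then show "(?f s)\<^sup>2 = ennreal (s powr (\<alpha> - 1)) * indicator {0<..h} s"
        by (auto simp: indicator_def)
    qed
    also have "\<dots> = H" by (rule H)
    also have "(\<integral>\<^sup>+s. (?k s)\<^sup>2 \<partial>lborel) \<le>
        (\<integral>\<^sup>+s. ennreal (s powr (1 - \<alpha>)) * (ennreal \<beta> * c2 s x) * indicator {0<..h} s \<partial>lborel)"
    proof (rule nn_integral_mono)
      fix s :: real
      have "(ennreal (s powr ((1 - \<alpha>) / 2)))\<^sup>2 = ennreal (s powr (1 - \<alpha>))"
        by (simp add: power2_eq_square ennreal_mult[symmetric] powr_add[symmetric])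
      then show "(?k s)\<^sup>2 \<le> ennreal (s powr (1 - \<alpha>)) * (ennreal \<beta> * c2 s x) * indicator {0<..h} s"
        using mult_left_mono[OF c_sq[of s x], of "ennreal (s powr (1 - \<alpha>))"]
        by (auto simp: indicator_def power_mult_distrib)
    qed
    finally show ?thesis by (simp add: mult_left_mono)
  qed
  define X where "X = (\<integral>\<^sup>+z. (g z)\<^sup>2 \<partial>lborel)"
  define Y where "Y = (\<integral>\<^sup>+z. W z \<partial>lborel)"
  have avg: "(\<integral>\<^sup>+x. G x * (\<integral>\<^sup>+\<omega>. f (T s x \<omega>) * indicator ?B \<omega> \<partial>lborel) \<partial>lborel)
      \<le> ennreal (\<Lambda> * 2 powr \<kappa> * s powr (\<kappa> - real ?d)) * (\<integral>\<^sup>+z. f z \<partial>lborel)"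
    if s: "0 < s" "s \<le> 1" and f: "f \<in> borel_measurable borel" for s f
  proof -
    have "(\<integral>\<^sup>+x. G x * (\<integral>\<^sup>+\<omega>. f (T s x \<omega>) * indicator ?B \<omega> \<partial>lborel) \<partial>lborel)
      \<le> ennreal (1 / s ^ ?d) * ennreal (\<Lambda> * (2 * s) powr \<kappa>) * (\<integral>\<^sup>+z. f z \<partial>lborel)"
      unfolding T_def \<kappa>_def
      by (rule nn_integral_shrink_average[OF f Gm r s GM G0]) (use s in auto)
    also have "ennreal (1 / s ^ ?d) * ennreal (\<Lambda> * (2 * s) powr \<kappa>) =
        ennreal (\<Lambda> * 2 powr \<kappa> * s powr (\<kappa> - real ?d))"
      using s \<Lambda> by (simp add: ennreal_mult[symmetric] powr_mult powr_diff powr_realpow)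
    finally show ?thesis .
  qed
  \<comment> \<open>In the square of a, one factor is bounded uniformly by h^(-d) times the integral
    of w and the other is integrated against G. Hence the exponent \<kappa> - 2 d.\<close>
  have a_le: "a x \<le> ennreal (1 / h ^ ?d) * Y" for x
  proof -
    have "a x = ennreal (1 / h ^ ?d) * (\<integral>\<^sup>+z. W z * indicator (ball ((1 - h / r) *\<^sub>R x) h) z \<partial>lborel)"
      unfolding a_def T_def by (rule nn_integral_ball_affine[OF Wm h(1)])
    also have "\<dots> \<le> ennreal (1 / h ^ ?d) * Y"
      unfolding Y_def by (intro mult_left_mono nn_integral_mono) (auto simp: indicator_def)
    finally show ?thesis .
  qed
  have Ga: "(\<integral>\<^sup>+x. G x * (a x)\<^sup>2 \<partial>lborel) \<le> ennreal (\<Lambda> * 2 powr \<kappa> * h powr (\<kappa> - 2 * real ?d)) * Y\<^sup>2"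
  proof -
    have "(\<integral>\<^sup>+x. G x * (a x)\<^sup>2 \<partial>lborel) \<le> (\<integral>\<^sup>+x. (ennreal (1 / h ^ ?d) * Y) * (G x * a x) \<partial>lborel)"
    proof (rule nn_integral_mono)
      show "G x * (a x)\<^sup>2 \<le> (ennreal (1 / h ^ ?d) * Y) * (G x * a x)" for x
        using mult_right_mono[OF a_le[of x], of "G x * a x"] by (simp add: power2_eq_square ac_simps)
    qed
    also have "\<dots> = (ennreal (1 / h ^ ?d) * Y) * (\<integral>\<^sup>+x. G x * a x \<partial>lborel)"
      by (rule nn_integral_cmult) measurable
    also have "\<dots> \<le> (ennreal (1 / h ^ ?d) * Y) * (ennreal (\<Lambda> * 2 powr \<kappa> * h powr (\<kappa> - real ?d)) * Y)"
      using avg[OF h Wm] unfolding a_def Y_def by (intro mult_left_mono) auto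
    also have "\<dots> = (ennreal (1 / h ^ ?d) * ennreal (\<Lambda> * 2 powr \<kappa> * h powr (\<kappa> - real ?d))) * Y\<^sup>2"
      by (simp add: power2_eq_square ac_simps)
    also have "ennreal (1 / h ^ ?d) * ennreal (\<Lambda> * 2 powr \<kappa> * h powr (\<kappa> - real ?d)) =
        ennreal (\<Lambda> * 2 powr \<kappa> * h powr (\<kappa> - 2 * real ?d))"
    proof -
      have "h powr (\<kappa> - 2 * real ?d) = h powr ((\<kappa> - real ?d) - real ?d)" by (simp add: algebra_simps)
      also have "\<dots> = h powr (\<kappa> - real ?d) / h ^ ?d" using h by (subst powr_diff) (simp add: powr_realpow)
      finally show ?thesis using h \<Lambda> by (simp add: ennreal_mult[symmetric])
    qed
    finally show ?thesis .
  qed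
  have Gb: "(\<integral>\<^sup>+x. G x * (b x)\<^sup>2 \<partial>lborel) \<le> ennreal (\<Lambda> * 2 powr \<kappa> * \<beta> * (h powr \<alpha> / \<alpha>)\<^sup>2) * X"
  proof -
    have "(\<integral>\<^sup>+x. G x * (b x)\<^sup>2 \<partial>lborel) \<le>
      (\<integral>\<^sup>+x. (\<integral>\<^sup>+s. H * (ennreal \<beta> * (ennreal (s powr (1 - \<alpha>)) * indicator {0<..h} s * (G x * c2 s x))) \<partial>lborel) \<partial>lborel)"
    proof (rule nn_integral_mono)
      fix x
      have "G x * (b x)\<^sup>2 \<le> G x * (H * (\<integral>\<^sup>+s. ennreal (s powr (1 - \<alpha>)) * (ennreal \<beta> * c2 s x) * indicator {0<..h} s \<partial>lborel))"
        by (intro mult_left_mono b_sq) auto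
      also have "\<dots> = (\<integral>\<^sup>+s. (G x * H) * (ennreal (s powr (1 - \<alpha>)) * (ennreal \<beta> * c2 s x) * indicator {0<..h} s) \<partial>lborel)"
        unfolding mult.assoc[symmetric, of "G x" H]
        by (rule nn_integral_cmult[symmetric]) measurable
      finally show "G x * (b x)\<^sup>2 \<le> (\<integral>\<^sup>+s. H * (ennreal \<beta> * (ennreal (s powr (1 - \<alpha>)) * indicator {0<..h} s * (G x * c2 s x))) \<partial>lborel)"
        by (simp add: ac_simps)
    qed
    also have "\<dots> = (\<integral>\<^sup>+s. (\<integral>\<^sup>+x. H * (ennreal \<beta> * (ennreal (s powr (1 - \<alpha>)) * indicator {0<..h} s * (G x * c2 s x))) \<partial>lborel) \<partial>lborel)"
      by (rule lborel_pair.Fubini'[symmetric]) measurable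
    also have "\<dots> \<le> (\<integral>\<^sup>+s. (H * (ennreal \<beta> * (ennreal (\<Lambda> * 2 powr \<kappa>) * X))) * (ennreal (s powr (\<alpha> - 1)) * indicator {0<..h} s) \<partial>lborel)"
    proof (rule nn_integral_mono)
      fix s :: real
      show "(\<integral>\<^sup>+x. H * (ennreal \<beta> * (ennreal (s powr (1 - \<alpha>)) * indicator {0<..h} s * (G x * c2 s x))) \<partial>lborel)
        \<le> (H * (ennreal \<beta> * (ennreal (\<Lambda> * 2 powr \<kappa>) * X))) * (ennreal (s powr (\<alpha> - 1)) * indicator {0<..h} s)"
      proof (cases "s \<in> {0<..h}")
        case True
        then have s: "0 < s" "s \<le> 1" using h by auto
        have "(\<integral>\<^sup>+x. H * (ennreal \<beta> * (ennreal (s powr (1 - \<alpha>)) * indicator {0<..h} s * (G x * c2 s x))) \<partial>lborel)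
          = (\<integral>\<^sup>+x. (H * ennreal \<beta> * ennreal (s powr (1 - \<alpha>))) * (G x * c2 s x) \<partial>lborel)"
          using True by (simp add: ac_simps)
        also have "\<dots> = (H * ennreal \<beta> * ennreal (s powr (1 - \<alpha>))) * (\<integral>\<^sup>+x. G x * c2 s x \<partial>lborel)"
          by (rule nn_integral_cmult) measurable
        also have "\<dots> \<le> (H * ennreal \<beta> * ennreal (s powr (1 - \<alpha>))) * (ennreal (\<Lambda> * 2 powr \<kappa> * s powr (\<kappa> - real ?d)) * X)"
        proof -
          have "(\<lambda>z. (g z)\<^sup>2) \<in> borel_measurable borel" by measurable
          from avg[OF s this] show ?thesis
            unfolding c2_def X_def by (intro mult_left_mono) auto
        qed
        also have "\<dots> = (H * ennreal \<beta> * X) * (ennreal (s powr (1 - \<alpha>)) * ennreal (\<Lambda> * 2 powr \<kappa> * s powr (\<kappa> - real ?d)))"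
          by (simp add: ac_simps)
        also have "ennreal (s powr (1 - \<alpha>)) * ennreal (\<Lambda> * 2 powr \<kappa> * s powr (\<kappa> - real ?d)) =
            ennreal (\<Lambda> * 2 powr \<kappa>) * ennreal (s powr (\<alpha> - 1))"
        proof -
          have "s powr (1 - \<alpha>) * s powr (\<kappa> - real ?d) = s powr (\<alpha> - 1)"
            unfolding powr_add[symmetric] by (simp add: \<kappa>_def)
          then show ?thesis using \<Lambda> by (simp add: ennreal_mult[symmetric] mult.left_commute)
        qed
        finally show ?thesis using True by (simp add: ac_simps)
      qed simp
    qed
    also have "\<dots> = (H * (ennreal \<beta> * (ennreal (\<Lambda> * 2 powr \<kappa>) * X))) * H"
      unfolding H[symmetric] by (rule nn_integral_cmult) measurable
    also have "\<dots> = (H * H * ennreal \<beta> * ennreal (\<Lambda> * 2 powr \<kappa>)) * X" by (simp add: ac_simps)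
    also have "H * H * ennreal \<beta> * ennreal (\<Lambda> * 2 powr \<kappa>) = ennreal (\<Lambda> * 2 powr \<kappa> * \<beta> * (h powr \<alpha> / \<alpha>)\<^sup>2)"
      unfolding H_def using \<alpha> \<beta>0 \<Lambda> by (simp add: ennreal_mult[symmetric] power2_eq_square ac_simps)
    finally show ?thesis .
  qed
  have "ennreal (\<beta>\<^sup>2) * (\<integral>\<^sup>+x. G x * (ennreal (w x))\<^sup>2 \<partial>lborel) =
      (\<integral>\<^sup>+x. ennreal (\<beta>\<^sup>2) * (G x * (W x)\<^sup>2) \<partial>lborel)"
  proof -
    have "G x * (ennreal (w x))\<^sup>2 = G x * (W x)\<^sup>2" for x
      using G0[of x] by (cases "norm x < r") (auto simp: W_def S_def)
    then show ?thesis by (subst nn_integral_cmult) auto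
  qed
  \<comment> \<open>The 16 is the 4 of \<open>ennreal_add_square_le\<close> times the square of the
    velocity bound 2.\<close>
  also have "\<dots> \<le> (\<integral>\<^sup>+x. 4 * (G x * (a x)\<^sup>2) + 16 * (G x * (b x)\<^sup>2) \<partial>lborel)"
  proof (rule nn_integral_mono)
    fix x
    show "ennreal (\<beta>\<^sup>2) * (G x * (W x)\<^sup>2) \<le> 4 * (G x * (a x)\<^sup>2) + 16 * (G x * (b x)\<^sup>2)"
    proof (cases "x \<in> S")
      case True
      have "ennreal (\<beta>\<^sup>2) * (W x)\<^sup>2 = (ennreal \<beta> * ennreal (w x))\<^sup>2"
        using True \<beta>0 by (simp add: W_def power_mult_distrib ennreal_power)
      also have "\<dots> \<le> (a x + 2 * b x)\<^sup>2"
        by (intro power_mono pointwise True) simp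
      also have "\<dots> \<le> 4 * (a x)\<^sup>2 + 4 * (2 * b x)\<^sup>2" by (rule ennreal_add_square_le)
      also have "\<dots> = 4 * (a x)\<^sup>2 + 16 * (b x)\<^sup>2" by (simp add: power_mult_distrib mult.assoc[symmetric])
      finally have "G x * (ennreal (\<beta>\<^sup>2) * (W x)\<^sup>2) \<le> G x * (4 * (a x)\<^sup>2 + 16 * (b x)\<^sup>2)"
        by (rule mult_left_mono) simp
      then show ?thesis by (simp add: distrib_left ac_simps)
    qed (simp add: W_def)
  qed
  also have "\<dots> = 4 * (\<integral>\<^sup>+x. G x * (a x)\<^sup>2 \<partial>lborel) + 16 * (\<integral>\<^sup>+x. G x * (b x)\<^sup>2 \<partial>lborel)"
    by (subst nn_integral_add) (auto simp: nn_integral_cmult)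
  also have "\<dots> \<le> 4 * (ennreal (\<Lambda> * 2 powr \<kappa> * h powr (\<kappa> - 2 * real ?d)) * Y\<^sup>2) +
      16 * (ennreal (\<Lambda> * 2 powr \<kappa> * \<beta> * (h powr \<alpha> / \<alpha>)\<^sup>2) * X)"
    by (intro add_mono mult_left_mono Ga Gb) auto
  also have "\<dots> = ennreal (4 * \<Lambda> * 2 powr \<kappa> * h powr (\<kappa> - 2 * real ?d)) * Y\<^sup>2 +
      ennreal (16 * \<Lambda> * 2 powr \<kappa> * \<beta> * (h powr \<alpha> / \<alpha>)\<^sup>2) * X"
  proof -
    have "4 * ennreal k = ennreal (4 * k)" "16 * ennreal k = ennreal (16 * k)" if "k \<ge> 0" for k
      using that by (simp_all add: ennreal_mult)
    then show ?thesis
      using \<Lambda> \<beta>0 by (simp add: mult.assoc[symmetric])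
  qed
  also have "X = (\<integral>\<^sup>+x. ennreal ((norm (gradient w (at x)))\<^sup>2) * indicator S x \<partial>lborel)"
    unfolding X_def g_def by (intro nn_integral_cong) (auto simp: indicator_def ennreal_power)
  finally show ?thesis unfolding Y_def W_def .
qed

text \<open>The weight is cut off to the ball, which preserves its Morrey bound, and the quantities,
  being finite, are moved from \<open>ennreal\<close> to the reals.\<close>

lemma morrey_poincare:
  fixes w G :: "'a::euclidean_space \<Rightarrow> real"
  assumes w: "C1_on \<Omega> w" and \<Omega>: "cball 0 r \<subseteq> \<Omega>" and r: "r \<ge> 1" and h: "0 < h" "h \<le> 1"
    and wpos: "\<And>x. x \<in> ball 0 r \<Longrightarrow> w x \<ge> 0"
    and \<alpha>: "0 < \<alpha>" and \<Lambda>: "\<Lambda> \<ge> 0"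
    and G: "continuous_on UNIV G" "\<And>x. G x \<ge> 0"
    and GM: "\<And>z \<rho>. 0 < \<rho> \<Longrightarrow> \<rho> \<le> 2 \<Longrightarrow> (\<integral>\<^sup>+x. ennreal (G x) * indicator (ball z \<rho>) x \<partial>lborel)
      \<le> ennreal (\<Lambda> * \<rho> powr (real DIM('a) - 2 + 2 * \<alpha>))"
  defines "\<beta> \<equiv> unit_ball_vol (real DIM('a))"
    and "\<kappa> \<equiv> real DIM('a) - 2 + 2 * \<alpha>"
    and "M \<equiv> lebesgue_on (ball (0::'a) r)"
  shows "(\<integral>x. G x * (w x)\<^sup>2 \<partial>M) \<le>
    (4 * 2 powr \<kappa> / \<beta>\<^sup>2) * \<Lambda> * h powr (\<kappa> - 2 * real DIM('a)) * (\<integral>x. w x \<partial>M)\<^sup>2 +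
    (16 * 2 powr \<kappa> / (\<beta> * \<alpha>\<^sup>2)) * \<Lambda> * h powr (2 * \<alpha>) * (\<integral>x. (norm (gradient w (at x)))\<^sup>2 \<partial>M)"
proof -
  define Gn where "Gn = (\<lambda>x. ennreal (G x) * indicator (ball 0 r) x)"
  have \<beta>0: "\<beta> > 0" unfolding \<beta>_def by (rule unit_ball_vol_pos) simp
  have Gm[measurable]: "G \<in> borel_measurable borel"
    using G(1) by (rule borel_measurable_continuous_onI)
  have [measurable]: "ball (0::'a) r \<in> sets borel" by simp
  have Gnm: "Gn \<in> borel_measurable borel" unfolding Gn_def by measurable
  have Gn0: "Gn x = 0" if "norm x \<ge> r" for x using that by (simp add: Gn_def)
  have GnM: "(\<integral>\<^sup>+x. Gn x * indicator (ball z \<rho>) x \<partial>lborel)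
      \<le> ennreal (\<Lambda> * \<rho> powr (real DIM('a) - 2 + 2 * \<alpha>))" if "0 < \<rho>" "\<rho> \<le> 2" for z \<rho>
    by (rule order_trans[OF nn_integral_mono GM[OF that, of z]]) (auto simp: Gn_def indicator_def)
  have wc: "continuous_on (cball 0 r) w"
    using continuous_on_subset[OF C1_on_imp_continuous_on[OF w] \<Omega>] .
  have gc: "continuous_on (cball 0 r) (\<lambda>x. (norm (gradient w (at x)))\<^sup>2)"
    using continuous_on_subset[OF continuous_on_gradient[OF w] \<Omega>] by (intro continuous_intros)
  have Gc: "continuous_on (cball 0 r) (\<lambda>x. G x * (w x)\<^sup>2)"
    using continuous_on_subset[OF G(1)] wc by (intro continuous_intros) auto
  have E1: "(\<integral>\<^sup>+x. Gn x * (ennreal (w x))\<^sup>2 \<partial>lborel) = ennreal (\<integral>x. G x * (w x)\<^sup>2 \<partial>M)"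
  proof -
    have "(\<integral>\<^sup>+x. Gn x * (ennreal (w x))\<^sup>2 \<partial>lborel) =
        (\<integral>\<^sup>+x. ennreal (G x * (w x)\<^sup>2) * indicator (ball 0 r) x \<partial>lborel)"
    proof (rule nn_integral_cong)
      show "Gn x * (ennreal (w x))\<^sup>2 = ennreal (G x * (w x)\<^sup>2) * indicator (ball 0 r) x" for x
        using wpos[of x] G(2)[of x] by (cases "x \<in> ball 0 r") (auto simp: Gn_def ennreal_mult ennreal_power)
    qed
    also have "\<dots> = ennreal (\<integral>x. G x * (w x)\<^sup>2 \<partial>M)"
      unfolding M_def by (rule nn_integral_ball_eq_integral[OF Gc]) (use G in auto)
    finally show ?thesis .
  qed
  have E2: "(\<integral>\<^sup>+x. ennreal (w x) * indicator (ball 0 r) x \<partial>lborel) = ennreal (\<integral>x. w x \<partial>M)"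
    unfolding M_def by (rule nn_integral_ball_eq_integral[OF wc wpos])
  have E3: "(\<integral>\<^sup>+x. ennreal ((norm (gradient w (at x)))\<^sup>2) * indicator (ball 0 r) x \<partial>lborel) =
      ennreal (\<integral>x. (norm (gradient w (at x)))\<^sup>2 \<partial>M)"
    unfolding M_def by (rule nn_integral_ball_eq_integral[OF gc]) auto
  define I1 I2 I3 where "I1 = (\<integral>x. G x * (w x)\<^sup>2 \<partial>M)" and "I2 = (\<integral>x. w x \<partial>M)"
    and "I3 = (\<integral>x. (norm (gradient w (at x)))\<^sup>2 \<partial>M)"
  have sp: "x \<in> ball 0 r" if "x \<in> space M" for x
    using that by (simp add: M_def space_restrict_space)
  have nn: "I1 \<ge> 0" "I2 \<ge> 0" "I3 \<ge> 0"
    unfolding I1_def I2_def I3_def using G(2) wpos sp by (auto intro!: Bochner_Integration.integral_nonneg)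
  let ?c1 = "4 * \<Lambda> * 2 powr \<kappa> * h powr (\<kappa> - 2 * real DIM('a))"
  let ?c2 = "16 * \<Lambda> * 2 powr \<kappa> * \<beta> * (h powr \<alpha> / \<alpha>)\<^sup>2"
  have "ennreal (\<beta>\<^sup>2) * ennreal I1 \<le> ennreal ?c1 * (ennreal I2)\<^sup>2 + ennreal ?c2 * ennreal I3"
    using morrey_poincare_nn[OF w \<Omega> r h wpos \<alpha> \<Lambda> Gnm Gn0 GnM]
    unfolding E1 E2 E3 \<beta>_def[symmetric] \<kappa>_def[symmetric] I1_def[symmetric] I2_def[symmetric] I3_def[symmetric] .
  also have "\<dots> = ennreal (?c1 * I2\<^sup>2 + ?c2 * I3)"
    using nn \<Lambda> \<beta>0 by (simp add: ennreal_mult ennreal_power)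
  finally have "ennreal (\<beta>\<^sup>2 * I1) \<le> ennreal (?c1 * I2\<^sup>2 + ?c2 * I3)"
    using nn by (simp add: ennreal_mult)
  moreover have "?c1 * I2\<^sup>2 + ?c2 * I3 \<ge> 0" using nn \<Lambda> \<beta>0 by simp
  ultimately have "\<beta>\<^sup>2 * I1 \<le> ?c1 * I2\<^sup>2 + ?c2 * I3" by simp
  then have "I1 \<le> (?c1 * I2\<^sup>2 + ?c2 * I3) / \<beta>\<^sup>2" using \<beta>0 by (simp add: pos_le_divide_eq mult.commute)
  also have "(h powr \<alpha>)\<^sup>2 = h powr (2 * \<alpha>)"
    by (simp add: power2_eq_square powr_add[symmetric])
  then have "(?c1 * I2\<^sup>2 + ?c2 * I3) / \<beta>\<^sup>2 =
    (4 * 2 powr \<kappa> / \<beta>\<^sup>2) * \<Lambda> * h powr (\<kappa> - 2 * real DIM('a)) * I2\<^sup>2 +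
    (16 * 2 powr \<kappa> / (\<beta> * \<alpha>\<^sup>2)) * \<Lambda> * h powr (2 * \<alpha>) * I3"
    using \<beta>0 \<alpha> by (simp add: add_divide_distrib power_divide) (simp add: field_simps power2_eq_square)
  finally show ?thesis unfolding I1_def I2_def I3_def .
qed

subsection \<open>The nonlinearity\<close>

locale pme_gauge =
  fixes m \<epsilon> :: real
  assumes m: "m > 1" and eps: "\<epsilon> > 0"
begin

definition dphi :: "real \<Rightarrow> real" where
  "dphi s = m * s powr (m - 1) + \<epsilon>"

text \<open>\<open>\<Phi>' = \<phi>' / s\<close>, so that \<open>\<nabla>\<phi>(u) = u \<nabla>\<Phi>(u)\<close>.\<close>

definition Phi :: "real \<Rightarrow> real" where
  "Phi s = m / (m - 1) * s powr (m - 1) + \<epsilon> * ln s"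

definition Phi_inv :: "real \<Rightarrow> real" where
  "Phi_inv z = (THE s. s > 0 \<and> Phi s = z)"

lemma phi_deriv: "s > 0 \<Longrightarrow> (phi m \<epsilon> has_real_derivative dphi s) (at s)"
  unfolding phi_def[abs_def] dphi_def by (auto intro!: derivative_eq_intros)

lemma dphi_gt: "dphi s \<ge> \<epsilon>" "dphi s > 0"
proof -
  have "m * s powr (m - 1) \<ge> 0" using m by simp
  then show "dphi s \<ge> \<epsilon>" "dphi s > 0" using eps by (auto simp: dphi_def)
qed

lemma dphi_ge_1: "s \<ge> 1 \<Longrightarrow> dphi s \<ge> 1"
proof -
  assume "s \<ge> 1"
  then have "s powr (m - 1) \<ge> 1" using m by (simp add: ge_one_powr_ge_zero)
  then have "m * s powr (m - 1) \<ge> 1 * 1" using m by (intro mult_mono) auto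
  then show ?thesis using eps by (simp add: dphi_def)
qed

lemma Phi_deriv:
  assumes "s > 0"
  shows "(Phi has_real_derivative dphi s / s) (at s)"
proof -
  have "(Phi has_real_derivative m / (m - 1) * ((m - 1) * s powr (m - 1 - 1)) + \<epsilon> * (1 / s)) (at s)"
    unfolding Phi_def[abs_def]
    using assms by (intro DERIV_add DERIV_cmult has_real_derivative_powr DERIV_ln_divide)
  moreover have "m / (m - 1) * ((m - 1) * s powr (m - 1 - 1)) + \<epsilon> * (1 / s) = dphi s / s"
  proof -
    have "s powr (m - 1 - 1) = s powr (m - 1) / s" using assms by (subst powr_diff) simp
    then show ?thesis using m by (simp add: dphi_def add_divide_distrib)
  qed
  ultimately show ?thesis by simp
qed

lemma dphi_deriv: "s > 0 \<Longrightarrow> (dphi has_real_derivative m * (m - 1) * s powr (m - 2)) (at s)"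
  unfolding dphi_def[abs_def] by (auto intro!: derivative_eq_intros simp: algebra_simps)

lemma Phi_strict_mono:
  assumes "0 < s" "s < t"
  shows "Phi s < Phi t"
proof (rule DERIV_pos_imp_increasing[OF assms(2)])
  fix x assume "s \<le> x"
  then show "\<exists>y. (Phi has_real_derivative y) (at x) \<and> 0 < y"
    using assms Phi_deriv[of x] dphi_gt(2)[of x] by (intro exI[of _ "dphi x / x"]) auto
qed

lemma Phi_less_iff: "0 < s \<Longrightarrow> 0 < t \<Longrightarrow> Phi s < Phi t \<longleftrightarrow> s < t"
  by (metis Phi_strict_mono linorder_neqE_linordered_idom order_less_asym)

text \<open>The logarithm, present because \<epsilon> > 0, drives \<open>Phi\<close> to minus
  infinity at 0; without it negative arguments of \<open>Phi_inv\<close> would have no meaning. The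
  witnesses \<open>s0\<close> and \<open>s1\<close> are chosen so that this term alone equals -(|z|
  + c) and |z|.\<close>

lemma Phi_surj: "\<exists>s>0. Phi s = z"
proof -
  define c where "c = m / (m - 1)"
  have c: "c > 0" using m by (simp add: c_def)
  define s0 where "s0 = exp (- (\<bar>z\<bar> + c) / \<epsilon>)"
  define s1 where "s1 = exp (\<bar>z\<bar> / \<epsilon>)"
  have "- (\<bar>z\<bar> + c) / \<epsilon> \<le> 0" using c eps by (intro divide_nonpos_pos) auto
  then have s0: "0 < s0" "s0 \<le> 1" by (auto simp: s0_def simp del: minus_add_distrib)
  have s1: "s1 \<ge> 1" using eps by (auto simp: s1_def)
  have "s0 powr (m - 1) \<le> 1" using s0 m by (simp add: powr_le1)
  then have "c * s0 powr (m - 1) \<le> c" using c by simp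
  moreover have "\<epsilon> * ln s0 = - (\<bar>z\<bar> + c)" using eps by (simp add: s0_def)
  ultimately have 1: "Phi s0 \<le> z" unfolding Phi_def c_def[symmetric] by linarith
  have "c * s1 powr (m - 1) \<ge> 0" using c by simp
  moreover have "\<epsilon> * ln s1 = \<bar>z\<bar>" using eps by (simp add: s1_def)
  ultimately have 2: "z \<le> Phi s1" unfolding Phi_def c_def[symmetric] by linarith
  have "\<exists>x\<ge>s0. x \<le> s1 \<and> Phi x = z"
  proof (rule IVT[where f = Phi and a = s0 and b = s1 and y = z, OF 1 2])
    show "\<forall>x. s0 \<le> x \<and> x \<le> s1 \<longrightarrow> isCont Phi x"
      using s0 Phi_deriv DERIV_isCont by (metis less_le_trans)
  qed (use s0 s1 in simp)
  then obtain x where "x \<ge> s0" "Phi x = z" by blast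
  then show ?thesis using s0 by (intro exI[of _ x]) auto
qed

lemma Phi_inv: "Phi_inv z > 0" "Phi (Phi_inv z) = z"
proof -
  have "\<exists>!s. s > 0 \<and> Phi s = z"
    using Phi_surj[of z] Phi_strict_mono by (metis less_irrefl linorder_neqE_linordered_idom)
  from theI'[OF this] show "Phi_inv z > 0" "Phi (Phi_inv z) = z"
    unfolding Phi_inv_def by auto
qed

lemma Phi_inv_Phi: "s > 0 \<Longrightarrow> Phi_inv (Phi s) = s"
  using Phi_inv[of "Phi s"] Phi_strict_mono by (metis less_irrefl linorder_neqE_linordered_idom)

lemma Phi_inv_less_iff: "Phi_inv y < Phi_inv z \<longleftrightarrow> y < z"
  using Phi_less_iff[of "Phi_inv y" "Phi_inv z"] Phi_inv by simp

lemma Phi_inv_isCont: "isCont Phi_inv z"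
proof -
  define s where "s = Phi_inv z"
  have s: "s > 0" by (simp add: s_def Phi_inv)
  have inv: "Phi_inv (Phi y) = y" "isCont Phi y" if "\<bar>y - s\<bar> \<le> s / 2" for y
  proof -
    have "y > 0" using that s by linarith
    then show "Phi_inv (Phi y) = y" "isCont Phi y"
      using Phi_inv_Phi Phi_deriv DERIV_isCont by blast+
  qed
  have "isCont Phi_inv (Phi s)"
    by (rule isCont_inverse_function[of "s / 2"]) (use s inv in auto)
  then show ?thesis by (simp add: s_def Phi_inv)
qed

lemma Phi_inv_deriv: "(Phi_inv has_real_derivative Phi_inv z / dphi (Phi_inv z)) (at z)"
proof -
  have "(Phi_inv has_real_derivative inverse (dphi (Phi_inv z) / Phi_inv z)) (at z)"
  proof (rule DERIV_inverse_function[where a = "z - 1" and b = "z + 1"])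
    show "(Phi has_real_derivative dphi (Phi_inv z) / Phi_inv z) (at (Phi_inv z))"
      by (rule Phi_deriv) (rule Phi_inv)
    show "dphi (Phi_inv z) / Phi_inv z \<noteq> 0" using Phi_inv[of z] dphi_gt(2)[of "Phi_inv z"] by auto
  qed (auto simp: Phi_inv Phi_inv_isCont)
  then show ?thesis by simp
qed

text \<open>Above level 1 the slope of \<open>Phi\<close> is at least that of the logarithm. So, as
  long as the argument stays above 1, shifting \<open>Phi\<close> by b changes it by at most the
  factor exp |b|, which does not see \<epsilon>.\<close>

lemma Phi_minus_ln_mono: "1 \<le> x \<Longrightarrow> x \<le> y \<Longrightarrow> ln y - ln x \<le> Phi y - Phi x"
proof -
  assume xy: "1 \<le> x" "x \<le> y"
  have "Phi x - ln x \<le> Phi y - ln y"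
  proof (rule DERIV_nonneg_imp_nondecreasing[OF xy(2)])
    fix s assume s: "x \<le> s"
    then have "s \<ge> 1" using xy by simp
    then have "((\<lambda>s. Phi s - ln s) has_real_derivative dphi s / s - 1 / s) (at s)"
      by (intro DERIV_diff Phi_deriv DERIV_ln_divide) auto
    moreover have "dphi s / s - 1 / s \<ge> 0"
      using dphi_ge_1[OF \<open>s \<ge> 1\<close>] \<open>s \<ge> 1\<close> by (simp add: diff_divide_distrib[symmetric])
    ultimately show "\<exists>d. ((\<lambda>s. Phi s - ln s) has_real_derivative d) (at s) \<and> 0 \<le> d" by blast
  qed
  then show ?thesis by simp
qed

section \<open>The unknown shifted by a potential\<close>

definition zeta :: "real \<Rightarrow> real \<Rightarrow> real" where
  "zeta b s = Phi_inv (Phi s + b)"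

lemma zeta_pos: "zeta b s > 0" by (simp add: zeta_def Phi_inv)

lemma zeta_zero: "s > 0 \<Longrightarrow> zeta 0 s = s" by (simp add: zeta_def Phi_inv_Phi)

lemma zeta_deriv:
  assumes "s > 0"
  shows "(zeta b has_real_derivative (zeta b s / dphi (zeta b s)) * (dphi s / s)) (at s)"
proof -
  have "((\<lambda>s. Phi s + b) has_real_derivative dphi s / s) (at s)"
    using Phi_deriv[OF assms] by (auto intro!: derivative_eq_intros)
  from DERIV_chain2[OF Phi_inv_deriv this] show ?thesis by (simp add: zeta_def[abs_def])
qed

text \<open>The threshold \<open>exp b0\<close> keeps the comparison point \<open>s'\<close> in the
  range above 1 where \<open>Phi_minus_ln_mono\<close> applies. The points \<open>s'\<close> and
  \<open>t\<close> are chosen so that their logarithms differ from that of \<open>zeta b s\<close>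
  by exactly b0.\<close>

lemma zeta_bounds:
  assumes b: "\<bar>b\<bar> \<le> b0" and s: "s > 0" and z: "zeta b s \<ge> exp b0"
  shows "zeta b s \<le> exp b0 * s" "s \<le> exp b0 * zeta b s" "s \<ge> 1"
proof -
  let ?z = "zeta b s"
  have Pz: "Phi ?z = Phi s + b" by (simp add: zeta_def Phi_inv)
  have b0: "b0 \<ge> 0" using b by linarith
  have z1: "?z \<ge> 1" using z b0 one_le_exp_iff[of b0] by linarith
  define s' where "s' = ?z / exp b0"
  have s': "1 \<le> s'" "s' \<le> ?z"
    using z z1 b0 by (auto simp: s'_def field_simps) 
  have "ln ?z - ln s' = b0" using z1 by (simp add: s'_def ln_div)
  then have "Phi s' \<le> Phi ?z - b0" using Phi_minus_ln_mono[OF s'] by simp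
  then have "\<not> Phi s < Phi s'" using Pz b by linarith
  then have "s' \<le> s" using Phi_less_iff[of s s'] s s' by simp
  then show "?z \<le> exp b0 * s" by (simp add: s'_def field_simps)
  then show "s \<ge> 1" using s' \<open>s' \<le> s\<close> by linarith
  define t where "t = exp b0 * ?z"
  have t: "?z \<le> t" using z1 b0 mult_right_mono[of 1 "exp b0" ?z] by (simp add: t_def)
  have "ln t - ln ?z = b0" using z1 by (simp add: t_def ln_mult)
  then have "Phi t \<ge> Phi ?z + b0" using Phi_minus_ln_mono[OF z1 t] by simp
  then have "\<not> Phi t < Phi s" using Pz b by linarith
  then show "s \<le> exp b0 * ?z" using Phi_less_iff[of t s] s t z1 by (simp add: t_def)
qed

text \<open>A truncation of \<zeta> at a positive level is also a truncation of s near zero,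
  uniformly in |b| \<le> b0; this keeps test functions away from the singularity at 0.\<close>

lemma zeta_small:
  assumes "k > 0"
  obtains s1 where "s1 > 0" "\<And>b s. \<bar>b\<bar> \<le> b0 \<Longrightarrow> 0 < s \<Longrightarrow> s < s1 \<Longrightarrow> zeta b s < k"
proof
  show "Phi_inv (Phi k - b0) > 0" by (rule Phi_inv)
  fix b s assume "\<bar>b\<bar> \<le> b0" "0 < s" and "s < Phi_inv (Phi k - b0)"
  then have "Phi s < Phi k - b0" using Phi_less_iff[of s "Phi_inv (Phi k - b0)"] Phi_inv by simp
  then have "Phi s + b < Phi k" using \<open>\<bar>b\<bar> \<le> b0\<close> by linarith
  then show "zeta b s < k" using Phi_inv_less_iff[of "Phi s + b" "Phi k"] assms
    by (simp add: zeta_def Phi_inv_Phi)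
qed

text \<open>The power grows by at most \<open>c powr (m - 1)\<close>, and this factor, being at
  least one, also covers the constant \<epsilon>; so the ratio is bounded independently of
  \<epsilon>.\<close>

lemma dphi_ratio:
  assumes "c \<ge> 1" "s > 0" "t > 0" "s \<le> c * t"
  shows "dphi s \<le> c powr (m - 1) * dphi t"
proof -
  have c: "c powr (m - 1) \<ge> 1" using assms m by (simp add: ge_one_powr_ge_zero)
  have "s powr (m - 1) \<le> (c * t) powr (m - 1)" using assms m by (intro powr_mono2) auto
  also have "\<dots> = c powr (m - 1) * t powr (m - 1)" using assms by (simp add: powr_mult)
  finally have "m * s powr (m - 1) \<le> m * (c powr (m - 1) * t powr (m - 1))" using m by simp
  moreover have "1 * \<epsilon> \<le> c powr (m - 1) * \<epsilon>" using c eps by (intro mult_right_mono) auto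
  ultimately show ?thesis by (simp add: dphi_def algebra_simps)
qed

text \<open>D is the derivative of \<open>zeta b\<close>. It is a ratio of diffusivities times a
  ratio of arguments, so \<open>dphi_ratio\<close> and \<open>zeta_bounds\<close> bound D and 1 / D
  by the same power, whatever \<epsilon> is.\<close>

lemma zeta_deriv_bounds:
  assumes b: "\<bar>b\<bar> \<le> b0" and s: "s > 0" and z: "zeta b s \<ge> exp b0"
  defines "D \<equiv> (zeta b s / dphi (zeta b s)) * (dphi s / s)"
  shows "D \<le> exp b0 powr m" "D \<ge> 1 / exp b0 powr m"
proof -
  let ?z = "zeta b s" and ?k = "exp b0"
  have k: "?k \<ge> 1" using b by auto
  note zb = zeta_bounds[OF b s z]
  have z0: "?z > 0" by (rule zeta_pos)
  have km: "?k powr (m - 1) * ?k = ?k powr m"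
    using powr_add[of ?k "m - 1" 1] by simp
  have "dphi s / dphi ?z \<le> ?k powr (m - 1)"
    using dphi_ratio[OF k s z0 zb(2)] dphi_gt(2)[of ?z] by (simp add: pos_divide_le_eq)
  moreover have "?z / s \<le> ?k" using zb(1) s by (simp add: pos_divide_le_eq)
  ultimately have "(dphi s / dphi ?z) * (?z / s) \<le> ?k powr (m - 1) * ?k"
    using s z0 dphi_gt(2)[of ?z] dphi_gt(2)[of s] by (intro mult_mono) auto
  then show "D \<le> ?k powr m" by (simp add: D_def km[symmetric] mult.commute)
  have "dphi ?z / dphi s \<le> ?k powr (m - 1)"
    using dphi_ratio[OF k z0 s zb(1)] dphi_gt(2)[of s] by (simp add: pos_divide_le_eq)
  moreover have "s / ?z \<le> ?k" using zb(2) z0 by (simp add: pos_divide_le_eq)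
  ultimately have "(dphi ?z / dphi s) * (s / ?z) \<le> ?k powr (m - 1) * ?k"
    using s z0 dphi_gt(2)[of ?z] dphi_gt(2)[of s] by (intro mult_mono) auto
  then have "1 / D \<le> ?k powr m" by (simp add: D_def km[symmetric] mult.commute)
  moreover have "D > 0" using s z0 dphi_gt(2)[of ?z] dphi_gt(2)[of s] by (simp add: D_def)
  ultimately show "D \<ge> 1 / ?k powr m" by (simp add: field_simps)
qed

end

subsection \<open>Truncated test functions\<close>

lemma has_real_derivative_integral:
  fixes f f' :: "real \<Rightarrow> 'a \<Rightarrow> real"
  assumes "finite_measure M" and \<delta>: "\<delta> > 0"
    and der: "\<And>x \<tau>. x \<in> space M \<Longrightarrow> \<bar>\<tau> - t\<bar> < \<delta> \<Longrightarrow> ((\<lambda>\<tau>. f \<tau> x) has_real_derivative f' \<tau> x) (at \<tau>)"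
    and bound: "\<And>x \<tau>. x \<in> space M \<Longrightarrow> \<bar>\<tau> - t\<bar> < \<delta> \<Longrightarrow> \<bar>f' \<tau> x\<bar> \<le> K"
    and int: "\<And>\<tau>. \<bar>\<tau> - t\<bar> < \<delta> \<Longrightarrow> integrable M (f \<tau>)"
    and meas: "f' t \<in> borel_measurable M"
  shows "((\<lambda>\<tau>. \<integral>x. f \<tau> x \<partial>M) has_real_derivative (\<integral>x. f' t x \<partial>M)) (at t)"
proof -
  interpret finite_measure M by fact
  let ?q = "\<lambda>h x. (f (t + h) x - f t x) / h"
  have lim: "(\<lambda>n. \<integral>x. ?q (X n) x \<partial>M) \<longlonglongrightarrow> (\<integral>x. f' t x \<partial>M)"
    if X: "X \<longlonglongrightarrow> 0" "\<And>n. X n \<noteq> 0" "\<And>n. \<bar>X n\<bar> < \<delta>" for X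
  proof (rule integral_dominated_convergence[where w = "\<lambda>x. K"])
    show "f' t \<in> borel_measurable M" by fact
    show "?q (X n) \<in> borel_measurable M" for n
      using int[of "t + X n"] int[of t] X(3)[of n] \<delta> by (intro borel_measurable_divide borel_measurable_diff) auto
    show "integrable M (\<lambda>x. K)" by simp
    show "AE x in M. (\<lambda>n. ?q (X n) x) \<longlonglongrightarrow> f' t x"
    proof (rule AE_I2)
      fix x assume "x \<in> space M"
      then have "((\<lambda>h. ?q h x) \<longlongrightarrow> f' t x) (at 0)"
        using der[of x t] \<delta> by (simp add: DERIV_def)
      moreover have "filterlim X (at 0) sequentially"
        using X by (auto simp: filterlim_at)
      ultimately show "(\<lambda>n. ?q (X n) x) \<longlonglongrightarrow> f' t x" by (rule filterlim_compose)
    qed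
    show "AE x in M. norm (?q (X n) x) \<le> K" for n
    proof (rule AE_I2)
      fix x assume x: "x \<in> space M"
      have "norm (f (t + X n) x - f t x) \<le> K * norm (t + X n - t)"
      proof (rule field_differentiable_bound[where S = "ball t \<delta>" and f' = "\<lambda>\<tau>. f' \<tau> x"])
        fix z assume "z \<in> ball t \<delta>"
        then have z: "\<bar>z - t\<bar> < \<delta>" by (simp add: dist_real_def abs_minus_commute)
        show "((\<lambda>\<tau>. f \<tau> x) has_real_derivative f' z x) (at z within ball t \<delta>)"
          using der[OF x z] by (rule has_field_derivative_at_within)
        show "norm (f' z x) \<le> K" using bound[OF x z] by simp
      qed (use X(3)[of n] \<delta> in \<open>auto simp: dist_real_def\<close>)
      then show "norm (?q (X n) x) \<le> K"
        using X(2)[of n] by (simp add: pos_divide_le_eq)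
    qed
  qed
  have "((\<lambda>h. ((\<integral>x. f (t + h) x \<partial>M) - (\<integral>x. f t x \<partial>M)) / h) \<longlongrightarrow> (\<integral>x. f' t x \<partial>M)) (at 0)"
    unfolding tendsto_at_iff_sequentially comp_def
  proof (intro allI impI)
    fix X :: "nat \<Rightarrow> real" assume X: "\<forall>i. X i \<in> UNIV - {0}" "X \<longlonglongrightarrow> 0"
    have "\<forall>\<^sub>F n in sequentially. \<bar>X n\<bar> < \<delta>"
      using X(2) \<delta> by (auto simp: tendsto_iff dist_real_def)
    then obtain N where N: "\<And>n. n \<ge> N \<Longrightarrow> \<bar>X n\<bar> < \<delta>"
      by (auto simp: eventually_sequentially)
    have "(\<lambda>n. \<integral>x. ?q (X (n + N)) x \<partial>M) \<longlonglongrightarrow> (\<integral>x. f' t x \<partial>M)"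
      by (rule lim) (use X N LIMSEQ_ignore_initial_segment[OF X(2), of N] in auto)
    moreover have "(\<integral>x. ?q (X (n + N)) x \<partial>M) =
        ((\<integral>x. f (t + X (n + N)) x \<partial>M) - (\<integral>x. f t x \<partial>M)) / X (n + N)" for n
      using int[of "t + X (n + N)"] int[of t] N[of "n + N"] \<delta> by simp
    ultimately have "(\<lambda>n. ((\<integral>x. f (t + X (n + N)) x \<partial>M) - (\<integral>x. f t x \<partial>M)) / X (n + N)) \<longlonglongrightarrow> (\<integral>x. f' t x \<partial>M)"
      by (simp only:)
    then show "(\<lambda>n. ((\<integral>x. f (t + X n) x \<partial>M) - (\<integral>x. f t x \<partial>M)) / X n) \<longlonglongrightarrow> (\<integral>x. f' t x \<partial>M)"
      by (rule LIMSEQ_offset)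
  qed
  then show ?thesis by (simp add: DERIV_def)
qed

text \<open>A cut-off in the value of the unknown: \<open>\<psi>\<close> vanishes on \<open>(-\<infinity>, k]\<close> with \<open>k > 0\<close>, so compositions
  with it never see the singularity of \<^term>\<open>s powr m\<close> at \<open>s = 0\<close>.\<close>

locale cutoff =
  fixes \<psi> \<psi>' :: "real \<Rightarrow> real" and k :: real
  assumes k_pos: "k > 0"
    and psi_deriv: "\<And>z. (\<psi> has_real_derivative \<psi>' z) (at z)"
    and psi'_cont: "continuous_on UNIV \<psi>'"
    and psi_zero: "\<And>z. z \<le> k \<Longrightarrow> \<psi> z = 0"
begin

lemma psi_cont: "continuous_on A \<psi>"
  using psi_deriv DERIV_isCont continuous_at_imp_continuous_on by blast

lemma psi'_zero: "z < k \<Longrightarrow> \<psi>' z = 0"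
proof -
  assume z: "z < k"
  have "((\<lambda>z. 0) has_real_derivative 0) (at z)" by simp
  then have "(\<psi> has_real_derivative 0) (at z)"
    by (rule has_field_derivative_transform_within_open[where S = "{..<k}"])
      (use z psi_zero in auto)
  then show ?thesis using psi_deriv DERIV_unique by blast
qed

end

locale pme_cutoff = pme_gauge m \<epsilon> + cutoff \<psi> \<psi>' k for m \<epsilon> \<psi> \<psi>' k
begin

text \<open>For s \<le> 0 \<open>Phi\<close> has no meaning, yet extensions beyond the ball may take
  such values; zero is the right continuation since \<open>\<psi>\<close> vanishes for small
  \<open>zeta\<close>.\<close>

definition theta :: "real \<Rightarrow> real \<Rightarrow> real" where
  "theta b s = (if s \<le> 0 then 0 else \<psi> (zeta b s))"

text \<open>Energy density: integrating \<open>Psi\<close> of the solution and differentiating in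
  time yields the equation tested with \<open>theta\<close>.\<close>

definition Psi :: "real \<Rightarrow> real \<Rightarrow> real" where
  "Psi b s = integral {0..s} (theta b)"

lemma theta_small:
  obtains s1 where "s1 > 0" "\<And>b s. \<bar>b\<bar> \<le> b0 \<Longrightarrow> s < s1 \<Longrightarrow> theta b s = 0"
    "\<And>b s. \<bar>b\<bar> \<le> b0 \<Longrightarrow> 0 < s \<Longrightarrow> s < s1 \<Longrightarrow> zeta b s < k"
proof -
  obtain s1 where s1: "s1 > 0" "\<And>b s. \<bar>b\<bar> \<le> b0 \<Longrightarrow> 0 < s \<Longrightarrow> s < s1 \<Longrightarrow> zeta b s < k"
    using zeta_small[OF k_pos] by blast
  have "theta b s = 0" if "\<bar>b\<bar> \<le> b0" "s < s1" for b s
    using s1(2)[of b s] that psi_zero[of "zeta b s"] by (auto simp: theta_def)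
  then show ?thesis using s1 that by blast
qed

lemma Phi_inv_cont: "continuous_on A Phi_inv"
  using Phi_inv_isCont by (simp add: continuous_at_imp_continuous_on)

lemma Phi_cont: "A \<subseteq> {0<..} \<Longrightarrow> continuous_on A Phi"
  using Phi_deriv DERIV_isCont by (force intro!: continuous_at_imp_continuous_on)

lemma theta_cont: "continuous_on UNIV (\<lambda>p. theta (fst p) (snd p))"
proof -
  \<comment> \<open>The threshold below which \<open>theta\<close> vanishes is uniform only for
    bounded b, hence the exhaustion by strips.\<close>
  have "continuous_on ({-c<..<c} \<times> UNIV) (\<lambda>p. theta (fst p) (snd p))" for c
  proof -
    obtain s1 where s1: "s1 > 0" "\<And>b s. \<bar>b\<bar> \<le> c \<Longrightarrow> s < s1 \<Longrightarrow> theta b s = 0"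
      using theta_small[of c] by metis
    have eq: "{-c<..<c} \<times> UNIV = ({-c<..<c} \<times> {0<..}) \<union> ({-c<..<c} \<times> {..<s1})"
      using s1(1) by auto
    have 1: "continuous_on ({-c<..<c} \<times> {0<..}) (\<lambda>p. theta (fst p) (snd p))"
    proof -
      have "continuous_on ({-c<..<c} \<times> {0<..}) (\<lambda>p. \<psi> (Phi_inv (Phi (snd p) + fst p)))"
        by (intro continuous_on_compose2[OF psi_cont[of UNIV]] continuous_on_compose2[OF Phi_inv_cont[of UNIV]]
            continuous_on_add continuous_on_compose2[OF Phi_cont[of "{0<..}"]] continuous_intros) auto
      then show ?thesis
        by (rule continuous_on_eq) (auto simp: theta_def zeta_def)
    qed
    have 2: "continuous_on ({-c<..<c} \<times> {..<s1}) (\<lambda>p. theta (fst p) (snd p))"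
    proof (rule continuous_on_eq[OF continuous_on_const[of _ 0]])
      show "0 = theta (fst p) (snd p)" if "p \<in> {-c<..<c} \<times> {..<s1}" for p
        using that s1(2)[of "fst p" "snd p"] by (auto simp: mem_Times_iff)
    qed
    show ?thesis unfolding eq
      by (rule continuous_on_open_Un[OF _ _ 1 2]) (auto intro!: open_Times)
  qed
  then have "isCont (\<lambda>p. theta (fst p) (snd p)) p" for p
  proof -
    let ?A = "{-(\<bar>fst p\<bar> + 1)<..<\<bar>fst p\<bar> + 1} \<times> (UNIV :: real set)"
    have "open ?A" by (intro open_Times) auto
    moreover have "- (\<bar>fst p\<bar> + 1) < fst p" "fst p < \<bar>fst p\<bar> + 1" by linarith+
    then have "p \<in> ?A" by (simp add: mem_Times_iff)
    ultimately show ?thesis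
      using \<open>\<And>c. continuous_on ({-c<..<c} \<times> UNIV) (\<lambda>p. theta (fst p) (snd p))\<close>[of "\<bar>fst p\<bar> + 1"]
        continuous_on_eq_continuous_at by blast
  qed
  then show ?thesis by (simp add: continuous_at_imp_continuous_on)
qed

lemma theta_cont_comp:
  assumes "continuous_on A f" "continuous_on A h"
  shows "continuous_on A (\<lambda>x. theta (f x) (h x))"
  using continuous_on_compose2[OF theta_cont, of A "\<lambda>x. (f x, h x)"] assms
  by (auto intro: continuous_on_Pair)

lemma Psi_neg: "s \<le> 0 \<Longrightarrow> Psi b s = 0"
  unfolding Psi_def by (cases "s = 0") auto

lemma Psi_deriv: "(Psi b has_real_derivative theta b s) (at s)"
proof (cases "s > 0")
  case True
  have "((\<lambda>x. integral {0..x} (theta b)) has_real_derivative theta b s) (at s within {0..s + 1})"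
    using True by (intro integral_has_real_derivative theta_cont_comp) (auto intro: continuous_intros)
  then have "(Psi b has_real_derivative theta b s) (at s within {0..s + 1})"
    by (simp add: Psi_def[abs_def])
  then show ?thesis using True at_within_interior[of s "{0..s+1}"] by simp
next
  case False
  obtain s1 where s1: "s1 > 0" "\<And>s. s < s1 \<Longrightarrow> theta b s = 0"
    using theta_small[of "\<bar>b\<bar>"] by (metis order_refl)
  have "Psi b x = 0" if "x < s1" for x
  proof (cases "x \<le> 0")
    case False
    then have "integral {0..x} (theta b) = integral {0..x} (\<lambda>s. 0)"
      using that s1 by (intro Henstock_Kurzweil_Integration.integral_cong) auto
    then show ?thesis by (simp add: Psi_def)
  qed (simp add: Psi_neg)
  have "((\<lambda>s. 0) has_real_derivative 0) (at s)" by simp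
  then have "(Psi b has_real_derivative 0) (at s)"
    by (rule has_field_derivative_transform_within_open[where S = "{..<s1}"])
      (use False s1 \<open>\<And>x. x < s1 \<Longrightarrow> Psi b x = 0\<close> in auto)
  then show ?thesis using False s1 by (simp add: theta_def)
qed

text \<open>Scaling the integration variable gives \<open>Psi b s\<close> as s times an integral
  over the fixed interval [0, 1], so the moving endpoint becomes a continuous parameter.\<close>

lemma Psi_cont_comp:
  fixes f h :: "'a::euclidean_space \<Rightarrow> real"
  assumes "continuous_on A f" "continuous_on A h" "\<And>x. x \<in> A \<Longrightarrow> h x \<ge> 0"
  shows "continuous_on A (\<lambda>x. Psi (f x) (h x))"
proof -
  have "continuous_on A (\<lambda>x. h x * integral (cbox 0 1) (\<lambda>\<sigma>. theta (f x) (h x * \<sigma>)))"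
  proof (intro continuous_on_mult assms(2) integral_continuous_on_param)
    have "continuous_on (A \<times> cbox 0 1) (\<lambda>p. theta (f (fst p)) (h (fst p) * snd p))"
      by (intro theta_cont_comp continuous_on_compose2[OF assms(1)] continuous_on_mult
          continuous_on_compose2[OF assms(2)] continuous_intros) auto
    then show "continuous_on (A \<times> cbox 0 1) (\<lambda>(x, \<sigma>). theta (f x) (h x * \<sigma>))"
      by (simp add: case_prod_unfold)
  qed
  moreover have "h x * integral (cbox 0 1) (\<lambda>\<sigma>. theta (f x) (h x * \<sigma>)) = Psi (f x) (h x)" if "x \<in> A" for x
  proof -
    let ?s = "h x"
    have "((\<lambda>\<sigma>. ?s * theta (f x) (?s * \<sigma>)) has_integral Psi (f x) (?s * 1) - Psi (f x) (?s * 0)) {0..1}"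
    proof (rule fundamental_theorem_of_calculus)
      fix \<sigma> :: real
      have "((\<lambda>\<sigma>. ?s * \<sigma>) has_real_derivative ?s) (at \<sigma>)"
        by (auto intro!: derivative_eq_intros)
      from DERIV_chain2[OF Psi_deriv this]
      show "((\<lambda>\<sigma>. Psi (f x) (?s * \<sigma>)) has_vector_derivative ?s * theta (f x) (?s * \<sigma>)) (at \<sigma> within {0..1})"
        by (simp add: has_real_derivative_iff_has_vector_derivative[symmetric] mult.commute has_field_derivative_at_within)
    qed simp
    then have "integral {0..1} (\<lambda>\<sigma>. ?s * theta (f x) (?s * \<sigma>)) = Psi (f x) (?s * 1) - Psi (f x) (?s * 0)"
      by (rule integral_unique)
    then show ?thesis
      unfolding Henstock_Kurzweil_Integration.integral_mult_right by (simp add: Psi_neg)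
  qed
  ultimately show ?thesis by (rule continuous_on_eq) auto
qed

end

subsection \<open>Energy identity\<close>

text \<open>\<open>g\<close> stands for a smooth extension of a solution beyond the closed ball; it may be negative
  outside.\<close>

locale pme_domain = pme_gauge m \<epsilon> for m \<epsilon> +
  fixes r :: real and U :: "('a::euclidean_space \<times> real) set" and g :: "'a \<times> real \<Rightarrow> real"
    and V :: "'a \<Rightarrow> 'a"
  assumes r: "r \<ge> 1" and U: "open U" "cball 0 r \<times> {0<..} \<subseteq> U"
    and g_C1: "C1_on U g"
    and g_C2: "\<And>v. C1_on U (\<lambda>z. frechet_derivative g (at z) v)"
    and g_nonneg: "\<And>x t. x \<in> cball 0 r \<Longrightarrow> t > 0 \<Longrightarrow> g (x, t) \<ge> 0"
    and V: "C1_on UNIV V"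
begin

definition M :: "'a measure" where "M = lebesgue_on (ball 0 r)"

definition g_t :: "real \<Rightarrow> 'a \<Rightarrow> real" where
  "g_t t x = frechet_derivative g (at (x, t)) (0, 1)"

definition slice :: "real \<Rightarrow> 'a set" where "slice t = {x. (x, t) \<in> U}"

definition grad :: "real \<Rightarrow> 'a \<Rightarrow> 'a" where "grad t x = gradient (\<lambda>y. g (y, t)) (at x)"

definition flux :: "real \<Rightarrow> 'a \<Rightarrow> 'a" where
  "flux t x = dphi (g (x, t)) *\<^sub>R grad t x + g (x, t) *\<^sub>R V x"

lemma space_M: "x \<in> space M \<longleftrightarrow> x \<in> ball 0 r"
  by (simp add: M_def space_restrict_space)

lemma finite_M: "finite_measure M"
  unfolding M_def by (rule finite_measure_lebesgue_on_ball)

lemma integrable_M: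
  fixes f :: "'a \<Rightarrow> 'b::euclidean_space"
  shows "continuous_on (cball 0 r) f \<Longrightarrow> integrable M f"
  unfolding M_def by (rule continuous_cball_integrable_lebesgue_on_ball)

lemma slice: "t > 0 \<Longrightarrow> cball 0 r \<subseteq> slice t" "open (slice t)"
proof -
  show "t > 0 \<Longrightarrow> cball 0 r \<subseteq> slice t" using U(2) by (auto simp: slice_def)
  have "slice t = (\<lambda>x. (x, t)) -` U" by (auto simp: slice_def)
  then show "open (slice t)"
    using U(1) by (auto intro!: open_vimage continuous_intros)
qed

lemma g_slice_C1: "C1_on (slice t) (\<lambda>x. g (x, t))"
  unfolding slice_def by (rule C1_on_slice[OF g_C1])

lemma grad_C1: "C1_on (slice t) (grad t)"
proof -
  have "C1_on (slice t) (\<lambda>x. \<Sum>b\<in>Basis. frechet_derivative g (at (x, t)) (b, 0) *\<^sub>R b)"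
    by (intro C1_on_sum C1_on_scaleR C1_on_const) (auto simp: slice_def intro: C1_on_slice[OF g_C2])
  then show ?thesis
  proof (rule C1_on_cong[OF slice(2)])
    fix x assume x: "x \<in> slice t"
    have "((\<lambda>x. g (x, t)) has_derivative (\<lambda>v. frechet_derivative g (at (x, t)) (v, 0))) (at x)"
    proof (rule has_derivative_compose[of "\<lambda>x. (x, t)" "\<lambda>v. (v, 0)" x UNIV g, simplified])
      show "((\<lambda>x. (x, t)) has_derivative (\<lambda>v. (v, 0))) (at x)"
        by (intro derivative_intros)
      show "(g has_derivative frechet_derivative g (at (x, t))) (at (x, t))"
        using x C1_on_has_derivative[OF g_C1] by (simp add: slice_def)
    qed
    from frechet_derivative_at[OF this]
    show "(\<Sum>b\<in>Basis. frechet_derivative g (at (x, t)) (b, 0) *\<^sub>R b) = grad t x"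
      unfolding grad_def gradient_def by metis
  qed
qed

lemma grad: "x \<in> slice t \<Longrightarrow> ((\<lambda>y. g (y, t)) has_derivative (\<lambda>v. grad t x \<bullet> v)) (at x)"
  unfolding grad_def by (rule C1_on_gradient[OF g_slice_C1])

lemma g_t_deriv: "(x, t) \<in> U \<Longrightarrow> ((\<lambda>\<tau>. g (x, \<tau>)) has_real_derivative g_t t x) (at t)"
proof -
  assume xt: "(x, t) \<in> U"
  have lin: "linear (frechet_derivative g (at (x, t)))"
    using g_C1 xt by (intro linear_frechet_derivative) (auto simp: C1_on_def)
  have "((\<lambda>\<tau>. g (x, \<tau>)) has_derivative (\<lambda>v. frechet_derivative g (at (x, t)) (0, v))) (at t)"
  proof (rule has_derivative_compose[of "\<lambda>\<tau>. (x, \<tau>)" "\<lambda>v. (0, v)" t UNIV g, simplified])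
    show "((\<lambda>\<tau>. (x, \<tau>)) has_derivative (\<lambda>v. (0, v))) (at t)"
      by (intro derivative_intros)
    show "(g has_derivative frechet_derivative g (at (x, t))) (at (x, t))"
      using xt C1_on_has_derivative[OF g_C1] by simp
  qed
  moreover have "(\<lambda>v. frechet_derivative g (at (x, t)) (0, v)) = (*) (g_t t x)"
  proof
    fix v :: real
    have "frechet_derivative g (at (x, t)) (v *\<^sub>R (0, 1)) = v *\<^sub>R g_t t x"
      unfolding g_t_def by (rule linear_cmul[OF lin])
    then show "frechet_derivative g (at (x, t)) (0, v) = g_t t x * v" by (simp add: mult.commute)
  qed
  ultimately show ?thesis by (simp add: has_field_derivative_def)
qed

lemma g_cont: "continuous_on U g" by (rule C1_on_imp_continuous_on[OF g_C1])

lemma g_slice_cont: "t > 0 \<Longrightarrow> continuous_on (cball 0 r) (\<lambda>x. g (x, t))"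
  using continuous_on_subset[OF C1_on_imp_continuous_on[OF g_slice_C1] slice(1)] .

lemma open_slice_pos: "open {x \<in> slice t. g (x, t) > 0}"
  using continuous_open_preimage[OF C1_on_imp_continuous_on[OF g_slice_C1] slice(2), of "{0<..}"]
  by (simp add: vimage_def Int_def conj_commute)

lemma open_slice_small: "open {x \<in> slice t. g (x, t) < s}"
  using continuous_open_preimage[OF C1_on_imp_continuous_on[OF g_slice_C1] slice(2), of "{..<s}"]
  by (simp add: vimage_def Int_def conj_commute)

lemma flux_C1: "C1_on {x \<in> slice t. g (x, t) > 0} (flux t)"
proof -
  let ?P = "{x \<in> slice t. g (x, t) > 0}"
  have sub: "?P \<subseteq> slice t" by auto
  have d: "C1_on ?P (\<lambda>x. dphi (g (x, t)))"
  proof (rule C1_on_real_compose[OF C1_on_subset[OF g_slice_C1 sub], where T = "{0<..}"])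
    show "continuous_on {0<..} (\<lambda>y. m * (m - 1) * y powr (m - 2))"
      by (intro continuous_intros) auto
  qed (auto intro: dphi_deriv)
  show ?thesis unfolding flux_def[abs_def]
    by (intro C1_on_add C1_on_scaleR d C1_on_subset[OF grad_C1 sub] C1_on_subset[OF g_slice_C1 sub]
        C1_on_subset[OF V]) auto
qed

end

text \<open>V is split into the gradient of a bounded potential B and a remainder W. The equation
  and the no-flux condition are imposed only where g is positive: there \<phi>(g) is twice
  differentiable, and elsewhere the test functions vanish.\<close>

locale pme_flow = pme_domain m \<epsilon> r U g V
  for m \<epsilon> r and b0 :: real and U :: "('a::euclidean_space \<times> real) set" and g V +
  fixes W :: "'a \<Rightarrow> 'a" and B :: "'a \<Rightarrow> real"
  assumes W: "continuous_on UNIV W"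
    and B: "\<And>x. (B has_derivative (\<lambda>v. (V x - W x) \<bullet> v)) (at x)"
    and B_bound: "\<And>x. \<bar>B x\<bar> \<le> b0"
    and pde: "\<And>x t. x \<in> ball 0 r \<Longrightarrow> t > 0 \<Longrightarrow> g (x, t) > 0 \<Longrightarrow> g_t t x = divergence (flux t) x"
    and bc: "\<And>x t. norm x = r \<Longrightarrow> t > 0 \<Longrightarrow> g (x, t) > 0 \<Longrightarrow> flux t x \<bullet> x = 0"
begin

definition zt :: "real \<Rightarrow> 'a \<Rightarrow> real" where "zt t x = zeta (B x) (g (x, t))"

definition zgrad :: "real \<Rightarrow> 'a \<Rightarrow> 'a" where
  "zgrad t x = (zt t x / dphi (zt t x)) *\<^sub>R ((dphi (g (x, t)) / g (x, t)) *\<^sub>R grad t x + (V x - W x))"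

lemma flux_zgrad:
  assumes "g (x, t) > 0"
  shows "flux t x = (g (x, t) / zt t x * dphi (zt t x)) *\<^sub>R zgrad t x + g (x, t) *\<^sub>R W x"
proof -
  have z: "zt t x > 0" by (simp add: zt_def zeta_pos)
  have d: "dphi (zt t x) > 0" by (rule dphi_gt)
  have "(g (x, t) / zt t x * dphi (zt t x)) *\<^sub>R zgrad t x =
    g (x, t) *\<^sub>R ((dphi (g (x, t)) / g (x, t)) *\<^sub>R grad t x + (V x - W x))"
    using z d by (simp add: zgrad_def)
  then show ?thesis using assms by (simp add: flux_def algebra_simps)
qed

lemma B_cont: "continuous_on A B"
  by (intro continuous_at_imp_continuous_on ballI has_derivative_continuous[OF B])

lemma B_C1: "C1_on S B"
  by (rule C1_onI[OF B])
     (intro continuous_intros continuous_on_subset[OF C1_on_imp_continuous_on[OF V]]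
       continuous_on_subset[OF W] subset_UNIV)

lemma zt_deriv:
  assumes "x \<in> slice t" "g (x, t) > 0"
  shows "(zt t has_derivative (\<lambda>v. zgrad t x \<bullet> v)) (at x)"
proof -
  have "((\<lambda>y. Phi (g (y, t))) has_derivative (\<lambda>v. (dphi (g (x, t)) / g (x, t)) * (grad t x \<bullet> v))) (at x)"
    using has_derivative_compose[OF grad[OF assms(1)], of Phi "(*) (dphi (g (x, t)) / g (x, t))"]
      Phi_deriv[OF assms(2)] by (simp add: has_field_derivative_def)
  then have *: "((\<lambda>y. Phi (g (y, t)) + B y) has_derivative
      (\<lambda>v. (dphi (g (x, t)) / g (x, t)) * (grad t x \<bullet> v) + (V x - W x) \<bullet> v)) (at x)"
    by (intro has_derivative_add B)
  have "(Phi_inv has_derivative (*) (zt t x / dphi (zt t x))) (at (Phi (g (x, t)) + B x))"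
    using Phi_inv_deriv[of "Phi (g (x, t)) + B x"] by (simp add: zt_def zeta_def has_field_derivative_def)
  note has_derivative_compose[OF * this]
  moreover have "(\<lambda>v. (zt t x / dphi (zt t x)) * ((dphi (g (x, t)) / g (x, t)) * (grad t x \<bullet> v) + (V x - W x) \<bullet> v)) =
      (\<lambda>v. zgrad t x \<bullet> v)"
    by (simp add: zgrad_def inner_add_left)
  ultimately show ?thesis by (simp add: zt_def[abs_def] zeta_def[abs_def])
qed

lemma zt_C1: "C1_on {x \<in> slice t. g (x, t) > 0} (zt t)"
proof -
  let ?P = "{x \<in> slice t. g (x, t) > 0}"
  have sub: "?P \<subseteq> slice t" by auto
  have "C1_on ?P (\<lambda>x. Phi (g (x, t)))"
  proof (rule C1_on_real_compose[OF C1_on_subset[OF g_slice_C1 sub], where T = "{0<..}"])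
    show "continuous_on {0<..} (\<lambda>s. dphi s / s)"
      unfolding dphi_def by (intro continuous_intros) auto
  qed (auto intro: Phi_deriv)
  then have "C1_on ?P (\<lambda>x. Phi (g (x, t)) + B x)" by (intro C1_on_add B_C1)
  then have "C1_on ?P (\<lambda>x. Phi_inv (Phi (g (x, t)) + B x))"
  proof (rule C1_on_real_compose[where T = UNIV])
    show "(Phi_inv has_real_derivative Phi_inv y / dphi (Phi_inv y)) (at y)" for y by (rule Phi_inv_deriv)
    have "continuous_on UNIV Phi_inv"
      using Phi_inv_isCont by (simp add: continuous_at_imp_continuous_on)
    moreover have "continuous_on UNIV (\<lambda>y. dphi (Phi_inv y))"
      unfolding dphi_def using Phi_inv(1) calculation
      by (intro continuous_intros) (auto simp: less_imp_neq[symmetric])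
    moreover have "dphi y \<noteq> 0" for y using dphi_gt(2)[of y] by simp
    ultimately show "continuous_on UNIV (\<lambda>y. Phi_inv y / dphi (Phi_inv y))"
      by (intro continuous_on_divide) auto
  qed auto
  then show ?thesis by (simp add: zt_def[abs_def] zeta_def)
qed

end

section \<open>Testing the equation with truncated functions\<close>

locale pme_flow_cutoff = pme_flow m \<epsilon> r b0 U g V W B + pme_cutoff m \<epsilon> \<psi> \<psi>' k
  for m \<epsilon> r b0 and U :: "('a::euclidean_space \<times> real) set" and g V W B \<psi> \<psi>' k
begin

definition Th :: "real \<Rightarrow> 'a \<Rightarrow> real" where "Th t x = theta (B x) (g (x, t))"

definition pgrad :: "real \<Rightarrow> 'a \<Rightarrow> 'a" where
  "pgrad t x = (if g (x, t) \<le> 0 then 0 else \<psi>' (zt t x) *\<^sub>R zgrad t x)"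

text \<open>On a time slice the sets g > 0 and g < s1 are open and cover everything. On the first
  the chain rule applies; on the second the test function and its gradient are zero, with one s1 for
  all x because |B| \<le> b0.\<close>

lemma Th_C1: "C1_on (slice t) (Th t)"
  and Th_grad: "x \<in> slice t \<Longrightarrow> (Th t has_derivative (\<lambda>v. pgrad t x \<bullet> v)) (at x)"
  and Th_flux_C1: "C1_on (slice t) (\<lambda>x. Th t x *\<^sub>R flux t x)"
  and pgrad_small: "\<exists>s1>0. \<forall>x. g (x, t) < s1 \<longrightarrow> Th t x = 0 \<and> pgrad t x = 0"
proof -
  obtain s1 where s1: "s1 > 0" "\<And>b s. \<bar>b\<bar> \<le> b0 \<Longrightarrow> s < s1 \<Longrightarrow> theta b s = 0"
    "\<And>b s. \<bar>b\<bar> \<le> b0 \<Longrightarrow> 0 < s \<Longrightarrow> s < s1 \<Longrightarrow> zeta b s < k"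
    using theta_small[of b0] by blast
  let ?P = "{x \<in> slice t. g (x, t) > 0}" and ?N = "{x \<in> slice t. g (x, t) < s1}"
  have cover: "slice t = ?P \<union> ?N" using s1(1) by auto
  have ThN: "Th t x = 0" if "g (x, t) < s1" for x
    using s1(2)[OF B_bound that] by (simp add: Th_def)
  have pN: "pgrad t x = 0" if "g (x, t) < s1" for x
    using s1(3)[OF B_bound[of x], of "g (x, t)"] that psi'_zero by (auto simp: pgrad_def zt_def)
  have ThP: "C1_on ?P (Th t)"
  proof (rule C1_on_cong[OF open_slice_pos])
    show "C1_on ?P (\<lambda>x. \<psi> (zt t x))"
      by (rule C1_on_real_compose[OF zt_C1 psi_deriv psi'_cont]) auto
    show "\<psi> (zt t x) = Th t x" if "x \<in> ?P" for x
      using that by (simp add: Th_def theta_def zt_def)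
  qed
  have ThN': "C1_on ?N (Th t)"
  proof (rule C1_on_cong[of ?N "\<lambda>x. 0"])
    show "open ?N" by (rule open_slice_small)
    show "C1_on ?N (\<lambda>x. 0 :: real)" by (rule C1_on_const)
    show "0 = Th t x" if "x \<in> ?N" for x using ThN[of x] that by auto
  qed
  show "C1_on (slice t) (Th t)"
    using cover C1_on_Un[OF open_slice_pos open_slice_small ThP ThN'] by simp
  have FP: "C1_on ?P (\<lambda>x. Th t x *\<^sub>R flux t x)" by (rule C1_on_scaleR[OF ThP flux_C1])
  have FN: "C1_on ?N (\<lambda>x. Th t x *\<^sub>R flux t x)"
  proof (rule C1_on_cong[of ?N "\<lambda>x. 0"])
    show "open ?N" by (rule open_slice_small)
    show "C1_on ?N (\<lambda>x. 0 :: 'a)" by (rule C1_on_const)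
    show "0 = Th t x *\<^sub>R flux t x" if "x \<in> ?N" for x using ThN[of x] that by auto
  qed
  show "C1_on (slice t) (\<lambda>x. Th t x *\<^sub>R flux t x)"
    using cover C1_on_Un[OF open_slice_pos open_slice_small FP FN] by simp
  show "\<exists>s1>0. \<forall>x. g (x, t) < s1 \<longrightarrow> Th t x = 0 \<and> pgrad t x = 0"
    using s1(1) ThN pN by blast
  show "(Th t has_derivative (\<lambda>v. pgrad t x \<bullet> v)) (at x)" if x: "x \<in> slice t"
  proof (cases "g (x, t) > 0")
    case True
    have "((\<lambda>x. \<psi> (zt t x)) has_derivative (\<lambda>v. \<psi>' (zt t x) * (zgrad t x \<bullet> v))) (at x)"
      using has_derivative_compose[OF zt_deriv[OF x True], of \<psi> "(*) (\<psi>' (zt t x))"]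
        psi_deriv[of "zt t x"] by (simp add: has_field_derivative_def)
    then have "(Th t has_derivative (\<lambda>v. \<psi>' (zt t x) * (zgrad t x \<bullet> v))) (at x)"
      by (rule has_derivative_transform_within_open[OF _ open_slice_pos])
         (use x True in \<open>auto simp: Th_def theta_def zt_def\<close>)
    then show ?thesis using True by (simp add: pgrad_def)
  next
    case False
    have "(Th t has_derivative (\<lambda>v. 0)) (at x)"
      by (rule has_derivative_transform_within_open[OF has_derivative_const[of 0] open_slice_small[of t s1]])
         (use x False s1(1) ThN in auto)
    then show ?thesis using False by (simp add: pgrad_def)
  qed
qed

text \<open>Integrate the divergence of \<open>Th t x *\<^sub>R flux t x\<close>. Its normal
  component is zero on the sphere, by the no-flux condition where g is positive and by the
  truncation elsewhere; inside, the product rule and the equation give the two integrands.\<close>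

lemma energy_identity:
  assumes t: "t > 0"
  shows "integrable M (\<lambda>x. Th t x * g_t t x)" "integrable M (\<lambda>x. pgrad t x \<bullet> flux t x)"
    "(\<integral>x. Th t x * g_t t x \<partial>M) = - (\<integral>x. pgrad t x \<bullet> flux t x \<partial>M)"
proof -
  let ?F = "\<lambda>x. Th t x *\<^sub>R flux t x"
  have div0: "(\<integral>x. divergence ?F x \<partial>M) = 0"
    unfolding M_def
  proof (rule integral_divergence_zero[OF _ slice(2) slice(1)[OF t] Th_flux_C1])
    show "?F x \<bullet> x = 0" if "norm x = r" for x
    proof (cases "g (x, t) > 0")
      case True
      then show ?thesis using bc[OF that t True] by simp
    qed (simp add: Th_def theta_def)
  qed (use r in simp)
  have div_eq: "divergence ?F x = Th t x * g_t t x + pgrad t x \<bullet> flux t x" if x: "x \<in> ball 0 r" for x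
  proof (cases "g (x, t) > 0")
    case True
    have xs: "x \<in> slice t" using x slice(1)[OF t] by auto
    have "flux t differentiable (at x)" using flux_C1[of t] xs True by (simp add: C1_on_def)
    then have "divergence ?F x = Th t x * divergence (flux t) x + pgrad t x \<bullet> flux t x"
      by (rule divergence_scaleR[OF Th_grad[OF xs]])
    also have "divergence (flux t) x = g_t t x"
      using pde[OF x t True] by simp
    finally show ?thesis .
  next
    case False
    have xs: "x \<in> slice t" using x slice(1)[OF t] by auto
    obtain s1 where s1: "s1 > 0" "\<And>x. g (x, t) < s1 \<Longrightarrow> Th t x = 0" "\<And>x. g (x, t) < s1 \<Longrightarrow> pgrad t x = 0"
      using pgrad_small[of t] by blast
    have "divergence ?F x = divergence (\<lambda>x. 0) x"
      by (rule divergence_cong[OF open_slice_small[of t s1]]) (use xs s1 False in auto)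
    also have "\<dots> = 0" using divergence_eq[OF has_derivative_const] by simp
    finally show ?thesis using s1 False by simp
  qed
  have c1: "continuous_on (cball 0 r) (\<lambda>x. Th t x * g_t t x)"
  proof (intro continuous_on_mult)
    show "continuous_on (cball 0 r) (Th t)"
      by (rule continuous_on_subset[OF C1_on_imp_continuous_on[OF Th_C1] slice(1)[OF t]])
    show "continuous_on (cball 0 r) (g_t t)"
      unfolding g_t_def using U(2) t
      by (intro continuous_on_compose2[OF C1_on_continuous_deriv[OF g_C1]] continuous_intros) auto
  qed
  then show i1: "integrable M (\<lambda>x. Th t x * g_t t x)" by (rule integrable_M)
  have c2: "continuous_on (cball 0 r) (divergence ?F)"
    unfolding divergence_def
    using continuous_on_subset[OF C1_on_continuous_deriv[OF Th_flux_C1] slice(1)[OF t]]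
    by (intro continuous_intros)
  \<comment> \<open>Continuity is available for the divergence and for
    \<open>Th t x * g_t t x\<close>; the gradient term inherits integrability as their
    difference.\<close>
  then have i2: "integrable M (\<lambda>x. divergence ?F x - Th t x * g_t t x)"
    using c1 by (intro integrable_M continuous_on_diff)
  show i3: "integrable M (\<lambda>x. pgrad t x \<bullet> flux t x)"
  proof -
    have "integrable M (\<lambda>x. divergence ?F x - Th t x * g_t t x) \<longleftrightarrow> integrable M (\<lambda>x. pgrad t x \<bullet> flux t x)"
      by (rule Bochner_Integration.integrable_cong) (auto simp: space_M div_eq)
    then show ?thesis using i2 by simp
  qed
  have "(\<integral>x. divergence ?F x \<partial>M) = (\<integral>x. Th t x * g_t t x + pgrad t x \<bullet> flux t x \<partial>M)"
    by (rule Bochner_Integration.integral_cong) (auto simp: space_M div_eq)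
  then show "(\<integral>x. Th t x * g_t t x \<partial>M) = - (\<integral>x. pgrad t x \<bullet> flux t x \<partial>M)"
    using div0 i1 i3 by simp
qed

definition E :: "real \<Rightarrow> real" where "E t = (\<integral>x. Psi (B x) (g (x, t)) \<partial>M)"

lemma integrable_Psi: "t > 0 \<Longrightarrow> integrable M (\<lambda>x. Psi (B x) (g (x, t)))"
  by (intro integrable_M Psi_cont_comp B_cont g_slice_cont g_nonneg)

text \<open>Domination near t comes from compactness of the closed ball times [t / 2, 2 t], a time
  interval that stays away from the singular time 0.\<close>

lemma E_deriv:
  assumes t: "t > 0"
  shows "(E has_real_derivative - (\<integral>x. pgrad t x \<bullet> flux t x \<partial>M)) (at t)"
proof -
  let ?f' = "\<lambda>\<tau> x. Th \<tau> x * g_t \<tau> x"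
  let ?K = "cball (0::'a) r \<times> {t / 2..2 * t}"
  have sub: "?K \<subseteq> U" using U(2) t by auto
  define F where "F = (\<lambda>p. theta (B (fst p)) (g p) * frechet_derivative g (at p) (0, 1))"
  have BK: "continuous_on ?K (\<lambda>p. B (fst p))"
    by (rule continuous_on_compose2[OF B_cont[of UNIV] continuous_on_fst[OF continuous_on_id]]) simp
  have "continuous_on ?K F"
    unfolding F_def
    by (rule continuous_on_mult[OF theta_cont_comp[OF BK continuous_on_subset[OF g_cont sub]]
      continuous_on_subset[OF C1_on_continuous_deriv[OF g_C1] sub]])
  moreover have "compact ?K" by (simp add: compact_Times)
  ultimately obtain K where K: "\<And>p. p \<in> ?K \<Longrightarrow> norm (F p) \<le> K"
    using continuous_on_compact_bound by metis
  have "((\<lambda>\<tau>. \<integral>x. Psi (B x) (g (x, \<tau>)) \<partial>M) has_real_derivative (\<integral>x. ?f' t x \<partial>M)) (at t)"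
  proof (rule has_real_derivative_integral[OF finite_M, where \<delta> = "t / 2"])
    fix x \<tau> assume x: "x \<in> space M" and \<tau>: "\<bar>\<tau> - t\<bar> < t / 2"
    have \<tau>': "t / 2 \<le> \<tau>" "\<tau> \<le> 2 * t" using \<tau> by linarith+
    have xb: "x \<in> cball 0 r" using x by (simp add: space_M)
    then have p: "(x, \<tau>) \<in> ?K" using \<tau>' by simp
    show "((\<lambda>\<tau>. Psi (B x) (g (x, \<tau>))) has_real_derivative ?f' \<tau> x) (at \<tau>)"
      unfolding Th_def by (rule DERIV_chain2[OF Psi_deriv g_t_deriv]) (use p sub in blast)
    show "\<bar>?f' \<tau> x\<bar> \<le> K"
      using K[OF p] by (simp add: F_def Th_def g_t_def)
  next
    show "integrable M (\<lambda>x. Psi (B x) (g (x, \<tau>)))" if "\<bar>\<tau> - t\<bar> < t / 2" for \<tau>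
      by (rule integrable_Psi) (use that in linarith)
    show "?f' t \<in> borel_measurable M"
      using energy_identity(1)[OF t] by auto
  qed (use t in simp)
  then show ?thesis using energy_identity(3)[OF t] by (simp add: E_def[abs_def])
qed

end

subsection \<open>Mass\<close>

text \<open>Truncation level and transition scale are both \<delta>, so that the derivative times
  z^2 is of order \<delta>; this makes the drift error in the mass estimate small.\<close>

lemma cutoff_square:
  assumes "\<delta> > 0"
  shows "cutoff (\<lambda>z. (max 0 (z - \<delta>))\<^sup>2 / ((max 0 (z - \<delta>))\<^sup>2 + \<delta>\<^sup>2))
    (\<lambda>z. 2 * max 0 (z - \<delta>) * \<delta>\<^sup>2 / ((max 0 (z - \<delta>))\<^sup>2 + \<delta>\<^sup>2)\<^sup>2) \<delta>"
proof
  have pos: "\<delta>\<^sup>2 > 0" using assms by simp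
  have ne: "(max 0 (z - \<delta>))\<^sup>2 + \<delta>\<^sup>2 \<noteq> 0" for z
    using pos zero_le_power2[of "max 0 (z - \<delta>)"] by linarith
  show "((\<lambda>z. (max 0 (z - \<delta>))\<^sup>2 / ((max 0 (z - \<delta>))\<^sup>2 + \<delta>\<^sup>2)) has_real_derivative
      2 * max 0 (z - \<delta>) * \<delta>\<^sup>2 / ((max 0 (z - \<delta>))\<^sup>2 + \<delta>\<^sup>2)\<^sup>2) (at z)" for z
  proof -
    have "((\<lambda>z. z - \<delta>) has_real_derivative 1) (at z)" by (auto intro!: derivative_eq_intros)
    from DERIV_chain2[where g = "\<lambda>z. z - \<delta>", OF has_real_derivative_square_cutoff[OF pos] this]
    show ?thesis by simp
  qed
  show "continuous_on UNIV (\<lambda>z. 2 * max 0 (z - \<delta>) * \<delta>\<^sup>2 / ((max 0 (z - \<delta>))\<^sup>2 + \<delta>\<^sup>2)\<^sup>2)"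
    using ne by (intro continuous_intros) auto
qed (use assms in auto)

lemma cutoff_power:
  assumes "k > 0" "n \<ge> 2"
  shows "cutoff (\<lambda>z. c * max 0 (z - k) ^ n) (\<lambda>z. c * (real n * max 0 (z - k) ^ (n - 1))) k"
proof
  show "((\<lambda>z. c * max 0 (z - k) ^ n) has_real_derivative c * (real n * max 0 (z - k) ^ (n - 1))) (at z)" for z
    by (rule DERIV_cmult[OF has_real_derivative_max_power_shift[OF assms(2)]])
qed (use assms in \<open>auto intro!: continuous_intros simp: power_0_left\<close>)

context pme_flow
begin

text \<open>Test with a smooth increasing approximation of the indicator of
  \<open>(0, \<infinity>)\<close>; the error made by the drift is of the order of the truncation level.\<close>

lemma mass_decreasing:
  assumes B0: "\<And>x. B x = 0" and WV: "\<And>x. W x = V x" and s: "0 < s" "s \<le> t"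
  shows "(\<integral>x. g (x, t) \<partial>M) \<le> (\<integral>x. g (x, s) \<partial>M)"
proof -
  interpret finite_measure M by (rule finite_M)
  obtain K where K: "K > 0" "\<And>x. x \<in> cball 0 r \<Longrightarrow> norm (V x) \<le> K"
    using continuous_on_compact_bound[OF compact_cball[of 0 r]
        continuous_on_subset[OF C1_on_imp_continuous_on[OF V] subset_UNIV]] by metis
  define vol where "vol = measure M (space M)"
  \<comment> \<open>This constant depends on \<epsilon> and on the size of V on the ball; it is
    harmless because it appears only with a factor that tends to zero.\<close>
  define c where "c = K\<^sup>2 / (2 * \<epsilon>) * vol"
  have main: "(1 - \<kappa>\<^sup>2) * (\<integral>x. g (x, t) \<partial>M) \<le>
      (\<integral>x. g (x, s) \<partial>M) + (t - s) * (\<kappa>\<^sup>2 * c) + (\<kappa>\<^sup>2 + \<kappa>) * vol"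
    if \<kappa>: "0 < \<kappa>" "\<kappa> < 1" for \<kappa>
  proof -
    \<comment> \<open>With level \<kappa>^2 the test function exceeds 1 - \<delta> as soon as z -
      \<delta> \<ge> \<kappa>, and the loss below that is at most \<delta> + \<kappa> per unit
      volume.\<close>
    define \<delta> where "\<delta> = \<kappa>\<^sup>2"
    have \<delta>: "\<delta> > 0" "\<delta> < 1" using \<kappa> by (auto simp: \<delta>_def power_less_one_iff)
    define \<psi> where "\<psi> = (\<lambda>z. (max 0 (z - \<delta>))\<^sup>2 / ((max 0 (z - \<delta>))\<^sup>2 + \<delta>\<^sup>2))"
    define \<psi>' where "\<psi>' = (\<lambda>z. 2 * max 0 (z - \<delta>) * \<delta>\<^sup>2 / ((max 0 (z - \<delta>))\<^sup>2 + \<delta>\<^sup>2)\<^sup>2)"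
    have "cutoff \<psi> \<psi>' \<delta>" unfolding \<psi>_def \<psi>'_def by (rule cutoff_square[OF \<delta>(1)])
    then interpret C: cutoff \<psi> \<psi>' \<delta> .
    interpret C: pme_flow_cutoff m \<epsilon> r b0 U g V W B \<psi> \<psi>' \<delta> ..
    have \<psi>'_nonneg: "\<psi>' z \<ge> 0" for z unfolding \<psi>'_def by simp
    have \<psi>'_bound: "\<psi>' z * z\<^sup>2 \<le> 2 * \<delta>" for z
    proof (cases "z > \<delta>")
      case True
      define y where "y = z - \<delta>"
      have y: "y > 0" "max 0 (z - \<delta>) = y" "z = y + \<delta>" using True by (auto simp: y_def)
      have p: "y\<^sup>2 + \<delta>\<^sup>2 > 0" using y by (intro add_pos_nonneg) auto
      have "z\<^sup>2 + (y - \<delta>)\<^sup>2 = 2 * (y\<^sup>2 + \<delta>\<^sup>2)" unfolding y(3) by (simp add: power2_eq_square algebra_simps)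
      then have z2: "z\<^sup>2 \<le> 2 * (y\<^sup>2 + \<delta>\<^sup>2)" using zero_le_power2[of "y - \<delta>"] by linarith
      have yd: "2 * y * \<delta> \<le> y\<^sup>2 + \<delta>\<^sup>2"
        using zero_le_power2[of "y - \<delta>"] by (simp add: power2_diff)
      have "2 * y * \<delta>\<^sup>2 * z\<^sup>2 \<le> 2 * y * \<delta>\<^sup>2 * (2 * (y\<^sup>2 + \<delta>\<^sup>2))"
        using y \<delta> z2 by (intro mult_left_mono) auto
      also have "\<dots> = (2 * y * \<delta>) * (2 * \<delta> * (y\<^sup>2 + \<delta>\<^sup>2))" by (simp add: power2_eq_square algebra_simps)
      also have "\<dots> \<le> (y\<^sup>2 + \<delta>\<^sup>2) * (2 * \<delta> * (y\<^sup>2 + \<delta>\<^sup>2))"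
        using y \<delta> yd p by (intro mult_right_mono) auto
      also have "\<dots> = 2 * \<delta> * (y\<^sup>2 + \<delta>\<^sup>2)\<^sup>2" by (simp add: power2_eq_square)
      finally show ?thesis
        unfolding \<psi>'_def y(2) times_divide_eq_left using zero_less_power[OF p, of 2] by (subst pos_divide_le_eq) auto
    qed (use \<delta> in \<open>simp add: \<psi>'_def\<close>)
    have pointwise: "- (C.pgrad \<tau> x \<bullet> flux \<tau> x) \<le> \<delta> * (K\<^sup>2 / (2 * \<epsilon>))"
      if \<tau>: "\<tau> > 0" and x: "x \<in> ball 0 r" for \<tau> x
    proof (cases "g (x, \<tau>) > 0")
      case True
      let ?u = "g (x, \<tau>)" and ?p = "grad \<tau> x"
      have zt: "zt \<tau> x = ?u" by (simp add: zt_def B0 zeta_zero[OF True])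
      have zg: "zgrad \<tau> x = ?p"
        using True dphi_gt(2)[of ?u] by (simp add: zgrad_def zt WV)
      have "?p \<bullet> flux \<tau> x = dphi ?u * (norm ?p)\<^sup>2 + ?u * (?p \<bullet> V x)"
        by (simp add: flux_def inner_add_right power2_norm_eq_inner)
      moreover have "\<epsilon> * (norm ?p)\<^sup>2 \<le> dphi ?u * (norm ?p)\<^sup>2"
        using dphi_gt(1) by (intro mult_right_mono) auto
      moreover have "?u * (?p \<bullet> V x) \<ge> - (?u * (norm ?p * K))"
      proof -
        have "\<bar>?p \<bullet> V x\<bar> \<le> norm ?p * norm (V x)" by (rule Cauchy_Schwarz_ineq2)
        also have "\<dots> \<le> norm ?p * K" using K(2)[of x] x by (intro mult_left_mono) auto
        finally have "- (norm ?p * K) \<le> ?p \<bullet> V x" by linarith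
        then have "?u * (- (norm ?p * K)) \<le> ?u * (?p \<bullet> V x)" using True by (intro mult_left_mono) auto
        then show ?thesis by simp
      qed
      \<comment> \<open>Complete the square against the ellipticity \<epsilon>; the remainder
        carries u^2, which \<open>\<psi>'_bound\<close> turns into a multiple of \<delta>.\<close>
      moreover have "\<epsilon> * (norm ?p)\<^sup>2 - ?u * (norm ?p * K) \<ge> - (?u\<^sup>2 * (K\<^sup>2 / (4 * \<epsilon>)))"
      proof -
        have "0 \<le> (2 * \<epsilon> * norm ?p - ?u * K)\<^sup>2 / (4 * \<epsilon>)" using eps by simp
        also have "\<dots> = \<epsilon> * (norm ?p)\<^sup>2 - ?u * (norm ?p * K) + ?u\<^sup>2 * (K\<^sup>2 / (4 * \<epsilon>))"
          using eps by (simp add: power2_diff power2_eq_square field_simps)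
        finally show ?thesis by simp
      qed
      ultimately have "?p \<bullet> flux \<tau> x \<ge> - (?u\<^sup>2 * (K\<^sup>2 / (4 * \<epsilon>)))" by linarith
      then have "\<psi>' ?u * (?p \<bullet> flux \<tau> x) \<ge> \<psi>' ?u * - (?u\<^sup>2 * (K\<^sup>2 / (4 * \<epsilon>)))"
        by (intro mult_left_mono \<psi>'_nonneg)
      moreover have "(\<psi>' ?u * ?u\<^sup>2) * (K\<^sup>2 / (4 * \<epsilon>)) \<le> (2 * \<delta>) * (K\<^sup>2 / (4 * \<epsilon>))"
        using eps by (intro mult_right_mono \<psi>'_bound) auto
      moreover have "C.pgrad \<tau> x \<bullet> flux \<tau> x = \<psi>' ?u * (?p \<bullet> flux \<tau> x)"
        using True by (simp add: C.pgrad_def zt zg)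
      ultimately show ?thesis by (simp add: mult.assoc)
    qed (use \<delta> eps in \<open>simp add: C.pgrad_def\<close>)
    have der: "- (\<integral>x. C.pgrad \<tau> x \<bullet> flux \<tau> x \<partial>M) \<le> \<delta> * c" if \<tau>: "\<tau> > 0" for \<tau>
    proof -
      have "(\<integral>x. - (C.pgrad \<tau> x \<bullet> flux \<tau> x) \<partial>M) \<le> (\<integral>x. \<delta> * (K\<^sup>2 / (2 * \<epsilon>)) \<partial>M)"
        using C.energy_identity(2)[OF \<tau>] pointwise[OF \<tau>]
        by (intro integral_mono) (auto simp: space_M)
      then show ?thesis by (simp add: c_def vol_def algebra_simps)
    qed
    have "C.E t - \<delta> * c * t \<le> C.E s - \<delta> * c * s"
    proof (rule DERIV_nonpos_imp_nonincreasing[OF s(2)])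
      fix \<tau> assume "s \<le> \<tau>"
      then have \<tau>: "\<tau> > 0" using s by simp
      have "((\<lambda>\<tau>. C.E \<tau> - \<delta> * c * \<tau>) has_real_derivative
          - (\<integral>x. C.pgrad \<tau> x \<bullet> flux \<tau> x \<partial>M) - \<delta> * c * 1) (at \<tau>)"
        by (intro DERIV_diff C.E_deriv[OF \<tau>] DERIV_cmult DERIV_ident)
      then show "\<exists>y. ((\<lambda>\<tau>. C.E \<tau> - \<delta> * c * \<tau>) has_real_derivative y) (at \<tau>) \<and> y \<le> 0"
        using der[OF \<tau>] by (intro exI conjI) auto
    qed
    then have Ets: "C.E t \<le> C.E s + (t - s) * (\<delta> * c)" by (simp add: algebra_simps)
    have theta: "C.theta 0 z \<le> 1" "0 \<le> C.theta 0 z" "z \<ge> \<delta> + \<kappa> \<Longrightarrow> C.theta 0 z \<ge> 1 - \<delta>" for z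
    proof -
      have p: "(max 0 (z - \<delta>))\<^sup>2 + \<delta>\<^sup>2 > 0" for z using \<delta> by (intro add_nonneg_pos) auto
      have th: "C.theta 0 z = (if z \<le> 0 then 0 else \<psi> z)" for z
        by (simp add: C.theta_def zeta_zero)
      show "C.theta 0 z \<le> 1" "0 \<le> C.theta 0 z"
        unfolding th using p[of z] by (auto simp: \<psi>_def divide_le_eq_1)
      show "C.theta 0 z \<ge> 1 - \<delta>" if z: "z \<ge> \<delta> + \<kappa>"
      proof -
        define y where "y = max 0 (z - \<delta>)"
        have y: "y \<ge> \<kappa>" using z by (simp add: y_def)
        then have "\<kappa>\<^sup>2 \<le> y\<^sup>2" using \<kappa> by (intro power_mono) auto
        then have "\<delta> \<le> y\<^sup>2 + \<delta>\<^sup>2" unfolding \<delta>_def using zero_le_power2[of "\<kappa>\<^sup>2"] by linarith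
        then have "\<delta> * \<delta> \<le> \<delta> * (y\<^sup>2 + \<delta>\<^sup>2)" using \<delta> by (intro mult_left_mono) auto
        then have "(1 - \<delta>) * (y\<^sup>2 + \<delta>\<^sup>2) \<le> y\<^sup>2"
          by (simp add: algebra_simps power2_eq_square)
        then have "1 - \<delta> \<le> y\<^sup>2 / (y\<^sup>2 + \<delta>\<^sup>2)" using p[of z] by (simp add: pos_le_divide_eq y_def)
        moreover have "z > 0" using z \<kappa> \<delta> by linarith
        ultimately show ?thesis unfolding th by (simp add: \<psi>_def y_def)
      qed
    qed
    have Psi_upper: "C.Psi 0 z \<le> z" if "z \<ge> 0" for z
    proof -
      have "C.Psi 0 z - z \<le> C.Psi 0 0 - 0"
      proof (rule DERIV_nonpos_imp_nonincreasing[OF that])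
        fix x
        have "((\<lambda>z. C.Psi 0 z - z) has_real_derivative C.theta 0 x - 1) (at x)"
          by (intro DERIV_diff C.Psi_deriv DERIV_ident)
        then show "\<exists>y. ((\<lambda>z. C.Psi 0 z - z) has_real_derivative y) (at x) \<and> y \<le> 0"
          using theta(1)[of x] by (intro exI conjI) auto
      qed
      then show ?thesis by (simp add: C.Psi_neg)
    qed
    have Psi_nonneg: "C.Psi 0 z \<ge> 0" if "z \<ge> 0" for z
    proof -
      have "C.Psi 0 0 \<le> C.Psi 0 z"
        by (rule DERIV_nonneg_imp_nondecreasing[OF that]) (use C.Psi_deriv theta(2) in blast)
      then show ?thesis by (simp add: C.Psi_neg)
    qed
    have Psi_lower: "(1 - \<delta>) * z \<le> C.Psi 0 z + (\<delta> + \<kappa>)" if "z \<ge> 0" for z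
    proof (cases "z \<ge> \<delta> + \<kappa>")
      case True
      have "C.Psi 0 (\<delta> + \<kappa>) - (1 - \<delta>) * (\<delta> + \<kappa>) \<le> C.Psi 0 z - (1 - \<delta>) * z"
      proof (rule DERIV_nonneg_imp_nondecreasing[OF True])
        fix x assume x: "\<delta> + \<kappa> \<le> x"
        have "((\<lambda>z. C.Psi 0 z - (1 - \<delta>) * z) has_real_derivative C.theta 0 x - (1 - \<delta>) * 1) (at x)"
          by (intro DERIV_diff C.Psi_deriv DERIV_cmult DERIV_ident)
        then show "\<exists>y. ((\<lambda>z. C.Psi 0 z - (1 - \<delta>) * z) has_real_derivative y) (at x) \<and> 0 \<le> y"
          using theta(3)[OF x] by (intro exI conjI) auto
      qed
      moreover have "C.Psi 0 (\<delta> + \<kappa>) \<ge> 0" using \<delta> \<kappa> by (intro Psi_nonneg) auto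
      moreover have "(1 - \<delta>) * (\<delta> + \<kappa>) \<le> 1 * (\<delta> + \<kappa>)" using \<delta> \<kappa> by (intro mult_right_mono) auto
      ultimately show ?thesis by simp
    next
      case False
      have "(1 - \<delta>) * z \<le> 1 * z" using \<delta> that by (intro mult_right_mono) auto
      then show ?thesis using False Psi_nonneg[OF that] by simp
    qed
    have t: "t > 0" using s by simp
    have nn: "g (x, \<tau>) \<ge> 0" if "x \<in> space M" "\<tau> > 0" for x \<tau>
      using that g_nonneg[of x \<tau>] by (simp add: space_M)
    have int_g: "integrable M (\<lambda>x. g (x, \<tau>))" if "\<tau> > 0" for \<tau>
      by (rule integrable_M[OF g_slice_cont[OF that]])
    have int_P: "integrable M (\<lambda>x. C.Psi 0 (g (x, \<tau>)))" if "\<tau> > 0" for \<tau>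
      using C.integrable_Psi[OF that] by (simp add: B0)
    have E_eq: "C.E \<tau> = (\<integral>x. C.Psi 0 (g (x, \<tau>)) \<partial>M)" for \<tau>
      by (simp add: C.E_def B0)
    have "(\<integral>x. (1 - \<delta>) * g (x, t) \<partial>M) \<le> (\<integral>x. C.Psi 0 (g (x, t)) + (\<delta> + \<kappa>) \<partial>M)"
      using int_g[OF t] int_P[OF t] Psi_lower nn t by (intro integral_mono) auto
    then have "(1 - \<delta>) * (\<integral>x. g (x, t) \<partial>M) \<le> C.E t + (\<delta> + \<kappa>) * vol"
      using int_P[OF t] by (simp add: E_eq vol_def mult.commute)
    moreover have "C.E s \<le> (\<integral>x. g (x, s) \<partial>M)"
      unfolding E_eq using int_g[OF s(1)] int_P[OF s(1)] Psi_upper nn s(1) by (intro integral_mono) auto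
    ultimately show ?thesis using Ets unfolding \<delta>_def by linarith
  qed
  \<comment> \<open>The double successor keeps every term strictly below 1, as \<open>main\<close>
    requires.\<close>
  define \<kappa> where "\<kappa> = (\<lambda>n. 1 / real (Suc (Suc n)))"
  have \<kappa>0: "\<kappa> \<longlonglongrightarrow> 0"
    unfolding \<kappa>_def by (rule LIMSEQ_Suc[OF LIMSEQ_Suc[OF lim_1_over_n]])
  have "(\<lambda>n. (1 - (\<kappa> n)\<^sup>2) * (\<integral>x. g (x, t) \<partial>M)) \<longlonglongrightarrow> (1 - 0\<^sup>2) * (\<integral>x. g (x, t) \<partial>M)"
    by (intro tendsto_intros \<kappa>0)
  moreover have "(\<lambda>n. (\<integral>x. g (x, s) \<partial>M) + (t - s) * ((\<kappa> n)\<^sup>2 * c) + ((\<kappa> n)\<^sup>2 + \<kappa> n) * vol) \<longlonglongrightarrow>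
      (\<integral>x. g (x, s) \<partial>M) + (t - s) * (0\<^sup>2 * c) + (0\<^sup>2 + 0) * vol"
    by (intro tendsto_intros \<kappa>0)
  moreover have "(1 - (\<kappa> n)\<^sup>2) * (\<integral>x. g (x, t) \<partial>M) \<le>
      (\<integral>x. g (x, s) \<partial>M) + (t - s) * ((\<kappa> n)\<^sup>2 * c) + ((\<kappa> n)\<^sup>2 + \<kappa> n) * vol" for n
    by (rule main) (auto simp: \<kappa>_def)
  ultimately have "(1 - 0\<^sup>2) * (\<integral>x. g (x, t) \<partial>M) \<le>
      (\<integral>x. g (x, s) \<partial>M) + (t - s) * (0\<^sup>2 * c) + (0\<^sup>2 + 0) * vol"
    by (intro LIMSEQ_le) auto
  then show ?thesis by simp
qed

end

subsection \<open>Moser iteration\<close>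

text \<open>Two powers of q come from the drift term; the others come from h to the power \<kappa> -
  2 d, with h of order \<open>q powr (- 1 / \<alpha>)\<close>. The absolute value makes this an
  upper bound whatever the sign.\<close>

definition moser_exponent :: "nat \<Rightarrow> real \<Rightarrow> real" where
  "moser_exponent d \<alpha> = 2 + \<bar>(real d + 2 - 2 * \<alpha>) / \<alpha>\<bar>"

text \<open>\<open>L0\<close> is such that the gradient term of the Morrey--Poincare inequality with
  \<open>h = L0 powr (- 1 / (2 * \<alpha>)) * q powr (- 1 / \<alpha>)\<close> is absorbed by the dissipation.\<close>

definition moser_const :: "nat \<Rightarrow> real \<Rightarrow> real \<Rightarrow> real \<Rightarrow> real \<Rightarrow> real \<Rightarrow> real" where
  "moser_const d m b0 \<alpha> \<Lambda> c0 =
    (let K = 2 * exp b0 ^ 5 + exp b0 powr m;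
         \<kappa> = real d - 2 + 2 * \<alpha>;
         C1 = 4 * 2 powr \<kappa> / (unit_ball_vol (real d))\<^sup>2;
         C2 = 16 * 2 powr \<kappa> / (unit_ball_vol (real d) * \<alpha>\<^sup>2);
         L0 = 1 + exp b0 * K * C2 * \<Lambda>
     in K * (C1 * \<Lambda> * L0 powr ((real d + 2 - 2 * \<alpha>) / (2 * \<alpha>)) + c0))"

text \<open>\<open>tail\<close> pays for the points where v is small: in the energy estimate
  \<open>v ^ (q - 2)\<close> is bounded by \<open>v ^ q + 1\<close>, and the 1 leaves the integral
  of the drift weight over g \<ge> 1.\<close>

locale pme_moser = pme_flow m \<epsilon> r b0 U g V W B
  for m \<epsilon> r b0 and U :: "('a::euclidean_space \<times> real) set" and g V W B +
  fixes \<alpha> \<Lambda> c0 :: real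
  assumes \<alpha>: "\<alpha> > 0" and \<Lambda>: "\<Lambda> \<ge> 0"
    and morrey: "\<And>z \<rho>. 0 < \<rho> \<Longrightarrow> \<rho> \<le> 2 \<Longrightarrow>
      (\<integral>\<^sup>+x. ennreal (1 + (norm (W x))\<^sup>2) * indicator (ball z \<rho>) x \<partial>lborel)
      \<le> ennreal (\<Lambda> * \<rho> powr (real DIM('a) - 2 + 2 * \<alpha>))"
    and tail: "\<And>t. t > 0 \<Longrightarrow> integrable M (\<lambda>x. if g (x, t) \<ge> 1 then 1 + (norm (W x))\<^sup>2 else 0)"
      "\<And>t. t > 0 \<Longrightarrow> (\<integral>x. (if g (x, t) \<ge> 1 then 1 + (norm (W x))\<^sup>2 else 0) \<partial>M) \<le> c0"
begin

text \<open>Truncating at the threshold of \<open>zeta_bounds\<close> makes v > 0 imply g \<ge> 1,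
  so that \<zeta> and g are comparable wherever v is positive.\<close>

definition k0 :: real where "k0 = exp b0"

lemma k0: "k0 \<ge> 1" "k0 > 0"
  using B_bound[of 0] by (auto simp: k0_def)

definition v :: "real \<Rightarrow> 'a \<Rightarrow> real" where
  "v t x = (if g (x, t) \<le> 0 then 0 else max 0 (zt t x - k0))"

text \<open>The summand 1 lets one application of the Poincare type inequality control the integral
  of \<open>v ^ q\<close> itself along with the drift term.\<close>

definition G :: "'a \<Rightarrow> real" where "G x = 1 + (norm (W x))\<^sup>2"

lemma v_nonneg: "v t x \<ge> 0" by (simp add: v_def)

lemma v_pos:
  assumes "v t x > 0"
  shows "g (x, t) \<ge> 1" "zt t x = v t x + k0" "zt t x \<le> k0 * g (x, t)" "g (x, t) \<le> k0 * zt t x" "v t x \<le> k0 * g (x, t)"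
proof -
  have g: "g (x, t) > 0" and z: "zt t x > k0" and vz: "v t x = zt t x - k0"
    using assms by (auto simp: v_def split: if_splits)
  have z': "zeta (B x) (g (x, t)) \<ge> exp b0" using z by (simp add: zt_def k0_def)
  note zb = zeta_bounds[OF B_bound g z']
  show "g (x, t) \<ge> 1" "zt t x \<le> k0 * g (x, t)" "g (x, t) \<le> k0 * zt t x" "zt t x = v t x + k0"
    using zb vz by (auto simp: zt_def k0_def)
  then show "v t x \<le> k0 * g (x, t)" using k0 by simp
qed

lemma flow_cutoff_power:
  "n \<ge> 2 \<Longrightarrow> pme_flow_cutoff m \<epsilon> r b0 U g V W B (\<lambda>z. c * max 0 (z - k0) ^ n)
    (\<lambda>z. c * (real n * max 0 (z - k0) ^ (n - 1))) k0"
  by (intro pme_flow_cutoff.intro pme_cutoff.intro pme_flow_axioms pme_gauge_axioms cutoff_power k0)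

lemma theta_power:
  assumes "n \<ge> 2"
  shows "pme_cutoff.theta m \<epsilon> (\<lambda>z. c * max 0 (z - k0) ^ n) (B x) (g (x, t)) = c * v t x ^ n"
proof -
  interpret C: pme_flow_cutoff m \<epsilon> r b0 U g V W B "\<lambda>z. c * max 0 (z - k0) ^ n"
    "\<lambda>z. c * (real n * max 0 (z - k0) ^ (n - 1))" k0 by (rule flow_cutoff_power[OF assms])
  show ?thesis using assms by (simp add: C.theta_def v_def zt_def)
qed

lemma v_power:
  assumes "n \<ge> 2"
  shows "C1_on (slice t) (\<lambda>x. v t x ^ n)"
    and "x \<in> slice t \<Longrightarrow> gradient (\<lambda>x. v t x ^ n) (at x) = (real n * v t x ^ (n - 1)) *\<^sub>R (if g (x, t) \<le> 0 then 0 else zgrad t x)"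
proof -
  interpret C: pme_flow_cutoff m \<epsilon> r b0 U g V W B "\<lambda>z. 1 * max 0 (z - k0) ^ n"
    "\<lambda>z. 1 * (real n * max 0 (z - k0) ^ (n - 1))" k0 by (rule flow_cutoff_power[OF assms])
  have eq: "C.Th t = (\<lambda>x. v t x ^ n)"
    unfolding C.Th_def using theta_power[OF assms, of 1] by simp
  show "C1_on (slice t) (\<lambda>x. v t x ^ n)" using C.Th_C1[of t] unfolding eq .
  show "gradient (\<lambda>x. v t x ^ n) (at x) = (real n * v t x ^ (n - 1)) *\<^sub>R (if g (x, t) \<le> 0 then 0 else zgrad t x)"
    if "x \<in> slice t"
    using gradientI[OF C.Th_grad[OF that]] unfolding eq C.pgrad_def by (simp add: v_def)
qed

lemma v_power_cont: "t > 0 \<Longrightarrow> n \<ge> 2 \<Longrightarrow> continuous_on (cball 0 r) (\<lambda>x. v t x ^ n)"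
  by (rule continuous_on_subset[OF C1_on_imp_continuous_on[OF v_power(1)] slice(1)])

lemma v_cont: "t > 0 \<Longrightarrow> continuous_on (cball 0 r) (v t)"
proof -
  assume "t > 0"
  then have "continuous_on (cball 0 r) (\<lambda>x. sqrt (v t x ^ 2))"
    by (intro continuous_on_real_sqrt v_power_cont) auto
  then show ?thesis using v_nonneg by simp
qed

lemma v_power_integrable: "t > 0 \<Longrightarrow> integrable M (\<lambda>x. v t x ^ n)"
  by (intro integrable_M continuous_on_power v_cont)

definition psi_E :: "nat \<Rightarrow> real \<Rightarrow> real" where
  "psi_E q = (\<lambda>z. real q * max 0 (z - k0) ^ (q - 1))"

text \<open>This is not the integral of \<open>v ^ q\<close>: the test function
  \<open>psi_E q\<close> acts on \<zeta>, and the energy takes its antiderivative in g. The two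
  agree up to the factor \<open>k0 powr m\<close>.\<close>

definition en :: "nat \<Rightarrow> real \<Rightarrow> real" where
  "en q t = (\<integral>x. pme_cutoff.Psi m \<epsilon> (psi_E q) (B x) (g (x, t)) \<partial>M)"

text \<open>As functions of g both quantities start from zero, and the derivative of
  \<open>v ^ q\<close> is that of \<open>Psi\<close> times the derivative of \<open>zeta\<close>,
  which \<open>zeta_deriv_bounds\<close> keeps between \<open>1 / k0 powr m\<close> and
  \<open>k0 powr m\<close>.\<close>

lemma Psi_v_bounds:
  assumes q: "q \<ge> 3" and t: "t > 0" and x: "x \<in> cball 0 r"
  defines "P \<equiv> pme_cutoff.Psi m \<epsilon> (psi_E q) (B x) (g (x, t))"
  shows "v t x ^ q \<le> k0 powr m * P" "P \<le> k0 powr m * v t x ^ q"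
proof -
  have q': "q - 1 \<ge> 2" "q \<ge> 2" using q by auto
  interpret C: pme_flow_cutoff m \<epsilon> r b0 U g V W B "psi_E q"
    "\<lambda>z. real q * (real (q - 1) * max 0 (z - k0) ^ (q - 1 - 1))" k0
    unfolding psi_E_def by (rule flow_cutoff_power[OF q'(1)])
  interpret D: pme_flow_cutoff m \<epsilon> r b0 U g V W B "\<lambda>z. 1 * max 0 (z - k0) ^ q"
    "\<lambda>z. 1 * (real q * max 0 (z - k0) ^ (q - 1))" k0 by (rule flow_cutoff_power[OF q'(2)])
  let ?b = "B x" and ?c = "k0 powr m"
  have c: "?c > 0" using k0 by simp
  have vq: "D.theta ?b (g (x, t)) = v t x ^ q" using theta_power[OF q'(2), of 1] by simp
  have g: "g (x, t) \<ge> 0" using g_nonneg[OF x t] .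
  have P: "P = C.Psi ?b (g (x, t))" by (simp add: P_def)
  have der: "\<exists>D. (D.theta ?b has_real_derivative D * C.theta ?b s) (at s) \<and>
      (C.theta ?b s = 0 \<or> (1 / ?c \<le> D \<and> D \<le> ?c)) \<and> C.theta ?b s \<ge> 0" for s
  proof (cases "s > 0")
    case True
    let ?z = "zeta ?b s"
    let ?D = "(?z / dphi ?z) * (dphi s / s)"
    have "((\<lambda>s. 1 * max 0 (zeta ?b s - k0) ^ q) has_real_derivative
        (1 * (real q * max 0 (?z - k0) ^ (q - 1))) * ?D) (at s)"
      by (rule DERIV_chain2[OF D.psi_deriv zeta_deriv[OF True]])
    then have "(D.theta ?b has_real_derivative (1 * (real q * max 0 (?z - k0) ^ (q - 1))) * ?D) (at s)"
      by (rule has_field_derivative_transform_within_open[where S = "{0<..}"])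
         (unfold D.theta_def, use True in auto)
    moreover have th: "C.theta ?b s = real q * max 0 (?z - k0) ^ (q - 1)"
      unfolding C.theta_def using True by (simp add: psi_E_def)
    ultimately have "(D.theta ?b has_real_derivative ?D * C.theta ?b s) (at s)"
      by (simp add: mult.commute)
    moreover have "C.theta ?b s = 0 \<or> (1 / ?c \<le> ?D \<and> ?D \<le> ?c)"
    proof (cases "?z \<ge> k0")
      case z: True
      then show ?thesis
        using zeta_deriv_bounds[OF B_bound True, of x] by (simp add: k0_def)
    next
      case False
      then show ?thesis using th q by (simp add: power_0_left)
    qed
    moreover have "C.theta ?b s \<ge> 0" unfolding th by simp
    ultimately show ?thesis by blast
  next
    case False
    obtain s1 where s1: "s1 > 0" "\<And>s. s < s1 \<Longrightarrow> D.theta ?b s = 0"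
      using D.theta_small[of "\<bar>?b\<bar>"] by (metis order_refl)
    have "((\<lambda>s. 0) has_real_derivative 0) (at s)" by simp
    then have "(D.theta ?b has_real_derivative 0) (at s)"
      by (rule has_field_derivative_transform_within_open[where S = "{..<s1}"])
        (use False s1 in auto)
    moreover have "C.theta ?b s = 0" using False by (simp add: C.theta_def)
    ultimately show ?thesis by auto
  qed
  have zero: "C.Psi ?b 0 = 0" "D.theta ?b 0 = 0" unfolding D.theta_def by (simp_all add: C.Psi_neg)
  have "?c * C.Psi ?b 0 - D.theta ?b 0 \<le> ?c * C.Psi ?b (g (x, t)) - D.theta ?b (g (x, t))"
  proof (rule DERIV_nonneg_imp_nondecreasing[OF g])
    fix s
    obtain D where D: "(D.theta ?b has_real_derivative D * C.theta ?b s) (at s)"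
      "C.theta ?b s = 0 \<or> (1 / ?c \<le> D \<and> D \<le> ?c)" "C.theta ?b s \<ge> 0" using der[of s] by blast
    have "((\<lambda>s. ?c * C.Psi ?b s - D.theta ?b s) has_real_derivative ?c * C.theta ?b s - D * C.theta ?b s) (at s)"
      by (intro DERIV_diff DERIV_cmult C.Psi_deriv D(1))
    moreover have "D * C.theta ?b s \<le> ?c * C.theta ?b s"
      using D(2,3) by (auto intro: mult_right_mono)
    ultimately show "\<exists>y. ((\<lambda>s. ?c * C.Psi ?b s - D.theta ?b s) has_real_derivative y) (at s) \<and> 0 \<le> y"
      by (intro exI conjI) auto
  qed
  then show "v t x ^ q \<le> ?c * P" unfolding zero vq P by simp
  have "?c * D.theta ?b 0 - C.Psi ?b 0 \<le> ?c * D.theta ?b (g (x, t)) - C.Psi ?b (g (x, t))"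
  proof (rule DERIV_nonneg_imp_nondecreasing[OF g])
    fix s
    obtain D where D: "(D.theta ?b has_real_derivative D * C.theta ?b s) (at s)"
      "C.theta ?b s = 0 \<or> (1 / ?c \<le> D \<and> D \<le> ?c)" "C.theta ?b s \<ge> 0" using der[of s] by blast
    have "((\<lambda>s. ?c * D.theta ?b s - C.Psi ?b s) has_real_derivative ?c * (D * C.theta ?b s) - C.theta ?b s) (at s)"
      by (intro DERIV_diff DERIV_cmult C.Psi_deriv D(1))
    moreover have "1 * C.theta ?b s \<le> (?c * D) * C.theta ?b s"
    proof (cases "C.theta ?b s = 0")
      case False
      then have "1 / ?c \<le> D" using D(2) by simp
      then have "1 \<le> ?c * D" using c by (simp add: pos_divide_le_eq mult.commute)
      then show ?thesis using D(3) by (rule mult_right_mono)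
    qed simp
    ultimately show "\<exists>y. ((\<lambda>s. ?c * D.theta ?b s - C.Psi ?b s) has_real_derivative y) (at s) \<and> 0 \<le> y"
      by (intro exI conjI) auto
  qed
  then show "P \<le> ?c * v t x ^ q" unfolding zero vq P by simp
qed

lemma en_bounds:
  assumes q: "q \<ge> 3" and t: "t > 0"
  shows "(\<integral>x. v t x ^ q \<partial>M) \<le> k0 powr m * en q t" "en q t \<le> k0 powr m * (\<integral>x. v t x ^ q \<partial>M)"
    "en q t \<ge> 0"
proof -
  have q': "q - 1 \<ge> 2" using q by auto
  interpret C: pme_flow_cutoff m \<epsilon> r b0 U g V W B "psi_E q"
    "\<lambda>z. real q * (real (q - 1) * max 0 (z - k0) ^ (q - 1 - 1))" k0
    unfolding psi_E_def by (rule flow_cutoff_power[OF q'])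
  have i: "integrable M (\<lambda>x. C.Psi (B x) (g (x, t)))" by (rule C.integrable_Psi[OF t])
  have e: "en q t = (\<integral>x. C.Psi (B x) (g (x, t)) \<partial>M)" by (simp add: en_def)
  note bd = Psi_v_bounds[OF q t]
  have "(\<integral>x. v t x ^ q \<partial>M) \<le> (\<integral>x. k0 powr m * C.Psi (B x) (g (x, t)) \<partial>M)"
    using i v_power_integrable[OF t] bd(1) by (intro integral_mono) (auto simp: space_M)
  then show "(\<integral>x. v t x ^ q \<partial>M) \<le> k0 powr m * en q t" by (simp add: e)
  have "(\<integral>x. C.Psi (B x) (g (x, t)) \<partial>M) \<le> (\<integral>x. k0 powr m * v t x ^ q \<partial>M)"
    using i v_power_integrable[OF t] bd(2) by (intro integral_mono) (auto simp: space_M)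
  then show "en q t \<le> k0 powr m * (\<integral>x. v t x ^ q \<partial>M)" by (simp add: e)
  have "(\<integral>x. v t x ^ q \<partial>M) \<ge> 0" by (intro Bochner_Integration.integral_nonneg) (simp add: v_nonneg)
  then have "0 \<le> k0 powr m * en q t" using \<open>(\<integral>x. v t x ^ q \<partial>M) \<le> k0 powr m * en q t\<close> by linarith
  moreover have "k0 powr m > 0" using k0 by simp
  ultimately show "en q t \<ge> 0" by (simp add: zero_le_mult_iff)
qed

text \<open>With \<mu> = q (q - 1) v^(q - 2), half of the dissipation absorbs the drift by Young's
  inequality and the other half dominates the squared gradient of v^n, because n^2 = q^2 / 4 \<le> q
  (q - 1) / 2. The factor z^2 left by the drift is brought back to v.\<close>

lemma energy_pointwise:
  assumes n: "n \<ge> 2" and x: "x \<in> slice t"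
  defines "q \<equiv> 2 * n"
  defines "p \<equiv> (if g (x, t) \<le> 0 then 0 else (real q * (real (q - 1) * max 0 (zt t x - k0) ^ (q - 1 - 1))) *\<^sub>R zgrad t x)"
  shows "- (p \<bullet> flux t x) \<le> - (1 / k0) * (norm (gradient (\<lambda>x. v t x ^ n) (at x)))\<^sup>2 +
    2 * k0 ^ 5 * (real q)\<^sup>2 * (G x * (v t x ^ n)\<^sup>2 + (if g (x, t) \<ge> 1 then G x else 0))"
proof (cases "v t x > 0")
  case False
  then have v0: "v t x = 0" using v_nonneg[of t x] by linarith
  have "p = 0"
  proof (cases "g (x, t) \<le> 0")
    case False
    then have "max 0 (zt t x - k0) = 0" using v0 by (simp add: v_def)
    then show ?thesis using n by (simp add: p_def q_def power_0_left)
  qed (simp add: p_def)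
  moreover have "gradient (\<lambda>x. v t x ^ n) (at x) = 0"
    using n by (simp add: v_power(2)[OF n x] v0 power_0_left)
  moreover have "G x \<ge> 0" by (simp add: G_def)
  ultimately show ?thesis using k0 v0 n by (simp add: power_0_left)
next
  case True
  let ?v = "v t x" and ?z = "zt t x" and ?u = "g (x, t)" and ?p = "zgrad t x"
  note vp = v_pos[OF True]
  have u: "?u > 0" "?u \<ge> 1" and z: "?z > k0" using vp True by auto
  have z0: "?z > 0" using z k0 by simp
  have z1: "?z \<ge> 1" using z k0 by simp
  define \<mu> where "\<mu> = real q * (real (q - 1) * ?v ^ (q - 2))"
  have \<mu>0: "\<mu> \<ge> 0" using v_nonneg by (simp add: \<mu>_def)
  have p: "p = \<mu> *\<^sub>R ?p"
  proof -
    have "max 0 (zt t x - k0) = ?v" using vp(2) v_nonneg[of t x] by simp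
    moreover have "q - 1 - 1 = q - 2" by simp
    ultimately show ?thesis unfolding p_def \<mu>_def using u by simp
  qed
  define a where "a = ?u / ?z * dphi ?z"
  have a: "a \<ge> 1 / k0"
  proof -
    have "?u / ?z \<ge> 1 / k0" using vp(3) z0 k0 by (simp add: field_simps)
    moreover have "dphi ?z \<ge> 1" by (rule dphi_ge_1[OF z1])
    ultimately have "1 / k0 * 1 \<le> ?u / ?z * dphi ?z"
      using k0 u z0 by (intro mult_mono) auto
    then show ?thesis by (simp add: a_def)
  qed
  let ?N = "norm ?p" and ?w = "norm (W x)"
  have "?p \<bullet> flux t x = a * ?N\<^sup>2 + ?u * (?p \<bullet> W x)"
    unfolding flux_zgrad[OF u(1)] a_def[symmetric] by (simp add: inner_add_right power2_norm_eq_inner)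
  moreover have "a * ?N\<^sup>2 \<ge> 1 / k0 * ?N\<^sup>2" using a by (intro mult_right_mono) auto
  moreover have "?u * (?p \<bullet> W x) \<ge> - (k0 * ?z * (?N * ?w))"
  proof -
    have "\<bar>?u * (?p \<bullet> W x)\<bar> \<le> (k0 * ?z) * (?N * ?w)"
      unfolding abs_mult using u vp(4) Cauchy_Schwarz_ineq2[of ?p "W x"] by (intro mult_mono) auto
    then show ?thesis by linarith
  qed
  moreover have "1 / k0 * ?N\<^sup>2 - k0 * ?z * (?N * ?w) \<ge> 1 / (2 * k0) * ?N\<^sup>2 - k0 ^ 3 / 2 * ?z\<^sup>2 * ?w\<^sup>2"
  proof -
    \<comment> \<open>Young's inequality with the weight that leaves exactly half of the coefficient
      1 / k0.\<close>
    have "0 \<le> (?N - k0\<^sup>2 * ?z * ?w)\<^sup>2 / (2 * k0)" using k0 by simp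
    also have "\<dots> = 1 / (2 * k0) * ?N\<^sup>2 - k0 * ?z * (?N * ?w) + k0 ^ 3 / 2 * ?z\<^sup>2 * ?w\<^sup>2"
      using k0 by (simp add: power2_diff power2_eq_square power3_eq_cube field_simps)
    finally have "1 / (2 * k0) * ?N\<^sup>2 - k0 * ?z * (?N * ?w) + k0 ^ 3 / 2 * ?z\<^sup>2 * ?w\<^sup>2 \<ge> 0" .
    moreover have "1 / k0 * ?N\<^sup>2 = 1 / (2 * k0) * ?N\<^sup>2 + 1 / (2 * k0) * ?N\<^sup>2"
      using k0 by (simp add: field_simps)
    ultimately show ?thesis by linarith
  qed
  ultimately have "- (?p \<bullet> flux t x) \<le> - (1 / (2 * k0) * ?N\<^sup>2) + k0 ^ 3 / 2 * ?z\<^sup>2 * ?w\<^sup>2" by linarith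
  then have "\<mu> * - (?p \<bullet> flux t x) \<le> \<mu> * (- (1 / (2 * k0) * ?N\<^sup>2) + k0 ^ 3 / 2 * ?z\<^sup>2 * ?w\<^sup>2)"
    by (rule mult_left_mono[OF _ \<mu>0])
  then have main: "- (p \<bullet> flux t x) \<le> - (1 / (2 * k0)) * (\<mu> * ?N\<^sup>2) + k0 ^ 3 / 2 * (\<mu> * ?z\<^sup>2) * ?w\<^sup>2"
    by (simp add: p algebra_simps)
  have qq: "real (q - 1) \<ge> real q / 2" "real (q - 1) \<le> real q" "q - 2 = 2 * (n - 1)"
    using n by (auto simp: q_def)
  have "(norm (gradient (\<lambda>x. v t x ^ n) (at x)))\<^sup>2 = (real n)\<^sup>2 * (?v ^ (n - 1))\<^sup>2 * ?N\<^sup>2"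
    using u v_nonneg[of t x] by (simp add: v_power(2)[OF n x] power_mult_distrib)
  also have "(?v ^ (n - 1))\<^sup>2 = ?v ^ (q - 2)" unfolding qq(3) by (simp add: power_mult[symmetric] mult.commute)
  also have "(real n)\<^sup>2 * ?v ^ (q - 2) * ?N\<^sup>2 \<le> 1 / 2 * (\<mu> * ?N\<^sup>2)"
  proof -
    have "(real n)\<^sup>2 = 1 / 2 * (real q * (real q / 2))" by (simp add: q_def power2_eq_square)
    also have "\<dots> \<le> 1 / 2 * (real q * real (q - 1))" using qq(1) by (intro mult_left_mono) auto
    finally have "(real n)\<^sup>2 * (?v ^ (q - 2) * ?N\<^sup>2) \<le> 1 / 2 * (real q * real (q - 1)) * (?v ^ (q - 2) * ?N\<^sup>2)"
      using v_nonneg by (intro mult_right_mono) auto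
    then show ?thesis by (simp add: \<mu>_def mult.assoc)
  qed
  finally have g1: "1 / k0 * (norm (gradient (\<lambda>x. v t x ^ n) (at x)))\<^sup>2 \<le> 1 / (2 * k0) * (\<mu> * ?N\<^sup>2)"
    using k0 by (simp add: field_simps)
  \<comment> \<open>Since z = v + k0 has a lower order part, a multiple of
    \<open>v ^ (q - 2)\<close> remains; comparing it with \<open>v ^ q + 1\<close> is the origin of
    the tail term.\<close>
  have "?v ^ (q - 2) * ?z\<^sup>2 \<le> 4 * k0\<^sup>2 * (?v ^ q + 1)"
  proof -
    have le: "?v ^ (q - 2) \<le> ?v ^ q + 1"
    proof (cases "?v \<ge> 1")
      case True
      have "?v ^ (q - 2) \<le> ?v ^ q" using True by (intro power_increasing) auto
      then show ?thesis by simp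
    next
      case False
      then have "?v ^ (q - 2) \<le> 1" using v_nonneg[of t x] by (intro power_le_one) auto
      then show ?thesis using v_nonneg[of t x] by (simp add: add_increasing)
    qed
    have "?z\<^sup>2 + (?v - k0)\<^sup>2 = 2 * ?v\<^sup>2 + 2 * k0\<^sup>2"
      unfolding vp(2) by (simp add: power2_eq_square algebra_simps)
    then have "?z\<^sup>2 \<le> 2 * ?v\<^sup>2 + 2 * k0\<^sup>2" using zero_le_power2[of "?v - k0"] by linarith
    then have "?v ^ (q - 2) * ?z\<^sup>2 \<le> ?v ^ (q - 2) * (2 * ?v\<^sup>2 + 2 * k0\<^sup>2)"
      using v_nonneg by (intro mult_left_mono) auto
    also have "\<dots> = 2 * ?v ^ q + 2 * k0\<^sup>2 * ?v ^ (q - 2)"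
    proof -
      have "q = (q - 2) + 2" using n by (simp add: q_def)
      then have "?v ^ q = ?v ^ (q - 2) * ?v\<^sup>2" by (metis power_add)
      then show ?thesis by (simp add: algebra_simps)
    qed
    also have "\<dots> \<le> 2 * k0\<^sup>2 * (?v ^ q + 1) + 2 * k0\<^sup>2 * (?v ^ q + 1)"
    proof (rule add_mono)
      have k2: "k0\<^sup>2 \<ge> 1" using k0 by (simp add: one_le_power)
      have "1 * ?v ^ q \<le> k0\<^sup>2 * (?v ^ q + 1)"
        using k2 v_nonneg[of t x] by (intro mult_mono) auto
      then show "2 * ?v ^ q \<le> 2 * k0\<^sup>2 * (?v ^ q + 1)" by simp
      show "2 * k0\<^sup>2 * ?v ^ (q - 2) \<le> 2 * k0\<^sup>2 * (?v ^ q + 1)"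
        using le by (intro mult_left_mono) auto
    qed
    finally show ?thesis by simp
  qed
  note vz = this
  have "(real q * real (q - 1)) * (?v ^ (q - 2) * ?z\<^sup>2) \<le> (real q * real q) * (4 * k0\<^sup>2 * (?v ^ q + 1))"
  proof (rule mult_mono)
    show "real q * real (q - 1) \<le> real q * real q" using qq(2) by (intro mult_left_mono) auto
  qed (use vz v_nonneg[of t x] in auto)
  then have "\<mu> * ?z\<^sup>2 \<le> 4 * k0\<^sup>2 * (real q)\<^sup>2 * (?v ^ q + 1)"
    by (simp add: \<mu>_def power2_eq_square mult.assoc mult.left_commute)
  then have "k0 ^ 3 / 2 * (\<mu> * ?z\<^sup>2) * ?w\<^sup>2 \<le> k0 ^ 3 / 2 * (4 * k0\<^sup>2 * (real q)\<^sup>2 * (?v ^ q + 1)) * ?w\<^sup>2"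
    using k0 by (intro mult_right_mono mult_left_mono) auto
  also have "\<dots> = 2 * k0 ^ 5 * (real q)\<^sup>2 * ((?v ^ q + 1) * ?w\<^sup>2)"
    by (simp add: power2_eq_square eval_nat_numeral)
  also have "\<dots> \<le> 2 * k0 ^ 5 * (real q)\<^sup>2 * ((?v ^ q + 1) * G x)"
    using k0 v_nonneg[of t x] by (intro mult_left_mono) (auto simp: G_def)
  also have "(?v ^ q + 1) * G x = G x * (?v ^ n)\<^sup>2 + (if ?u \<ge> 1 then G x else 0)"
  proof -
    have "(?v ^ n)\<^sup>2 = ?v ^ q" by (simp add: q_def power_mult[symmetric] mult.commute)
    then show ?thesis using u by (simp add: algebra_simps)
  qed
  finally show ?thesis using main g1 by linarith
qed

text \<open>Apply the Poincare type inequality to w = v^n at a scale h so small, as a power of q,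
  that the gradient term is swallowed by the dissipation. Since \<open>en\<close> is bounded by the
  same weighted integral, it can be added on the left, where it acts as damping and makes the bounds
  uniform in time.\<close>

lemma moser_inequality:
  assumes n: "n \<ge> 2" and t: "t > 0"
  defines "q \<equiv> 2 * n"
  shows "\<exists>D. (en q has_real_derivative D) (at t) \<and>
    D + en q t \<le> moser_const DIM('a) m b0 \<alpha> \<Lambda> c0 * real q powr moser_exponent DIM('a) \<alpha> *
      (1 + (\<integral>x. v t x ^ n \<partial>M)\<^sup>2)"
proof -
  have q: "q \<ge> 4" using n by (simp add: q_def)
  have q': "q - 1 \<ge> 2" "q \<ge> 3" using q by auto
  interpret C: pme_flow_cutoff m \<epsilon> r b0 U g V W B "psi_E q"
    "\<lambda>z. real q * (real (q - 1) * max 0 (z - k0) ^ (q - 1 - 1))" k0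
    unfolding psi_E_def by (rule flow_cutoff_power[OF q'(1)])
  interpret finite_measure M by (rule finite_M)
  have enE: "en q = C.E" by (rule ext) (simp add: en_def C.E_def)
  let ?d = "real DIM('a)"
  define \<kappa> where "\<kappa> = ?d - 2 + 2 * \<alpha>"
  define K where "K = 2 * k0 ^ 5 + k0 powr m"
  define C1 where "C1 = 4 * 2 powr \<kappa> / (unit_ball_vol ?d)\<^sup>2"
  define C2 where "C2 = 16 * 2 powr \<kappa> / (unit_ball_vol ?d * \<alpha>\<^sup>2)"
  define L0 where "L0 = 1 + k0 * K * C2 * \<Lambda>"
  define e where "e = (?d + 2 - 2 * \<alpha>) / (2 * \<alpha>)"
  define Q where "Q = real q"
  have Q: "Q \<ge> 1" "Q > 0" using q by (auto simp: Q_def)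
  have ub: "unit_ball_vol ?d > 0" by (rule unit_ball_vol_pos) simp
  have K0: "K > 0" using k0 by (simp add: K_def add_pos_nonneg)
  have C0: "C1 > 0" "C2 > 0"
    unfolding C1_def C2_def using ub \<alpha> by (intro divide_pos_pos mult_pos_pos zero_less_power; simp)+
  have L0: "L0 \<ge> 1" using k0 K0 C0 \<Lambda> by (simp add: L0_def)
  have const: "moser_const DIM('a) m b0 \<alpha> \<Lambda> c0 = K * (C1 * \<Lambda> * L0 powr e + c0)"
    unfolding moser_const_def Let_def K_def C1_def C2_def L0_def e_def \<kappa>_def k0_def by simp
  define h where "h = L0 powr (- 1 / (2 * \<alpha>)) * Q powr (- 1 / \<alpha>)"
  have h0: "h > 0" using L0 Q by (simp add: h_def)
  have h1: "h \<le> 1"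
  proof -
    have neg: "- 1 / (2 * \<alpha>) \<le> 0" "- 1 / \<alpha> \<le> 0" using \<alpha> by auto
    have "L0 powr (- 1 / (2 * \<alpha>)) \<le> 1" "Q powr (- 1 / \<alpha>) \<le> 1"
      using powr_mono[OF neg(1) L0] powr_mono[OF neg(2) Q(1)] L0 Q by simp_all
    then have "h \<le> 1 * 1" unfolding h_def using L0 Q by (intro mult_mono) auto
    then show ?thesis by simp
  qed
  have h2: "h powr (2 * \<alpha>) = 1 / (L0 * Q\<^sup>2)"
  proof -
    have "h powr (2 * \<alpha>) = L0 powr (- 1) * Q powr (- 2)"
      unfolding h_def using \<alpha> L0 Q by (simp add: powr_mult powr_powr)
    also have "Q powr (- 2) = 1 / Q\<^sup>2"
      using Q powr_minus_divide[of Q 2] by (simp add: powr_numeral)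
    also have "L0 powr (- 1) = 1 / L0" using L0 powr_minus_divide[of L0 1] by simp
    finally show ?thesis by simp
  qed
  have h3: "h powr (\<kappa> - 2 * ?d) = L0 powr e * Q powr (2 * e)"
  proof -
    have "- 1 / (2 * \<alpha>) * (\<kappa> - 2 * ?d) = e" "- 1 / \<alpha> * (\<kappa> - 2 * ?d) = 2 * e"
      using \<alpha> by (auto simp: e_def \<kappa>_def field_simps)
    then show ?thesis unfolding h_def using L0 Q by (subst powr_mult) (simp_all only: powr_powr powr_ge_zero)
  qed
  let ?w = "\<lambda>x. v t x ^ n"
  let ?T = "\<lambda>x. if g (x, t) \<ge> 1 then G x else 0"
  define I1 where "I1 = (\<integral>x. G x * (?w x)\<^sup>2 \<partial>M)"
  define I2 where "I2 = (\<integral>x. ?w x \<partial>M)"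
  define I3 where "I3 = (\<integral>x. (norm (gradient ?w (at x)))\<^sup>2 \<partial>M)"
  have G0: "G x \<ge> 0" "G x \<ge> 1" for x by (auto simp: G_def)
  have Gc: "continuous_on A G" for A
    unfolding G_def using continuous_on_subset[OF W] by (intro continuous_intros) auto
  have w0: "?w x \<ge> 0" for x using v_nonneg by simp
  have sl: "cball 0 r \<subseteq> slice t" using slice(1)[OF t] .
  have poin: "I1 \<le> C1 * \<Lambda> * h powr (\<kappa> - 2 * ?d) * I2\<^sup>2 + C2 * \<Lambda> * h powr (2 * \<alpha>) * I3"
    unfolding I1_def I2_def I3_def C1_def C2_def \<kappa>_def M_def
    by (rule morrey_poincare[OF v_power(1)[OF n] sl r h0 h1 w0 \<alpha> \<Lambda> Gc G0(1)])
       (use morrey in \<open>simp add: G_def\<close>)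
  have i1: "integrable M (\<lambda>x. G x * (?w x)\<^sup>2)"
    by (intro integrable_M continuous_intros Gc v_power_cont[OF t n])
  have i3: "integrable M (\<lambda>x. (norm (gradient ?w (at x)))\<^sup>2)"
    using continuous_on_subset[OF continuous_on_gradient[OF v_power(1)[OF n]] sl]
    by (intro integrable_M continuous_intros)
  have iT: "integrable M ?T" and Tc: "(\<integral>x. ?T x \<partial>M) \<le> c0"
    using tail[OF t] by (simp_all add: G_def cong: if_cong)
  have "(\<integral>x. ?T x \<partial>M) \<ge> 0" using G0(1) by (intro Bochner_Integration.integral_nonneg) auto
  then have c0: "c0 \<ge> 0" using Tc by simp
  have nn: "I1 \<ge> 0" "I3 \<ge> 0"
    unfolding I1_def I3_def using G0(1) by (auto intro!: Bochner_Integration.integral_nonneg)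
  define D where "D = - (\<integral>x. C.pgrad t x \<bullet> flux t x \<partial>M)"
  have der: "(en q has_real_derivative D) (at t)" unfolding enE D_def by (rule C.E_deriv[OF t])
  have "(\<integral>x. - (C.pgrad t x \<bullet> flux t x) \<partial>M) \<le>
    (\<integral>x. - (1 / k0) * (norm (gradient ?w (at x)))\<^sup>2 + 2 * k0 ^ 5 * Q\<^sup>2 * (G x * (?w x)\<^sup>2 + ?T x) \<partial>M)"
  proof (rule integral_mono)
    show "integrable M (\<lambda>x. - (C.pgrad t x \<bullet> flux t x))" using C.energy_identity(2)[OF t] by simp
    show "integrable M (\<lambda>x. - (1 / k0) * (norm (gradient ?w (at x)))\<^sup>2 + 2 * k0 ^ 5 * Q\<^sup>2 * (G x * (?w x)\<^sup>2 + ?T x))"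
      using i1 i3 iT by (intro Bochner_Integration.integrable_add integrable_mult_right)
    show "- (C.pgrad t x \<bullet> flux t x) \<le>
        - (1 / k0) * (norm (gradient ?w (at x)))\<^sup>2 + 2 * k0 ^ 5 * Q\<^sup>2 * (G x * (?w x)\<^sup>2 + ?T x)"
      if "x \<in> space M" for x
    proof -
      have "x \<in> slice t" using that sl by (auto simp: space_M)
      from energy_pointwise[OF n this] show ?thesis
        unfolding C.pgrad_def unfolding q_def Q_def .
    qed
  qed
  also have "\<dots> = - (1 / k0) * I3 + 2 * k0 ^ 5 * Q\<^sup>2 * (I1 + (\<integral>x. ?T x \<partial>M))"
    unfolding I1_def I3_def using i1 i3 iT
    by (subst Bochner_Integration.integral_add) (auto intro!: integrable_mult_right Bochner_Integration.integrable_add)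
  also have "\<dots> \<le> - (1 / k0) * I3 + 2 * k0 ^ 5 * Q\<^sup>2 * (I1 + c0)"
    using k0 Tc by (intro add_left_mono mult_left_mono) auto
  finally have Dle: "D \<le> - (1 / k0) * I3 + 2 * k0 ^ 5 * Q\<^sup>2 * (I1 + c0)"
    by (simp add: D_def)
  have enle: "en q t \<le> k0 powr m * Q\<^sup>2 * (I1 + c0)"
  proof -
    have "(\<integral>x. v t x ^ q \<partial>M) \<le> I1"
      unfolding I1_def
    proof (rule integral_mono[OF v_power_integrable[OF t] i1])
      fix x
      have "v t x ^ q = (?w x)\<^sup>2" by (simp add: q_def power_mult[symmetric] mult.commute)
      then show "v t x ^ q \<le> G x * (?w x)\<^sup>2"
        using mult_right_mono[OF G0(2)[of x], of "(?w x)\<^sup>2"] by simp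
    qed
    then have "en q t \<le> k0 powr m * I1"
      using en_bounds(2)[OF q'(2) t] k0 by (meson mult_left_mono order_trans powr_ge_zero)
    also have "\<dots> \<le> k0 powr m * (Q\<^sup>2 * (I1 + c0))"
    proof -
      have "1 * I1 \<le> Q\<^sup>2 * (I1 + c0)"
        using Q nn c0 by (intro mult_mono) (auto simp: one_le_power)
      then show ?thesis by (intro mult_left_mono) auto
    qed
    finally show ?thesis by (simp add: mult.assoc)
  qed
  have "D + en q t \<le> - (1 / k0) * I3 + K * Q\<^sup>2 * (I1 + c0)"
    using Dle enle by (simp add: K_def distrib_right)
  also have "\<dots> \<le> - (1 / k0) * I3 + K * Q\<^sup>2 * ((C1 * \<Lambda> * h powr (\<kappa> - 2 * ?d) * I2\<^sup>2 + C2 * \<Lambda> * h powr (2 * \<alpha>) * I3) + c0)"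
    using poin K0 by (intro add_left_mono mult_left_mono add_right_mono) auto
  also have "\<dots> = (K * C2 * \<Lambda> / L0 - 1 / k0) * I3 + K * (C1 * \<Lambda> * L0 powr e * (Q\<^sup>2 * Q powr (2 * e)) * I2\<^sup>2 + c0 * Q\<^sup>2)"
  proof -
    define s where "s = 1 / (L0 * Q\<^sup>2)"
    have s: "1 / L0 = Q\<^sup>2 * s" using Q by (simp add: s_def)
    have "K * C2 * \<Lambda> / L0 = K * C2 * \<Lambda> * (Q\<^sup>2 * s)" unfolding s[symmetric] by simp
    then show ?thesis unfolding h2 h3 s_def[symmetric] by (simp add: algebra_simps)
  qed
  also have "\<dots> \<le> 0 + K * (C1 * \<Lambda> * L0 powr e * Q powr moser_exponent DIM('a) \<alpha> * I2\<^sup>2 +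
      c0 * Q powr moser_exponent DIM('a) \<alpha>)"
  proof (rule add_mono)
    have "k0 * K * C2 * \<Lambda> \<le> L0" by (simp add: L0_def)
    then have "K * C2 * \<Lambda> / L0 \<le> 1 / k0" using k0 L0 by (simp add: field_simps)
    then show "(K * C2 * \<Lambda> / L0 - 1 / k0) * I3 \<le> 0" using nn by (intro mult_nonpos_nonneg) auto
    have ex: "moser_exponent DIM('a) \<alpha> = 2 + \<bar>2 * e\<bar>"
    proof -
      have "2 * e = (?d + 2 - 2 * \<alpha>) / \<alpha>" using \<alpha> by (simp add: e_def field_simps)
      then show ?thesis unfolding moser_exponent_def by (simp only:)
    qed
    have Q2: "Q\<^sup>2 = Q powr 2" using Q by (simp add: powr_numeral)
    have "Q\<^sup>2 * Q powr (2 * e) = Q powr (2 + 2 * e)" unfolding Q2 by (simp add: powr_add)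
    also have "\<dots> \<le> Q powr moser_exponent DIM('a) \<alpha>" unfolding ex using Q by (intro powr_mono) auto
    finally have 1: "Q\<^sup>2 * Q powr (2 * e) \<le> Q powr moser_exponent DIM('a) \<alpha>" .
    have 2: "Q\<^sup>2 \<le> Q powr moser_exponent DIM('a) \<alpha>" unfolding ex Q2 using Q by (intro powr_mono) auto
    show "K * (C1 * \<Lambda> * L0 powr e * (Q\<^sup>2 * Q powr (2 * e)) * I2\<^sup>2 + c0 * Q\<^sup>2) \<le>
      K * (C1 * \<Lambda> * L0 powr e * Q powr moser_exponent DIM('a) \<alpha> * I2\<^sup>2 + c0 * Q powr moser_exponent DIM('a) \<alpha>)"
      using K0 C0 \<Lambda> c0 1 2 by (intro mult_left_mono add_mono mult_right_mono) auto
  qed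
  also have "\<dots> \<le> K * (C1 * \<Lambda> * L0 powr e + c0) * Q powr moser_exponent DIM('a) \<alpha> * (1 + I2\<^sup>2)"
  proof -
    define X where "X = C1 * \<Lambda> * L0 powr e"
    define Y where "Y = Q powr moser_exponent DIM('a) \<alpha>"
    have XY: "X \<ge> 0" "Y \<ge> 0" using C0 \<Lambda> by (auto simp: X_def Y_def)
    have "K * (X + c0) * Y * (1 + I2\<^sup>2) = (0 + K * (X * Y * I2\<^sup>2 + c0 * Y)) + K * (X * Y + c0 * Y * I2\<^sup>2)"
      by (simp add: algebra_simps)
    moreover have "K * (X * Y + c0 * Y * I2\<^sup>2) \<ge> 0" using K0 XY c0 by simp
    ultimately show ?thesis unfolding X_def[symmetric] Y_def[symmetric] by linarith
  qed
  finally show ?thesis using der unfolding const Q_def I2_def by blast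
qed

end

text \<open>Weighted with \<open>exp (c * t)\<close>, the excess of f over the bound cannot
  increase. The initial bound is asked only at some arbitrarily small time, which is what
  convergence to the datum in integral norms provides.\<close>

lemma differential_inequality_bound:
  fixes f :: "real \<Rightarrow> real"
  assumes c: "c > 0"
    and der: "\<And>t. t > 0 \<Longrightarrow> \<exists>D. (f has_real_derivative D) (at t) \<and> D + c * f t \<le> K"
    and init: "\<And>\<tau>. \<tau> > 0 \<Longrightarrow> \<exists>s. 0 < s \<and> s < \<tau> \<and> f s \<le> a"
    and t: "t > 0"
  shows "f t \<le> max a (K / c)"
proof -
  define b where "b = max a (K / c)"
  obtain s where s: "0 < s" "s < t" "f s \<le> a" using init[OF t] by blast
  have cb: "K \<le> c * b" using c by (simp add: b_def max_def field_simps)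
  define h where "h = (\<lambda>t. exp (c * t) * (f t - b))"
  have "h t \<le> h s"
  proof (rule DERIV_nonpos_imp_nonincreasing[OF less_imp_le[OF s(2)]])
    fix x assume "s \<le> x"
    then have "x > 0" using s by simp
    then obtain D where D: "(f has_real_derivative D) (at x)" "D + c * f x \<le> K" using der by blast
    have "(h has_real_derivative exp (c * x) * (D + c * f x - c * b)) (at x)"
      unfolding h_def using D(1) by (auto intro!: derivative_eq_intros simp: algebra_simps)
    moreover have "exp (c * x) * (D + c * f x - c * b) \<le> 0"
      using D(2) cb by (intro mult_nonneg_nonpos) auto
    ultimately show "\<exists>y. (h has_real_derivative y) (at x) \<and> y \<le> 0"
      by blast
  qed
  also have "h s \<le> 0" unfolding h_def using s by (intro mult_nonneg_nonpos) (auto simp: b_def)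
  finally have "f t - b \<le> 0" by (simp add: h_def mult_le_0_iff)
  then show ?thesis by (simp add: b_def)
qed

text \<open>Entry k bounds \<open>en q\<close> with q = 2^(k + 2). In the recursion the first
  argument of the maximum is the initial value for q = 2^(k + 3), the second the equilibrium of the
  damped inequality.\<close>

primrec moser_seq :: "real \<Rightarrow> real \<Rightarrow> real \<Rightarrow> real \<Rightarrow> nat \<Rightarrow> real" where
  "moser_seq A D b L 0 = A"
| "moser_seq A D b L (Suc k) = max (L ^ (2 ^ (k + 3))) (D * b ^ k * (1 + (moser_seq A D b L k)\<^sup>2))"

text \<open>The bare bound N^(2^(k + 2)) does not reproduce itself because of the factor
  \<open>b ^ k\<close>. The stronger bound \<open>R k\<close>, divided by \<open>c * b ^ k\<close>,
  does: squaring yields the divisor twice, and since 4 D b \<le> c one copy pays for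
  \<open>2 * D * b ^ k\<close> and for the extra b in the next divisor. N is so large that R k \<ge>
  1, hence 1 + a^2 is at most twice the square of R k.\<close>

lemma moser_seq_bound:
  assumes A: "A \<ge> 0" and D: "D \<ge> 0" and b: "b \<ge> 1" and L: "L \<ge> 1"
  obtains N where "N \<ge> 1" "\<And>k. moser_seq A D b L k \<le> N ^ (2 ^ (k + 2))"
proof -
  define c where "c = 4 * D * b + 1"
  have c: "c \<ge> 1" "4 * D * b \<le> c" using D b by (auto simp: c_def)
  define e where "e = 2 * c * b"
  have cb: "c * b \<ge> 1" using c b mult_mono[of 1 c 1 b] by simp
  have e: "e \<ge> 1" using cb by (simp add: e_def)
  define N where "N = e * L * (1 + A)"
  have N1: "N \<ge> e * L"
    using A e L mult_left_mono[of 1 "1 + A" "e * L"] by (simp add: N_def)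
  have eL: "e * L \<ge> e" using e L mult_left_mono[of 1 L e] by simp
  have N: "N \<ge> e" "N \<ge> 1" using N1 eL e by linarith+
  have pow2: "k + 1 \<le> 2 ^ k" for k :: nat
    by (induction k) auto
  have epow: "c * b ^ k \<le> e ^ (k + 1)" "2 * c * b ^ (k + 1) \<le> e ^ (k + 1)" for k
  proof -
    have "e ^ (k + 1) = (2 * c) ^ (k + 1) * b ^ (k + 1)" by (simp add: e_def power_mult_distrib)
    moreover have "(2 * c) ^ 1 \<le> (2 * c) ^ (k + 1)" using c by (intro power_increasing) auto
    ultimately show *: "2 * c * b ^ (k + 1) \<le> e ^ (k + 1)"
      using b by (simp add: mult_right_mono)
    have "c * b ^ k \<le> 2 * c * b ^ (k + 1)"
      using b c by (intro mult_mono power_increasing) auto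
    then show "c * b ^ k \<le> e ^ (k + 1)" using * by linarith
  qed
  define R where "R = (\<lambda>k. N ^ (2 ^ (k + 2)) / (c * b ^ k))"
  have bk: "c * b ^ k > 0" for k using c b by (intro mult_pos_pos) auto
  have R1: "R k \<ge> 1" for k
  proof -
    have "c * b ^ k \<le> e ^ (k + 1)" by (rule epow)
    also have "\<dots> \<le> N ^ (k + 1)" using N e by (intro power_mono) auto
    also have "\<dots> \<le> N ^ (2 ^ (k + 2))" using N pow2[of k] by (intro power_increasing) (auto intro: order_trans)
    finally show ?thesis using bk[of k] by (simp add: R_def pos_le_divide_eq)
  qed
  have nonneg: "moser_seq A D b L k \<ge> 0" for k
    using A L by (cases k) (auto intro: max.coboundedI1)
  have main: "moser_seq A D b L k \<le> R k" for k
  proof (induction k)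
    case 0
    have "c * b \<le> e" unfolding e_def using cb by linarith
    then have "c \<le> e" using b c mult_left_mono[of 1 b c] by linarith
    have "c * A \<le> e * (1 + A)" using \<open>c \<le> e\<close> A c by (intro mult_mono) auto
    also have "\<dots> \<le> e * (1 + A) * L" using A e L mult_left_mono[of 1 L "e * (1 + A)"] by simp
    also have "\<dots> = N ^ 1" by (simp add: N_def)
    also have "\<dots> \<le> N ^ 4" using N by (intro power_increasing) auto
    finally show ?case using c by (simp add: R_def pos_le_divide_eq mult.commute)
  next
    case (Suc k)
    let ?P = "N ^ (2 ^ (k + 3))"
    have RS: "R (Suc k) = ?P / (c * b ^ (k + 1))" by (simp add: R_def eval_nat_numeral)
    have first: "L ^ (2 ^ (k + 3)) \<le> R (Suc k)"
    proof -
      have "L ^ (2 ^ (k + 3)) * (c * b ^ (k + 1)) \<le> L ^ (2 ^ (k + 3)) * e ^ (k + 1)"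
        using epow(2)[of k] bk[of "k + 1"] L by (intro mult_left_mono) auto
      also have "\<dots> \<le> L ^ (2 ^ (k + 3)) * e ^ (2 ^ (k + 3))"
        using e L pow2[of k] by (intro mult_left_mono power_increasing) (auto intro: order_trans)
      also have "\<dots> = (e * L) ^ (2 ^ (k + 3))" by (simp add: power_mult_distrib mult.commute)
      also have "\<dots> \<le> ?P" using N1 e L by (intro power_mono) auto
      finally show ?thesis using bk[of "k + 1"] unfolding RS by (simp add: pos_le_divide_eq)
    qed
    have "(moser_seq A D b L k)\<^sup>2 \<le> (R k)\<^sup>2" using Suc nonneg by (intro power_mono)
    moreover have "1 \<le> (R k)\<^sup>2" using R1[of k] by (simp add: one_le_power)
    ultimately have "D * b ^ k * (1 + (moser_seq A D b L k)\<^sup>2) \<le> D * b ^ k * (2 * (R k)\<^sup>2)"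
      using D b by (intro mult_left_mono) auto
    also have "(R k)\<^sup>2 = ?P / (c * b ^ k)\<^sup>2"
    proof -
      have "2 ^ (k + 2) * 2 = (2::nat) ^ (k + 3)" by (simp add: eval_nat_numeral)
      then have "(N ^ (2 ^ (k + 2)))\<^sup>2 = ?P" by (simp only: power_mult[symmetric])
      then show ?thesis by (simp only: R_def power_divide)
    qed
    also have "D * b ^ k * (2 * (?P / (c * b ^ k)\<^sup>2)) = (2 * D * b) / c * (?P / (c * b ^ (k + 1)))"
      using b c by (simp add: power2_eq_square field_simps)
    also have "\<dots> \<le> 1 * (?P / (c * b ^ (k + 1)))"
      using c D b N bk[of "k + 1"] by (intro mult_right_mono) (auto simp: divide_le_eq_1)
    finally have "D * b ^ k * (1 + (moser_seq A D b L k)\<^sup>2) \<le> R (Suc k)" by (simp add: RS)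
    then show ?case using first by simp
  qed
  have "moser_seq A D b L k \<le> N ^ (2 ^ (k + 2))" for k
  proof -
    have "c * b ^ k \<ge> 1" using c b mult_mono[of 1 c 1 "b ^ k"] by (simp add: one_le_power)
    then have "R k \<le> N ^ (2 ^ (k + 2)) / 1"
      unfolding R_def using N by (intro divide_left_mono) auto
    then show ?thesis using main[of k] by simp
  qed
  then show ?thesis using that N(2) by blast
qed

lemma moser_const_nonneg:
  assumes "\<Lambda> \<ge> 0" "c0 \<ge> 0"
  shows "moser_const d m b0 \<alpha> \<Lambda> c0 \<ge> 0"
proof -
  have "unit_ball_vol (real d) \<ge> 0" by (rule unit_ball_vol_nonneg) simp
  then show ?thesis using assms unfolding moser_const_def Let_def
    by (intro mult_nonneg_nonneg add_nonneg_nonneg divide_nonneg_nonneg) auto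
qed

text \<open>Constants of the separate first step at q = 4: \<eta> is the level at which v^3 is split
  between v and v^4, large enough that the v^4 part costs at most half of the damping.\<close>

definition moser_start :: "nat \<Rightarrow> real \<Rightarrow> real \<Rightarrow> real \<Rightarrow> real \<Rightarrow> real \<Rightarrow> real \<Rightarrow> real \<Rightarrow> real" where
  "moser_start d m b0 \<alpha> \<Lambda> c0 M1 L =
    (let D0 = moser_const d m b0 \<alpha> \<Lambda> c0 * 4 powr moser_exponent d \<alpha>;
         Mk = exp b0 * M1 + 1;
         \<eta> = 2 * D0 * Mk * exp b0 powr m + 1
     in max (L ^ 4) (2 * D0 * (1 + \<eta>\<^sup>2 * Mk\<^sup>2)))"

text \<open>For q = 8 * 2^k the factor q^\<gamma> is 8^\<gamma> (2^\<gamma>)^k, with \<gamma> the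
  Moser exponent; the square of \<open>exp b0 powr m\<close> comes from replacing the integral of
  \<open>v ^ n\<close> by \<open>en n\<close>.\<close>

definition moser_rate :: "nat \<Rightarrow> real \<Rightarrow> real \<Rightarrow> real \<Rightarrow> real \<Rightarrow> real \<Rightarrow> real" where
  "moser_rate d m b0 \<alpha> \<Lambda> c0 = moser_const d m b0 \<alpha> \<Lambda> c0 * 8 powr moser_exponent d \<alpha> * (exp b0 powr m)\<^sup>2"

section \<open>The supremum bound\<close>

context pme_moser
begin

text \<open>The comparison factor \<open>k0 powr m\<close> is at least one and hence below its own
  q-th power, so the bound remains a q-th power whose base is independent of q.\<close>

lemma en_initial:
  assumes L: "L \<ge> 1" and q: "q \<ge> 3" and s: "s > 0" and init: "(\<integral>x. g (x, s) ^ q \<partial>M) \<le> L ^ q"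
  shows "en q s \<le> (k0 powr m * k0 * L) ^ q"
proof -
  have km: "k0 powr m \<ge> 1" using k0 m by (simp add: ge_one_powr_ge_zero)
  have "(\<integral>x. v s x ^ q \<partial>M) \<le> (\<integral>x. k0 ^ q * g (x, s) ^ q \<partial>M)"
  proof (rule integral_mono[OF v_power_integrable[OF s]])
    show "integrable M (\<lambda>x. k0 ^ q * g (x, s) ^ q)"
      by (intro integrable_M continuous_intros g_slice_cont[OF s])
    fix x assume "x \<in> space M"
    then have g: "g (x, s) \<ge> 0" using g_nonneg[of x s] s by (simp add: space_M)
    have "v s x \<le> k0 * g (x, s)"
      using v_pos(5)[of s x] v_nonneg[of s x] k0 g by (cases "v s x > 0") auto
    then have "v s x ^ q \<le> (k0 * g (x, s)) ^ q" using v_nonneg by (intro power_mono)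
    then show "v s x ^ q \<le> k0 ^ q * g (x, s) ^ q" by (simp add: power_mult_distrib)
  qed
  also have "\<dots> = k0 ^ q * (\<integral>x. g (x, s) ^ q \<partial>M)" by simp
  also have "\<dots> \<le> k0 ^ q * L ^ q" using init k0 by (intro mult_left_mono) auto
  finally have le: "(\<integral>x. v s x ^ q \<partial>M) \<le> (k0 * L) ^ q" by (simp add: power_mult_distrib)
  have "en q s \<le> k0 powr m * (\<integral>x. v s x ^ q \<partial>M)" by (rule en_bounds(2)[OF q s])
  also have "\<dots> \<le> (k0 powr m) ^ q * (k0 * L) ^ q"
  proof (rule mult_mono[OF _ le])
    show "k0 powr m \<le> (k0 powr m) ^ q" using km q power_increasing[of 1 q "k0 powr m"] by simp
    show "(\<integral>x. v s x ^ q \<partial>M) \<ge> 0" by (intro Bochner_Integration.integral_nonneg) (simp add: v_nonneg)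
  qed simp
  finally show ?thesis by (simp add: power_mult_distrib mult.assoc)
qed

lemma c0_nonneg: "c0 \<ge> 0"
proof -
  have "(\<integral>x. (if g (x, 1) \<ge> 1 then 1 + (norm (W x))\<^sup>2 else 0) \<partial>M) \<ge> 0"
    by (intro Bochner_Integration.integral_nonneg) auto
  then show ?thesis using tail(2)[of 1] by linarith
qed

lemma sup_bound:
  assumes M1: "\<And>t. t > 0 \<Longrightarrow> (\<integral>x. g (x, t) \<partial>M) \<le> M1"
    and L: "L \<ge> 1"
    and init: "\<And>q \<tau>. q \<ge> 3 \<Longrightarrow> \<tau> > 0 \<Longrightarrow> \<exists>s. 0 < s \<and> s < \<tau> \<and> (\<integral>x. g (x, s) ^ q \<partial>M) \<le> L ^ q"
    and N: "N \<ge> 1" "\<And>k. moser_seq (moser_start DIM('a) m b0 \<alpha> \<Lambda> c0 M1 (k0 powr m * k0 * L))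
      (moser_rate DIM('a) m b0 \<alpha> \<Lambda> c0) (2 powr moser_exponent DIM('a) \<alpha>) (k0 powr m * k0 * L) k \<le> N ^ (2 ^ (k + 2))"
    and t: "t > 0" and x: "x \<in> ball 0 r"
  shows "g (x, t) \<le> exp b0 * (N + exp b0)"
proof -
  define L' where "L' = k0 powr m * k0 * L"
  define \<gamma> where "\<gamma> = moser_exponent DIM('a) \<alpha>"
  define C where "C = moser_const DIM('a) m b0 \<alpha> \<Lambda> c0"
  define A where "A = moser_start DIM('a) m b0 \<alpha> \<Lambda> c0 M1 L'"
  define a where "a = moser_seq A (moser_rate DIM('a) m b0 \<alpha> \<Lambda> c0) (2 powr \<gamma>) L'"
  have Na: "a k \<le> N ^ (2 ^ (k + 2))" for k using N(2)[of k] by (simp add: a_def A_def L'_def \<gamma>_def)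
  have C0: "C \<ge> 0" unfolding C_def by (rule moser_const_nonneg[OF \<Lambda> c0_nonneg])
  have km: "k0 powr m \<ge> 1" using k0 m by (simp add: ge_one_powr_ge_zero)
  have ineq: "\<exists>D. (en (2 * n) has_real_derivative D) (at t) \<and>
      D + en (2 * n) t \<le> C * real (2 * n) powr \<gamma> * (1 + (\<integral>x. v t x ^ n \<partial>M)\<^sup>2)"
    if "n \<ge> 2" "t > 0" for n t
    using moser_inequality[OF that] by (simp add: C_def \<gamma>_def)
  have einit: "\<exists>s. 0 < s \<and> s < \<tau> \<and> en q s \<le> L' ^ q" if "q \<ge> 3" "\<tau> > 0" for q \<tau>
    using init[OF that] en_initial[OF L that(1)] unfolding L'_def by blast
  \<comment> \<open>For q = 4 the inequality involves the integral of v^2, while only that of v is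
    known. Interpolation through v^3 and v^4 bounds its square by a constant plus a small multiple
    of \<open>en 4\<close>, which half of the damping absorbs.\<close>
  have start: "en 4 t \<le> A" if t: "t > 0" for t
  proof -
    define D0 where "D0 = C * 4 powr \<gamma>"
    define Mk where "Mk = k0 * M1 + 1"
    define \<eta> where "\<eta> = 2 * D0 * Mk * k0 powr m + 1"
    have A_eq: "A = max (L' ^ 4) (2 * D0 * (1 + \<eta>\<^sup>2 * Mk\<^sup>2))"
      by (simp add: A_def moser_start_def Let_def D0_def Mk_def \<eta>_def C_def \<gamma>_def k0_def)
    have D0: "D0 \<ge> 0" using C0 by (simp add: D0_def)
    have "(\<integral>x. g (x, 1) \<partial>M) \<ge> 0"
      using g_nonneg by (intro Bochner_Integration.integral_nonneg_AE AE_I2) (auto simp: space_M)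
    then have "M1 \<ge> 0" using M1[of 1] by simp
    then have Mk: "Mk \<ge> 1" using k0 by (simp add: Mk_def)
    have \<eta>: "\<eta> \<ge> 1" using D0 Mk by (simp add: \<eta>_def)
    have "\<exists>D. (en 4 has_real_derivative D) (at s) \<and> D + 1/2 * en 4 s \<le> D0 * (1 + \<eta>\<^sup>2 * Mk\<^sup>2)"
      if s: "s > 0" for s
    proof -
      define y where "y = (\<lambda>n. \<integral>x. v s x ^ n \<partial>M)"
      have int: "integrable M (\<lambda>x. v s x ^ n)" for n by (rule v_power_integrable[OF s])
      have y0: "y n \<ge> 0" for n
        unfolding y_def by (intro Bochner_Integration.integral_nonneg) (simp add: v_nonneg)
      have y1: "y 1 \<le> Mk"
      proof -
        have "y 1 \<le> (\<integral>x. k0 * g (x, s) \<partial>M)"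
          unfolding y_def
        proof (rule integral_mono[OF int])
          show "integrable M (\<lambda>x. k0 * g (x, s))"
            by (intro integrable_M continuous_intros g_slice_cont[OF s])
          show "v s x ^ 1 \<le> k0 * g (x, s)" if "x \<in> space M" for x
            using v_pos(5)[of s x] v_nonneg[of s x] k0 g_nonneg[of x s] s that
            by (cases "v s x > 0") (auto simp: space_M)
        qed
        also have "\<dots> \<le> k0 * M1" using M1[OF s] k0 by simp
        finally show ?thesis by (simp add: Mk_def)
      qed
      have y4: "y 4 \<le> k0 powr m * en 4 s" unfolding y_def by (rule en_bounds(1)[OF _ s]) simp
      \<comment> \<open>Split at v = \<eta>: below it v^3 \<le> \<eta>^2 v, above it v^3 \<le> v^4 /
        \<eta>.\<close>
      define Y3 where "Y3 = \<eta>\<^sup>2 * Mk + y 4 / \<eta>"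
      have Y3: "Y3 > 0" unfolding Y3_def using \<eta> Mk y0[of 4] by (intro add_pos_nonneg) auto
      have y3: "y 3 \<le> Y3"
      proof -
        have "y 3 \<le> (\<integral>x. \<eta>\<^sup>2 * v s x ^ 1 + v s x ^ 4 / \<eta> \<partial>M)"
          unfolding y_def
        proof (rule integral_mono[OF int])
          show "integrable M (\<lambda>x. \<eta>\<^sup>2 * v s x ^ 1 + v s x ^ 4 / \<eta>)"
            by (intro Bochner_Integration.integrable_add integrable_mult_right integrable_divide int)
          show "v s x ^ 3 \<le> \<eta>\<^sup>2 * v s x ^ 1 + v s x ^ 4 / \<eta>" for x
          proof (cases "v s x \<le> \<eta>")
            case True
            then have "(v s x)\<^sup>2 * v s x \<le> \<eta>\<^sup>2 * v s x"
              using v_nonneg[of s x] by (intro mult_right_mono power_mono)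
            moreover have "v s x ^ 4 / \<eta> \<ge> 0" using \<eta> v_nonneg[of s x] by simp
            ultimately show ?thesis by (simp add: power2_eq_square power3_eq_cube)
          next
            case False
            then have "v s x ^ 3 * \<eta> \<le> v s x ^ 3 * v s x"
              using v_nonneg[of s x] by (intro mult_left_mono) auto
            then have "v s x ^ 3 \<le> v s x ^ 4 / \<eta>"
              using \<eta> by (simp add: pos_le_divide_eq eval_nat_numeral mult.assoc)
            moreover have "\<eta>\<^sup>2 * v s x \<ge> 0" using v_nonneg[of s x] by simp
            ultimately show ?thesis by simp
          qed
        qed
        also have "\<dots> = \<eta>\<^sup>2 * y 1 + y 4 / \<eta>"
          unfolding y_def using int[of 1] int[of 4] by simp
        also have "\<dots> \<le> Y3" unfolding Y3_def using y1 \<eta> by (intro add_right_mono mult_left_mono) auto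
        finally show ?thesis .
      qed
      have y2: "(y 2)\<^sup>2 \<le> Mk * Y3"
      proof -
        \<comment> \<open>The minimizing parameter for v^2 \<le> c v / 2 + v^3 / (2 c) with the
          bounds at hand; the outcome is the Cauchy--Schwarz inequality between the powers 1 and
          3.\<close>
        define c where "c = sqrt (Y3 / Mk)"
        have c: "c > 0" "c\<^sup>2 = Y3 / Mk" using Y3 Mk by (auto simp: c_def)
        have "y 2 \<le> (\<integral>x. c / 2 * v s x ^ 1 + v s x ^ 3 / (2 * c) \<partial>M)"
          unfolding y_def
        proof (rule integral_mono[OF int])
          show "integrable M (\<lambda>x. c / 2 * v s x ^ 1 + v s x ^ 3 / (2 * c))"
            by (intro Bochner_Integration.integrable_add integrable_mult_right integrable_divide int)
          show "v s x ^ 2 \<le> c / 2 * v s x ^ 1 + v s x ^ 3 / (2 * c)" for x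
          proof -
            have "0 \<le> v s x * (v s x - c)\<^sup>2 / (2 * c)" using c v_nonneg[of s x] by simp
            also have "\<dots> = c / 2 * v s x ^ 1 + v s x ^ 3 / (2 * c) - v s x ^ 2"
              using c(1) by (simp add: power2_diff power2_eq_square power3_eq_cube field_simps)
            finally show ?thesis by simp
          qed
        qed
        also have "\<dots> = c / 2 * y 1 + y 3 / (2 * c)"
          unfolding y_def using int[of 1] int[of 3] by simp
        also have "\<dots> \<le> c / 2 * Mk + Y3 / (2 * c)"
          using c y1 y3 by (intro add_mono mult_left_mono divide_right_mono) auto
        also have "\<dots> = c * Mk"
        proof -
          have "Y3 = c\<^sup>2 * Mk" using c Mk by simp
          then show ?thesis using c by (simp add: power2_eq_square field_simps)
        qed
        finally have "(y 2)\<^sup>2 \<le> (c * Mk)\<^sup>2" using y0[of 2] by (intro power_mono)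
        also have "\<dots> = Mk * (c\<^sup>2 * Mk)" by (simp add: power2_eq_square)
        also have "c\<^sup>2 * Mk = Y3" using c(2) Mk by simp
        finally show ?thesis .
      qed
      obtain D where D: "(en 4 has_real_derivative D) (at s)"
        "D + en 4 s \<le> C * 4 powr \<gamma> * (1 + (\<integral>x. v s x ^ 2 \<partial>M)\<^sup>2)"
        using ineq[of 2 s] s by auto
      have "D + en 4 s \<le> D0 * (1 + (y 2)\<^sup>2)" using D(2) by (simp add: D0_def y_def)
      also have "\<dots> \<le> D0 * (1 + Mk * Y3)" using y2 D0 by (intro mult_left_mono) auto
      also have "\<dots> = D0 * (1 + \<eta>\<^sup>2 * Mk\<^sup>2) + (D0 * Mk / \<eta>) * y 4"
        by (simp add: Y3_def power2_eq_square algebra_simps)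
      also have "\<dots> \<le> D0 * (1 + \<eta>\<^sup>2 * Mk\<^sup>2) + (D0 * Mk / \<eta>) * (k0 powr m * en 4 s)"
        using y4 D0 Mk \<eta> by (intro add_left_mono mult_left_mono) auto
      also have "(D0 * Mk / \<eta>) * (k0 powr m * en 4 s) = (D0 * Mk * k0 powr m / \<eta>) * en 4 s" by simp
      also have "\<dots> \<le> 1/2 * en 4 s"
      proof (rule mult_right_mono)
        show "D0 * Mk * k0 powr m / \<eta> \<le> 1/2" using \<eta> by (simp add: pos_divide_le_eq \<eta>_def)
        show "en 4 s \<ge> 0" by (rule en_bounds(3)[OF _ s]) simp
      qed
      finally have "D + en 4 s \<le> D0 * (1 + \<eta>\<^sup>2 * Mk\<^sup>2) + 1/2 * en 4 s" by simp
      then have "D + 1/2 * en 4 s \<le> D0 * (1 + \<eta>\<^sup>2 * Mk\<^sup>2)" by linarith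
      then show ?thesis using D(1) by blast
    qed
    then have "en 4 t \<le> max (L' ^ 4) (D0 * (1 + \<eta>\<^sup>2 * Mk\<^sup>2) / (1/2))"
      by (intro differential_inequality_bound[where c = "1/2"] einit t) auto
    then show ?thesis by (simp add: A_eq mult.commute)
  qed
  \<comment> \<open>Damping gives the maximum of the initial value and the right-hand side, which is
    precisely the recursion of \<open>moser_seq\<close>.\<close>
  have step: "en (2 ^ (k + 2)) t \<le> a k" if "t > 0" for k t
    using that
  proof (induction k arbitrary: t)
    case 0
    then show ?case using start[of t] by (simp add: a_def)
  next
    case (Suc k)
    let ?n = "2 ^ (k + 2) :: nat"
    have "?n = 4 * 2 ^ k" "(1::nat) \<le> 2 ^ k" by simp_all
    then have n: "?n \<ge> 2" "?n \<ge> 3" by linarith+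
    have q: "2 ^ (Suc k + 2) = 2 * ?n" by simp
    let ?K = "moser_rate DIM('a) m b0 \<alpha> \<Lambda> c0 * (2 powr \<gamma>) ^ k * (1 + (a k)\<^sup>2)"
    have "\<exists>D. (en (2 * ?n) has_real_derivative D) (at s) \<and> D + 1 * en (2 * ?n) s \<le> ?K" if s: "s > 0" for s
    proof -
      obtain D where D: "(en (2 * ?n) has_real_derivative D) (at s)"
        "D + en (2 * ?n) s \<le> C * real (2 * ?n) powr \<gamma> * (1 + (\<integral>x. v s x ^ ?n \<partial>M)\<^sup>2)"
        using ineq[OF n(1) s] by blast
      have i0: "(\<integral>x. v s x ^ ?n \<partial>M) \<ge> 0" by (intro Bochner_Integration.integral_nonneg) (simp add: v_nonneg)
      have "(\<integral>x. v s x ^ ?n \<partial>M) \<le> k0 powr m * en ?n s" by (rule en_bounds(1)[OF n(2) s])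
      also have "\<dots> \<le> k0 powr m * a k" using Suc.IH[OF s] by (intro mult_left_mono) auto
      finally have "(\<integral>x. v s x ^ ?n \<partial>M)\<^sup>2 \<le> (k0 powr m * a k)\<^sup>2" using i0 by (intro power_mono)
      then have "1 + (\<integral>x. v s x ^ ?n \<partial>M)\<^sup>2 \<le> (k0 powr m)\<^sup>2 * (1 + (a k)\<^sup>2)"
        using one_le_power[OF km, of 2] by (simp add: power_mult_distrib distrib_left)
      then have "C * real (2 * ?n) powr \<gamma> * (1 + (\<integral>x. v s x ^ ?n \<partial>M)\<^sup>2) \<le>
          C * real (2 * ?n) powr \<gamma> * ((k0 powr m)\<^sup>2 * (1 + (a k)\<^sup>2))"
        using C0 by (intro mult_left_mono) auto
      also have "C * real (2 * ?n) powr \<gamma> * ((k0 powr m)\<^sup>2 * (1 + (a k)\<^sup>2)) = ?K"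
      proof -
        have "real (2 * ?n) = 8 * 2 ^ k" by (simp add: eval_nat_numeral)
        moreover have "(2 ^ k) powr \<gamma> = (2 powr \<gamma>) ^ k"
          by (simp add: powr_realpow[symmetric] powr_powr powr_power mult.commute)
        ultimately have pw: "real (2 * ?n) powr \<gamma> = 8 powr \<gamma> * (2 powr \<gamma>) ^ k"
          by (simp add: powr_mult)
        show ?thesis unfolding pw by (simp add: moser_rate_def C_def \<gamma>_def k0_def)
      qed
      finally have "D + 1 * en (2 * ?n) s \<le> ?K" using D(2) by linarith
      then show ?thesis using D(1) by blast
    qed
    then have "en (2 * ?n) t \<le> max (L' ^ (2 * ?n)) (?K / 1)"
      using n by (intro differential_inequality_bound[where c = 1] einit Suc.prems) auto
    also have "\<dots> = a (Suc k)"
      by (simp add: a_def eval_nat_numeral)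
    finally show ?case unfolding q .
  qed
  \<comment> \<open>By continuity v would exceed some N' > N on a small ball of measure \<mu> > 0;
    then \<mu> N'^q \<le> k0^m N^q for all q = 2^(k + 2), which fails for large k.\<close>
  have v_le: "v t x \<le> N"
  proof (rule ccontr)
    assume "\<not> v t x \<le> N"
    then have big: "v t x > N" by simp
    define N' where "N' = (v t x + N) / 2"
    have N': "N < N'" "N' < v t x" using big by (auto simp: N'_def)
    have "continuous_on (ball 0 r) (v t)"
      using continuous_on_subset[OF v_cont[OF t]] by auto
    then have "isCont (v t) x" using x continuous_on_eq_continuous_at[OF open_ball] by blast
    then have "\<forall>\<^sub>F y in nhds x. v t y > N'"
      using N'(2) by (simp add: isCont_def tendsto_at_iff_tendsto_nhds order_tendstoD(1))
    then obtain S where S: "open S" "x \<in> S" "\<And>y. y \<in> S \<Longrightarrow> v t y > N'"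
      by (auto simp: eventually_nhds)
    have "open (S \<inter> ball 0 r)" "x \<in> S \<inter> ball 0 r" using S x by auto
    then obtain \<rho> where \<rho>: "\<rho> > 0" "ball x \<rho> \<subseteq> S \<inter> ball 0 r"
      using open_contains_ball by meson
    interpret finite_measure M by (rule finite_M)
    have bM: "ball x \<rho> \<in> sets M"
      using \<rho>(2) by (auto simp: M_def sets_restrict_space_iff)
    define \<mu> where "\<mu> = measure M (ball x \<rho>)"
    have \<mu>: "\<mu> > 0"
    proof -
      have "\<mu> = measure lebesgue (ball x \<rho>)"
        unfolding \<mu>_def M_def using \<rho>(2) by (intro measure_restrict_space) auto
      then show ?thesis using \<rho>(1) content_ball_pos[of \<rho> x] by simp
    qed
    have le: "\<mu> * N' ^ q \<le> k0 powr m * N ^ q" if q: "q = 2 ^ (k + 2)" for q k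
    proof -
      have "q = 4 * 2 ^ k" "(1::nat) \<le> 2 ^ k" using q by simp_all
      then have q3: "q \<ge> 3" by linarith
      have "\<mu> * N' ^ q = (\<integral>y. N' ^ q * indicator (ball x \<rho>) y \<partial>M)"
        using bM by (simp add: \<mu>_def mult.commute)
      also have "\<dots> \<le> (\<integral>y. v t y ^ q \<partial>M)"
      proof (rule integral_mono)
        show "integrable M (\<lambda>y. N' ^ q * indicator (ball x \<rho>) y)"
          using bM by (intro integrable_mult_right integrable_real_indicator) (auto simp: emeasure_eq_measure)
        show "integrable M (\<lambda>y. v t y ^ q)" by (rule v_power_integrable[OF t])
        show "N' ^ q * indicator (ball x \<rho>) y \<le> v t y ^ q" for y
        proof (cases "y \<in> ball x \<rho>")
          case True
          then have "N' \<le> v t y" using S(3)[of y] \<rho>(2) by fastforce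
          then have "N' ^ q \<le> v t y ^ q" using N' N(1) by (intro power_mono) auto
          then show ?thesis using True by simp
        qed (simp add: v_nonneg)
      qed
      also have "\<dots> \<le> k0 powr m * en q t" by (rule en_bounds(1)[OF q3 t])
      also have "\<dots> \<le> k0 powr m * N ^ q"
        using step[OF t, of k] Na[of k] unfolding q by (intro mult_left_mono) auto
      finally show ?thesis .
    qed
    have "N' / N > 1" using N' N(1) by simp
    then obtain j where j: "(N' / N) ^ j > k0 powr m / \<mu>"
      using real_arch_pow by blast
    define q where "q = (2::nat) ^ (j + 2)"
    have "j \<le> q"
    proof -
      have "j < 2 ^ j" by (rule less_exp)
      also have "(2::nat) ^ j \<le> 2 ^ (j + 2)" by (intro power_increasing) auto
      finally show ?thesis by (simp add: q_def)
    qed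
    then have "(N' / N) ^ j \<le> (N' / N) ^ q" using \<open>N' / N > 1\<close> by (intro power_increasing) auto
    then have "k0 powr m / \<mu> < N' ^ q / N ^ q" using j by (simp add: power_divide)
    then have "k0 powr m * N ^ q < \<mu> * N' ^ q"
      using \<mu> N(1) by (simp add: field_simps)
    then show False using le[of q j] q_def by simp
  qed
  show ?thesis
  proof (cases "v t x > 0")
    case True
    have "g (x, t) \<le> k0 * (v t x + k0)" using v_pos(4)[OF True] v_pos(2)[OF True] by simp
    also have "\<dots> \<le> k0 * (N + k0)" using v_le k0 by (intro mult_left_mono) auto
    finally show ?thesis by (simp add: k0_def)
  next
    case False
    show ?thesis
    proof (cases "g (x, t) > 0")
      case g: True
      then have "zt t x \<le> k0" using False by (simp add: v_def split: if_splits)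
      \<comment> \<open>Going from k0 to k0^2 raises \<open>Phi\<close> by at least b0, which
        outweighs B; so a larger g would push \<zeta> above k0.\<close>
      have "g (x, t) \<le> k0 * k0"
      proof (rule ccontr)
        assume "\<not> g (x, t) \<le> k0 * k0"
        then have gk: "g (x, t) > k0 * k0" by simp
        have "Phi (k0 * k0) - Phi k0 \<ge> ln (k0 * k0) - ln k0"
          using k0 mult_left_mono[of 1 k0 k0] by (intro Phi_minus_ln_mono) auto
        moreover have "ln (k0 * k0) - ln k0 = b0" using k0 by (simp add: ln_mult k0_def)
        moreover have "Phi (k0 * k0) < Phi (g (x, t))" using gk k0 by (intro Phi_strict_mono) auto
        ultimately have "Phi k0 < Phi (g (x, t)) + B x" using B_bound[of x] by linarith
        then have "k0 < zt t x"
          using Phi_inv_less_iff[of "Phi k0" "Phi (g (x, t)) + B x"] k0 by (simp add: zt_def zeta_def Phi_inv_Phi)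
        then show False using \<open>zt t x \<le> k0\<close> by simp
      qed
      also have "k0 * k0 \<le> k0 * (N + k0)" using N(1) k0 by (intro mult_left_mono) auto
      finally show ?thesis by (simp add: k0_def)
    next
      case False
      moreover have "k0 * (N + k0) \<ge> 0" using N(1) k0 by simp
      ultimately show ?thesis by (simp add: k0_def)
    qed
  qed
qed

end

subsection \<open>Classical solutions\<close>

lemma smooth_on_C2:
  fixes f :: "'a::euclidean_space \<Rightarrow> 'b::real_normed_vector"
  assumes "smooth_on S f"
  obtains U g where "open U" "S \<subseteq> U" "C1_on U g" "\<And>v. C1_on U (\<lambda>z. frechet_derivative g (at z) v)"
    "\<And>x. x \<in> S \<Longrightarrow> g x = f x"
proof -
  obtain U g where g: "open U" "S \<subseteq> U" "\<forall>k. k_times_diff k U g" "\<forall>x\<in>S. g x = f x"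
    using assms by (auto simp: smooth_on_def)
  have C1: "k_times_diff (Suc 0) U h \<Longrightarrow> C1_on U h" for h :: "'a \<Rightarrow> 'b"
    by (simp add: C1_on_def)
  have "k_times_diff (Suc (Suc 0)) U g" using g(3) by blast
  then have "C1_on U (\<lambda>z. frechet_derivative g (at z) v)" for v
    by (intro C1) simp
  then show ?thesis using that g C1 by blast
qed

lemma smooth_on_UNIV_C1:
  fixes f :: "'a::euclidean_space \<Rightarrow> 'b::real_normed_vector"
  assumes "smooth_on UNIV f"
  shows "C1_on UNIV f"
proof -
  obtain U g where "UNIV \<subseteq> U" "C1_on U g" "\<And>x. x \<in> UNIV \<Longrightarrow> g x = f x"
    using smooth_on_C2[OF assms] by metis
  then have "C1_on UNIV g" "g = f" by (auto intro: C1_on_subset)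
  then show ?thesis by simp
qed

text \<open>At boundary points \<^const>\<open>frechet_derivative\<close> is a choice; it is determined because the
  directions into the ball span the space.\<close>

lemma frechet_derivative_within_cball:
  fixes f :: "'a::euclidean_space \<Rightarrow> real"
  assumes D: "(f has_derivative D) (at x within cball 0 r)" and x: "x \<in> cball 0 r" and r: "r > 0"
  shows "frechet_derivative f (at x within cball 0 r) = D"
proof -
  define D' where "D' = frechet_derivative f (at x within cball 0 r)"
  have D': "(f has_derivative D') (at x within cball 0 r)"
    unfolding D'_def using D by (metis differentiableI frechet_derivative_works)
  have line: "D (y - x) = D' (y - x)" if y: "y \<in> cball 0 r" for y
  proof -
    have seg: "(\<lambda>s. x + s *\<^sub>R (y - x)) ` {0..1} \<subseteq> cball 0 r"
    proof safe
      fix s :: real assume "s \<in> {0..1}"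
      then have "(1 - s) *\<^sub>R x + s *\<^sub>R y \<in> cball 0 r"
        using x y by (intro convexD_alt[OF convex_cball]) auto
      then show "x + s *\<^sub>R (y - x) \<in> cball 0 r" by (simp add: algebra_simps)
    qed
    have vd: "((\<lambda>s. f (x + s *\<^sub>R (y - x))) has_vector_derivative L (y - x)) (at 0 within {0..1})"
      if L: "(f has_derivative L) (at x within cball 0 r)" for L
    proof -
      have lin: "((\<lambda>s::real. x + s *\<^sub>R (y - x)) has_derivative (\<lambda>s. s *\<^sub>R (y - x))) (at 0 within {0..1})"
        by (auto intro!: derivative_eq_intros)
      have "(f has_derivative L) (at (x + 0 *\<^sub>R (y - x)) within (\<lambda>s. x + s *\<^sub>R (y - x)) ` {0..1})"
        using has_derivative_subset[OF L seg] by simp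
      from has_derivative_in_compose[OF lin this]
      have "((\<lambda>s. f (x + s *\<^sub>R (y - x))) has_derivative (\<lambda>s. L (s *\<^sub>R (y - x)))) (at 0 within {0..1})" .
      then show ?thesis
        unfolding has_vector_derivative_def linear_cmul[OF has_derivative_linear[OF L]] .
    qed
    show ?thesis
      by (rule vector_derivative_unique_within[OF _ vd[OF D] vd[OF D']]) (simp add: trivial_limit_within)
  qed
  have linD: "linear D" "linear D'" using D D' has_derivative_linear by blast+
  have Dx: "D x = D' x"
    using line[of 0] r by (simp add: linear_neg[OF linD(1)] linear_neg[OF linD(2)])
  have "D b = D' b" if b: "b \<in> Basis" for b
  proof -
    have "D (r *\<^sub>R b - x) = D' (r *\<^sub>R b - x)" using line[of "r *\<^sub>R b"] r b by simp
    then have "r *\<^sub>R D b = r *\<^sub>R D' b"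
      using Dx by (simp add: linear_diff[OF linD(1)] linear_diff[OF linD(2)]
          linear_cmul[OF linD(1)] linear_cmul[OF linD(2)])
    then show ?thesis using r by simp
  qed
  then have "D = D'" using linear_eq_stdbasis[OF linD] by blast
  then show ?thesis by (simp add: D'_def)
qed

text \<open>The extension g is fixed before W, B and b0, so one g serves both the trivial splitting
  B = 0, used for the mass, and the splitting behind the supremum bound.\<close>

lemma is_solution_pme_flow:
  fixes V :: "'a::euclidean_space \<Rightarrow> 'a"
  assumes sol: "is_solution m \<epsilon> V u0 r u" and m: "m > 1" and \<epsilon>: "\<epsilon> > 0" and r: "r \<ge> 1"
    and V: "C1_on UNIV V"
  obtains U g where "\<And>x t. x \<in> cball 0 r \<Longrightarrow> t > 0 \<Longrightarrow> g (x, t) = u x t"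
    "\<And>W B b0. continuous_on UNIV W \<Longrightarrow> (\<And>x. (B has_derivative (\<lambda>v. (V x - W x) \<bullet> v)) (at x)) \<Longrightarrow>
      (\<And>x. \<bar>B x\<bar> \<le> b0) \<Longrightarrow> pme_flow m \<epsilon> r b0 U g V W B"
proof -
  have smooth: "smooth_on (cball 0 r \<times> {0<..}) (\<lambda>(x, t). u x t)"
    and nonneg: "\<And>x t. x \<in> cball 0 r \<Longrightarrow> t > 0 \<Longrightarrow> u x t \<ge> 0"
    and pde: "\<And>x t. x \<in> ball 0 r \<Longrightarrow> t > 0 \<Longrightarrow> ((\<lambda>s. u x s) has_real_derivative
           laplacian (\<lambda>y. phi m \<epsilon> (u y t)) x + divergence (\<lambda>y. u y t *\<^sub>R V y) x) (at t)"
    and bc: "\<And>x t. x \<in> sphere 0 r \<Longrightarrow> t > 0 \<Longrightarrow>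
        (gradient (\<lambda>y. phi m \<epsilon> (u y t)) (at x within cball 0 r) + u x t *\<^sub>R V x) \<bullet> (x /\<^sub>R norm x) = 0"
    using sol unfolding is_solution_def by blast+
  obtain U g where U: "open U" "cball 0 r \<times> {0<..} \<subseteq> U" and C1: "C1_on U g"
    and C2: "\<And>v. C1_on U (\<lambda>z. frechet_derivative g (at z) v)"
    and eq: "\<And>z. z \<in> cball 0 r \<times> {0<..} \<Longrightarrow> g z = (\<lambda>(x, t). u x t) z"
    using smooth_on_C2[OF smooth] by metis
  have gu: "g (x, t) = u x t" if "x \<in> cball 0 r" "t > 0" for x t
    using eq[of "(x, t)"] that by simp
  interpret pme_domain m \<epsilon> r U g V
    by unfold_locales (use m \<epsilon> r U C1 C2 V gu nonneg in auto)
  have PDE: "g_t t x = divergence (flux t) x" if x: "x \<in> ball 0 r" and t: "t > 0" and pos: "g (x, t) > 0" for x t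
  proof -
    \<comment> \<open>On this open set u and g coincide and g is positive, so the operators in the
      equation, being local, can be evaluated on g with the chain rule for \<phi>.\<close>
    let ?S = "{y \<in> slice t. g (y, t) > 0} \<inter> ball 0 r"
    have S: "open ?S" using open_slice_pos by blast
    have xS: "x \<in> ?S" using x pos slice(1)[OF t] by auto
    have xU: "(x, t) \<in> U" using U x t by auto
    have "((\<lambda>s. g (x, s)) has_real_derivative
        laplacian (\<lambda>y. phi m \<epsilon> (u y t)) x + divergence (\<lambda>y. u y t *\<^sub>R V y) x) (at t)"
      by (rule has_field_derivative_transform_within_open[OF pde[OF x t], of "{0<..}"])
         (use t x gu in auto)
    then have "g_t t x = laplacian (\<lambda>y. phi m \<epsilon> (u y t)) x + divergence (\<lambda>y. u y t *\<^sub>R V y) x"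
      using g_t_deriv[OF xU] DERIV_unique by blast
    also have "laplacian (\<lambda>y. phi m \<epsilon> (u y t)) x = divergence (\<lambda>y. dphi (g (y, t)) *\<^sub>R grad t y) x"
      unfolding laplacian_def
    proof (rule divergence_cong[OF S xS])
      fix y assume y: "y \<in> ?S"
      have "((\<lambda>y. phi m \<epsilon> (g (y, t))) has_derivative (\<lambda>v. dphi (g (y, t)) * (grad t y \<bullet> v))) (at y)"
        using has_derivative_compose[OF grad, of y t "phi m \<epsilon>" "(*) (dphi (g (y, t)))"]
          phi_deriv[of "g (y, t)"] y by (simp add: has_field_derivative_def)
      then have "gradient (\<lambda>y. phi m \<epsilon> (g (y, t))) (at y) = dphi (g (y, t)) *\<^sub>R grad t y"
        by (intro gradientI) simp
      moreover have "gradient (\<lambda>y. phi m \<epsilon> (u y t)) (at y) = gradient (\<lambda>y. phi m \<epsilon> (g (y, t))) (at y)"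
        by (rule gradient_cong[OF S y]) (use gu t in auto)
      ultimately show "gradient (\<lambda>y. phi m \<epsilon> (u y t)) (at y) = dphi (g (y, t)) *\<^sub>R grad t y" by simp
    qed
    also have "divergence (\<lambda>y. u y t *\<^sub>R V y) x = divergence (\<lambda>y. g (y, t) *\<^sub>R V y) x"
      by (rule divergence_cong[OF S xS]) (use gu t in auto)
    also have "divergence (\<lambda>y. dphi (g (y, t)) *\<^sub>R grad t y) x + divergence (\<lambda>y. g (y, t) *\<^sub>R V y) x = divergence (flux t) x"
      unfolding flux_def[abs_def]
    proof (rule divergence_add[symmetric])
      have d: "(\<lambda>y. g (y, t)) differentiable (at x)" "grad t differentiable (at x)" "V differentiable (at x)"
        using g_slice_C1[of t] grad_C1[of t] V xS by (auto simp: C1_on_def)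
      have "dphi differentiable (at (g (x, t)))"
        using dphi_deriv[OF pos] by (auto simp: has_field_derivative_def differentiable_def)
      then have "(\<lambda>y. dphi (g (y, t))) differentiable (at x)"
        using differentiable_chain_at[OF d(1)] by (simp add: comp_def)
      then show "(\<lambda>y. dphi (g (y, t)) *\<^sub>R grad t y) differentiable (at x)"
        "(\<lambda>y. g (y, t) *\<^sub>R V y) differentiable (at x)"
        using d by (auto intro: differentiable_scaleR)
    qed
    finally show ?thesis .
  qed
  \<comment> \<open>At the sphere u is known only from inside. The derivative of \<phi>(g),
    restricted to the closed ball, is a derivative of \<phi>(u) within it, and uniqueness identifies
    the gradient in the boundary condition.\<close>
  have BC: "flux t x \<bullet> x = 0" if x: "norm x = r" and t: "t > 0" and pos: "g (x, t) > 0" for x t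
  proof -
    have xs: "x \<in> slice t" "x \<in> cball 0 r" using x slice(1)[OF t] by auto
    have "((\<lambda>y. phi m \<epsilon> (g (y, t))) has_derivative (\<lambda>v. dphi (g (x, t)) * (grad t x \<bullet> v))) (at x)"
      using has_derivative_compose[OF grad[OF xs(1)], of "phi m \<epsilon>" "(*) (dphi (g (x, t)))"]
        phi_deriv[OF pos] by (simp add: has_field_derivative_def)
    then have "((\<lambda>y. phi m \<epsilon> (g (y, t))) has_derivative (\<lambda>v. dphi (g (x, t)) * (grad t x \<bullet> v))) (at x within cball 0 r)"
      by (rule has_derivative_at_withinI)
    then have "((\<lambda>y. phi m \<epsilon> (u y t)) has_derivative (\<lambda>v. dphi (g (x, t)) * (grad t x \<bullet> v))) (at x within cball 0 r)"
      by (rule has_derivative_transform[OF xs(2), rotated]) (use gu t in auto)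
    then have "frechet_derivative (\<lambda>y. phi m \<epsilon> (u y t)) (at x within cball 0 r) = (\<lambda>v. dphi (g (x, t)) * (grad t x \<bullet> v))"
      by (rule frechet_derivative_within_cball[OF _ xs(2)]) (use r in simp)
    then have "gradient (\<lambda>y. phi m \<epsilon> (u y t)) (at x within cball 0 r) = dphi (g (x, t)) *\<^sub>R grad t x"
      unfolding gradient_def by (simp add: scaleR_scaleR[symmetric] scaleR_sum_right[symmetric] euclidean_representation del: scaleR_scaleR)
    then have "flux t x \<bullet> (x /\<^sub>R norm x) = 0"
      using bc[of x t] x t gu[OF xs(2) t] by (simp add: flux_def)
    then show ?thesis using x r by simp
  qed
  show ?thesis
  proof (rule that[OF gu])
    fix W :: "'a \<Rightarrow> 'a" and B :: "'a \<Rightarrow> real" and b0 :: real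
    assume "continuous_on UNIV W" "\<And>x. (B has_derivative (\<lambda>v. (V x - W x) \<bullet> v)) (at x)" "\<And>x. \<bar>B x\<bar> \<le> b0"
    then show "pme_flow m \<epsilon> r b0 U g V W B"
      by unfold_locales (use PDE BC in auto)
  qed
qed

subsection \<open>The drift\<close>

text \<open>The absolute value makes the bound nonnegative by form, without a discussion of the sign
  of the converted essential supremum.\<close>

lemma Linf_norm_AE:
  assumes "in_Linf lebesgue f"
  shows "AE x in lborel. norm (f x) \<le> \<bar>Linf_norm lebesgue f\<bar>"
proof -
  let ?E = "esssup lebesgue (\<lambda>x. ereal (norm (f x)))"
  have fin: "?E < \<infinity>" using assms by (simp add: in_Linf_def)
  have "AE x in lebesgue. ereal (norm (f x)) \<le> ?E" by (rule esssup_AE)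
  then have "AE x in lebesgue. norm (f x) \<le> \<bar>Linf_norm lebesgue f\<bar>"
  proof eventually_elim
    case (elim x)
    then show ?case using fin unfolding Linf_norm_def by (cases ?E) auto
  qed
  then show ?thesis by (simp add: AE_completion_iff)
qed

lemma in_Lp_nn_integral:
  assumes "in_Lp lebesgue p f" "p > 0"
  shows "(\<integral>\<^sup>+x. ennreal (norm (f x) powr p) \<partial>lborel) = ennreal (Lp_norm lebesgue p f powr p)"
proof -
  have int: "integrable lebesgue (\<lambda>x. norm (f x) powr p)" using assms by (simp add: in_Lp_def)
  let ?I = "\<integral>x. norm (f x) powr p \<partial>lebesgue"
  have "(\<integral>\<^sup>+x. ennreal (norm (f x) powr p) \<partial>lborel) = (\<integral>\<^sup>+x. ennreal (norm (f x) powr p) \<partial>lebesgue)"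
    by (rule nn_integral_completion[symmetric])
  also have "\<dots> = ennreal ?I" by (rule nn_integral_eq_integral[OF int]) auto
  also have "?I = Lp_norm lebesgue p f powr p"
    using assms(2) by (simp add: Lp_norm_def powr_powr)
  finally show ?thesis .
qed

text \<open>Splitting at t = a trades the square against the p-th power; a stays free so that
  \<open>drift_morrey\<close> can tune it to the radius.\<close>

lemma square_le_powr:
  fixes t a p :: real
  assumes "t \<ge> 0" "a > 0" "p \<ge> 2"
  shows "t\<^sup>2 \<le> a\<^sup>2 + a powr (2 - p) * t powr p"
proof (cases "t \<le> a")
  case True
  then have "t\<^sup>2 \<le> a\<^sup>2" using assms by (intro power_mono)
  then show ?thesis by (simp add: add_increasing2)
next
  case False
  then have t: "t > a" "t > 0" using assms by auto
  have "t\<^sup>2 = t powr (2 - p) * t powr p"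
    using t by (simp add: powr_add[symmetric] powr_numeral)
  also have "\<dots> \<le> a powr (2 - p) * t powr p"
    using t assms by (intro mult_right_mono powr_mono2') auto
  finally show ?thesis by (simp add: add_increasing)
qed

lemma norm_add_square_le:
  fixes x y :: "'a::real_normed_vector"
  assumes "norm x \<le> A"
  shows "(norm (x + y))\<^sup>2 \<le> 2 * A\<^sup>2 + 2 * (norm y)\<^sup>2"
proof -
  have "norm (x + y) \<le> A + norm y" using norm_triangle_ineq[of x y] assms by linarith
  then have "(norm (x + y))\<^sup>2 \<le> (A + norm y)\<^sup>2" by (intro power_mono) auto
  also have "\<dots> \<le> (A + norm y)\<^sup>2 + (A - norm y)\<^sup>2" by simp
  also have "\<dots> = 2 * A\<^sup>2 + 2 * (norm y)\<^sup>2" by (simp add: power2_eq_square algebra_simps)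
  finally show ?thesis .
qed

text \<open>In place of Hoelder's inequality, |V2|^2 is split at the level a = \<rho>^(-d/p): then
  a^2 \<rho>^d and a^(2 - p) are the same power \<rho>^\<kappa> with \<kappa> = d - 2 d / p. The
  bounded part contributes \<rho>^d, which is at most 4 \<rho>^\<kappa> because \<rho> \<le> 2 and 2
  d / p \<le> 2.\<close>

lemma drift_morrey:
  fixes V1 V2 :: "'a::euclidean_space \<Rightarrow> 'a"
  assumes d: "DIM('a) \<ge> 2" and p: "p > real DIM('a)"
    and V1: "AE x in lborel. norm (V1 x) \<le> A"
    and V2: "continuous_on UNIV V2" "(\<integral>\<^sup>+x. ennreal (norm (V2 x) powr p) \<partial>lborel) = ennreal I" "I \<ge> 0"
  defines "\<beta> \<equiv> unit_ball_vol (real DIM('a))" and "\<alpha> \<equiv> 1 - real DIM('a) / p"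
  shows "AE x in lborel. 1 + (norm (V1 x + V2 x))\<^sup>2 \<le> (3 + 2 * A\<^sup>2) + 2 * norm (V2 x) powr p"
    and "0 < \<rho> \<Longrightarrow> \<rho> \<le> 2 \<Longrightarrow>
      (\<integral>\<^sup>+x. ennreal (1 + (norm (V1 x + V2 x))\<^sup>2) * indicator (ball z \<rho>) x \<partial>lborel)
      \<le> ennreal ((4 * (1 + 2 * A\<^sup>2) * \<beta> + 2 * (\<beta> + I)) * \<rho> powr (real DIM('a) - 2 + 2 * \<alpha>))"
proof -
  let ?d = "real DIM('a)"
  have p2: "p \<ge> 2" "p > 0" using p d by auto
  have pointwise: "AE x in lborel. 1 + (norm (V1 x + V2 x))\<^sup>2 \<le>
      (1 + 2 * A\<^sup>2 + 2 * a\<^sup>2) + 2 * a powr (2 - p) * norm (V2 x) powr p" if a: "a > 0" for a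
    using V1
  proof eventually_elim
    case (elim x)
    have "(norm (V1 x + V2 x))\<^sup>2 \<le> 2 * A\<^sup>2 + 2 * (norm (V2 x))\<^sup>2" by (rule norm_add_square_le[OF elim])
    moreover have "(norm (V2 x))\<^sup>2 \<le> a\<^sup>2 + a powr (2 - p) * norm (V2 x) powr p"
      by (rule square_le_powr) (use a p2 in auto)
    ultimately show ?case by (simp add: algebra_simps)
  qed
  show "AE x in lborel. 1 + (norm (V1 x + V2 x))\<^sup>2 \<le> (3 + 2 * A\<^sup>2) + 2 * norm (V2 x) powr p"
    using pointwise[of 1] by (simp add: algebra_simps)
  assume \<rho>: "0 < \<rho>" "\<rho> \<le> 2"
  define \<kappa> where "\<kappa> = ?d - 2 + 2 * \<alpha>"
  have \<kappa>: "\<kappa> = ?d - 2 * ?d / p" by (simp add: \<kappa>_def \<alpha>_def algebra_simps)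
  define a where "a = \<rho> powr (- (?d / p))"
  have a: "a > 0" using \<rho> by (simp add: a_def)
  have \<beta>: "\<beta> \<ge> 0" unfolding \<beta>_def by (rule unit_ball_vol_nonneg) simp
  let ?c1 = "1 + 2 * A\<^sup>2 + 2 * a\<^sup>2" and ?c2 = "2 * a powr (2 - p)"
  have [measurable]: "V2 \<in> borel_measurable borel" using V2(1) by (rule borel_measurable_continuous_onI)
  have [measurable]: "ball z \<rho> \<in> sets borel" for z :: 'a by simp
  have c: "?c1 \<ge> 0" "?c2 \<ge> 0" by (auto intro!: add_nonneg_nonneg)
  have e: "ennreal (?c1 + ?c2 * norm (V2 x) powr p) = ennreal ?c1 + ennreal ?c2 * ennreal (norm (V2 x) powr p)" for x
    using c by (simp add: ennreal_plus ennreal_mult)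
  have "(\<integral>\<^sup>+x. ennreal (1 + (norm (V1 x + V2 x))\<^sup>2) * indicator (ball z \<rho>) x \<partial>lborel) \<le>
      (\<integral>\<^sup>+x. ennreal ?c1 * indicator (ball z \<rho>) x + ennreal ?c2 * ennreal (norm (V2 x) powr p) \<partial>lborel)"
  proof (rule nn_integral_mono_AE)
    show "AE x in lborel. ennreal (1 + (norm (V1 x + V2 x))\<^sup>2) * indicator (ball z \<rho>) x \<le>
        ennreal ?c1 * indicator (ball z \<rho>) x + ennreal ?c2 * ennreal (norm (V2 x) powr p)"
      using pointwise[OF a]
    proof eventually_elim
      case (elim x)
      then have "ennreal (1 + (norm (V1 x + V2 x))\<^sup>2) \<le> ennreal ?c1 + ennreal ?c2 * ennreal (norm (V2 x) powr p)"
        unfolding e[symmetric] by (rule ennreal_leI)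
      then show ?case by (auto simp: indicator_def)
    qed
  qed
  also have "\<dots> = ennreal ?c1 * emeasure lborel (ball z \<rho>) + ennreal ?c2 * ennreal I"
    by (subst nn_integral_add) (simp_all add: nn_integral_cmult nn_integral_cmult_indicator V2(2))
  also have "emeasure lborel (ball z \<rho>) = ennreal (\<beta> * \<rho> ^ DIM('a))"
    using emeasure_ball[of \<rho> z] \<rho> by (simp add: \<beta>_def)
  also have "ennreal ?c1 * ennreal (\<beta> * \<rho> ^ DIM('a)) + ennreal ?c2 * ennreal I =
      ennreal (?c1 * (\<beta> * \<rho> ^ DIM('a)) + ?c2 * I)"
    using c \<beta> \<rho> V2(3) by (simp add: ennreal_plus ennreal_mult)
  also have "\<dots> \<le> ennreal ((4 * (1 + 2 * A\<^sup>2) * \<beta> + 2 * (\<beta> + I)) * \<rho> powr \<kappa>)"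
  proof (rule ennreal_leI)
    have a2: "a\<^sup>2 * \<rho> ^ DIM('a) = \<rho> powr \<kappa>"
      using \<rho> by (simp add: a_def \<kappa> power2_eq_square powr_add[symmetric] powr_realpow[symmetric])
    have ap: "a powr (2 - p) = \<rho> powr \<kappa>"
    proof -
      have "- (?d / p) * (2 - p) = \<kappa>" using p2 by (simp add: \<kappa> field_simps)
      then show ?thesis by (simp only: a_def powr_powr)
    qed
    have "\<rho> ^ DIM('a) = \<rho> powr \<kappa> * \<rho> powr (2 * ?d / p)"
      using \<rho> by (simp add: \<kappa> powr_add[symmetric] powr_realpow[symmetric])
    also have "\<dots> \<le> \<rho> powr \<kappa> * 4"
    proof (rule mult_left_mono)
      have "2 * ?d / p \<le> 2" using p p2 by (simp add: pos_divide_le_eq)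
      have "\<rho> powr (2 * ?d / p) \<le> 2 powr (2 * ?d / p)"
        using \<rho> p2 by (intro powr_mono2) auto
      also have "\<dots> \<le> 2 powr 2" using \<open>2 * ?d / p \<le> 2\<close> by (intro powr_mono) auto
      finally show "\<rho> powr (2 * ?d / p) \<le> 4" by (simp add: powr_numeral)
    qed simp
    finally have d4: "\<rho> ^ DIM('a) \<le> 4 * \<rho> powr \<kappa>" by (simp add: mult.commute)
    have "?c1 * (\<beta> * \<rho> ^ DIM('a)) + ?c2 * I =
        (1 + 2 * A\<^sup>2) * \<beta> * \<rho> ^ DIM('a) + 2 * \<beta> * (a\<^sup>2 * \<rho> ^ DIM('a)) + 2 * a powr (2 - p) * I"
      by (simp add: algebra_simps)
    also have "\<dots> \<le> (1 + 2 * A\<^sup>2) * \<beta> * (4 * \<rho> powr \<kappa>) + 2 * \<beta> * \<rho> powr \<kappa> + 2 * \<rho> powr \<kappa> * I"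
      unfolding a2 ap using \<beta> d4 by (intro add_mono mult_left_mono) auto
    also have "\<dots> = (4 * (1 + 2 * A\<^sup>2) * \<beta> + 2 * (\<beta> + I)) * \<rho> powr \<kappa>"
      by (simp add: algebra_simps)
    finally show "?c1 * (\<beta> * \<rho> ^ DIM('a)) + ?c2 * I \<le> (4 * (1 + 2 * A\<^sup>2) * \<beta> + 2 * (\<beta> + I)) * \<rho> powr \<kappa>" .
  qed
  finally show "(\<integral>\<^sup>+x. ennreal (1 + (norm (V1 x + V2 x))\<^sup>2) * indicator (ball z \<rho>) x \<partial>lborel)
      \<le> ennreal ((4 * (1 + 2 * A\<^sup>2) * \<beta> + 2 * (\<beta> + I)) * \<rho> powr (real DIM('a) - 2 + 2 * \<alpha>))"
    by (simp add: \<kappa>_def)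
qed

text \<open>The space is an abstract one of dimension one; agreement on boxes lets integrals over
  \<open>real\<close> be transported to it.\<close>

lemma lborel_one_dimensional:
  fixes b :: "'a::euclidean_space"
  assumes b: "Basis = {b}"
  shows "lborel = distr lborel borel (\<lambda>\<tau>::real. \<tau> *\<^sub>R b)"
proof (rule lborel_eqI)
  have "b \<in> Basis" using b by blast
  then have bb: "b \<bullet> b = 1" by (rule inner_same_Basis)
  fix l u :: 'a assume le: "\<And>c. c \<in> Basis \<Longrightarrow> l \<bullet> c \<le> u \<bullet> c"
  have vim: "(\<lambda>\<tau>. \<tau> *\<^sub>R b) -` box l u = {l \<bullet> b<..<u \<bullet> b}"
    by (auto simp: box_def b bb)
  have "emeasure (distr lborel borel (\<lambda>\<tau>. \<tau> *\<^sub>R b)) (box l u) = emeasure lborel ((\<lambda>\<tau>. \<tau> *\<^sub>R b) -` box l u)"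
    by (subst emeasure_distr) auto
  also have "\<dots> = ennreal (u \<bullet> b - l \<bullet> b)"
    unfolding vim by (rule emeasure_lborel_Ioo) (use le b in blast)
  also have "\<dots> = (\<Prod>c\<in>Basis. (u - l) \<bullet> c)" by (simp add: b inner_diff_left)
  finally show "emeasure (distr lborel borel (\<lambda>\<tau>. \<tau> *\<^sub>R b)) (box l u) = (\<Prod>c\<in>Basis. (u - l) \<bullet> c)" .
qed simp

text \<open>In one dimension \<open>V\<close> is replaced by its average over unit intervals, up to a derivative of a
  bounded function; this only uses uniform local integrability of \<open>V\<close>.\<close>

lemma drift_one_dimensional:
  fixes V V2 :: "'a::euclidean_space \<Rightarrow> 'a"
  assumes d: "DIM('a) = 1" and V: "continuous_on UNIV V"
    and V_le: "AE x in lborel. norm (V x) \<le> K + norm (V2 x) powr p" and K: "K \<ge> 0"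
    and V2: "continuous_on UNIV V2" "(\<integral>\<^sup>+x. ennreal (norm (V2 x) powr p) \<partial>lborel) = ennreal I" "I \<ge> 0"
  obtains W B where "continuous_on UNIV W" "\<And>x. (B has_derivative (\<lambda>v. (V x - W x) \<bullet> v)) (at x)"
    "\<And>x. \<bar>B x\<bar> \<le> K + I" "\<And>x. norm (W x) \<le> K + I"
proof -
  obtain b where b: "Basis = {b::'a}" using d by (auto simp: card_1_singleton_iff)
  have "b \<in> Basis" using b by blast
  then have bb: "b \<bullet> b = 1" by (rule inner_same_Basis)
  have nb: "norm b = 1" using b by (metis insertI1 norm_Basis)
  have rep: "x = (x \<bullet> b) *\<^sub>R b" for x :: 'a using euclidean_representation[of x] by (simp add: b)
  define f where "f = (\<lambda>s. V (s *\<^sub>R b) \<bullet> b)"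
  have fc: "continuous_on A f" for A
    unfolding f_def by (intro continuous_intros continuous_on_compose2[OF V]) auto
  have anti: "\<exists>F. \<forall>s. (F has_real_derivative h s) (at s)" if h: "continuous_on UNIV h" for h :: "real \<Rightarrow> real"
    using einterval_antiderivative[of "-\<infinity>" "\<infinity>" h] h
    by (auto simp: has_real_derivative_iff_has_vector_derivative continuous_on_eq_continuous_at)
  obtain F where F: "\<And>s. (F has_real_derivative f s) (at s)" using anti[OF fc] by blast
  have Fc: "continuous_on A F" for A
    using F DERIV_isCont by (blast intro: continuous_at_imp_continuous_on)
  obtain H where H: "\<And>s. (H has_real_derivative F s) (at s)" using anti[OF Fc] by blast
  have osc: "\<bar>F \<xi> - F s\<bar> \<le> K + I" if s: "s \<le> \<xi>" "\<xi> \<le> s + 1" for s \<xi>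
  proof -
    have 1: "(f has_integral (F \<xi> - F s)) {s..\<xi>}"
      by (rule fundamental_theorem_of_calculus[OF s(1)])
         (use F in \<open>auto simp: has_real_derivative_iff_has_vector_derivative[symmetric] intro: has_field_derivative_at_within\<close>)
    have 2: "((\<lambda>s. \<bar>f s\<bar>) has_integral (integral {s..\<xi>} (\<lambda>s. \<bar>f s\<bar>))) {s..\<xi>}"
      by (intro integrable_integral integrable_continuous_interval continuous_intros fc)
    have "\<bar>F \<xi> - F s\<bar> \<le> integral {s..\<xi>} (\<lambda>s. \<bar>f s\<bar>)"
      using has_integral_le[OF 1 2] has_integral_le[OF has_integral_neg[OF 1] 2] by (force simp: abs_le_iff)
    also have "\<dots> \<le> K + I"
    proof -
      have "((\<lambda>\<tau>. if \<tau> \<in> {s..\<xi>} then \<bar>f \<tau>\<bar> else 0) has_integral (integral {s..\<xi>} (\<lambda>s. \<bar>f s\<bar>))) UNIV"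
        using 2 by (subst has_integral_restrict_UNIV)
      moreover have "(\<lambda>\<tau>. if \<tau> \<in> {s..\<xi>} then \<bar>f \<tau>\<bar> else 0) = (\<lambda>\<tau>. indicator {s..\<xi>} \<tau> *\<^sub>R \<bar>f \<tau>\<bar>)"
        by (auto simp: fun_eq_iff indicator_def)
      ultimately have "((\<lambda>\<tau>. indicator {s..\<xi>} \<tau> *\<^sub>R \<bar>f \<tau>\<bar>) has_integral (integral {s..\<xi>} (\<lambda>s. \<bar>f s\<bar>))) UNIV" by simp
      then have "ennreal (integral {s..\<xi>} (\<lambda>s. \<bar>f s\<bar>)) = (\<integral>\<^sup>+\<tau>. ennreal (indicator {s..\<xi>} \<tau> *\<^sub>R \<bar>f \<tau>\<bar>) \<partial>lborel)"
        by (intro nn_integral_has_integral_lborel[symmetric] borel_measurable_continuous_on_indicator continuous_intros fc) auto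
      also have "\<dots> \<le> (\<integral>\<^sup>+\<tau>. ennreal (norm (V (\<tau> *\<^sub>R b))) * indicator {s..s + 1} ((\<tau> *\<^sub>R b) \<bullet> b) \<partial>lborel)"
      proof (rule nn_integral_mono)
        fix \<tau>
        have "\<bar>f \<tau>\<bar> \<le> norm (V (\<tau> *\<^sub>R b))"
          unfolding f_def using Cauchy_Schwarz_ineq2[of "V (\<tau> *\<^sub>R b)" b] by (simp add: nb)
        then show "ennreal (indicator {s..\<xi>} \<tau> *\<^sub>R \<bar>f \<tau>\<bar>) \<le> ennreal (norm (V (\<tau> *\<^sub>R b))) * indicator {s..s + 1} ((\<tau> *\<^sub>R b) \<bullet> b)"
          using s by (auto simp: indicator_def bb intro!: ennreal_leI)
      qed
      also have "\<dots> = (\<integral>\<^sup>+x. ennreal (norm (V x)) * indicator {s..s + 1} (x \<bullet> b) \<partial>distr lborel borel (\<lambda>\<tau>. \<tau> *\<^sub>R b))"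
      proof (rule nn_integral_distr[symmetric])
        have [measurable]: "V \<in> borel_measurable borel" using V by (rule borel_measurable_continuous_onI)
        show "(\<lambda>x. ennreal (norm (V x)) * indicator {s..s + 1} (x \<bullet> b)) \<in> borel_measurable (distr lborel borel (\<lambda>\<tau>. \<tau> *\<^sub>R b))"
          by measurable
      qed simp
      also have "\<dots> = (\<integral>\<^sup>+x. ennreal (norm (V x)) * indicator {s..s + 1} (x \<bullet> b) \<partial>lborel)"
        by (subst lborel_one_dimensional[OF b, symmetric]) simp
      also have "\<dots> \<le> (\<integral>\<^sup>+x. ennreal K * indicator {s..s + 1} (x \<bullet> b) + ennreal (norm (V2 x) powr p) \<partial>lborel)"
      proof (rule nn_integral_mono_AE)
        show "AE x in lborel. ennreal (norm (V x)) * indicator {s..s + 1} (x \<bullet> b) \<le>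
            ennreal K * indicator {s..s + 1} (x \<bullet> b) + ennreal (norm (V2 x) powr p)"
          using V_le
        proof eventually_elim
          case (elim x)
          then have "ennreal (norm (V x)) \<le> ennreal K + ennreal (norm (V2 x) powr p)"
            using K by (simp add: ennreal_plus[symmetric] ennreal_leI del: ennreal_plus)
          then show ?case by (auto simp: indicator_def)
        qed
      qed
      also have "\<dots> = (\<integral>\<^sup>+x. ennreal K * indicator {s..s + 1} (x \<bullet> b) \<partial>lborel) + ennreal I"
      proof -
        have [measurable]: "V2 \<in> borel_measurable borel" using V2(1) by (rule borel_measurable_continuous_onI)
        show ?thesis by (subst nn_integral_add) (simp_all add: V2(2))
      qed
      also have "(\<integral>\<^sup>+x. ennreal K * indicator {s..s + 1} (x \<bullet> b) \<partial>lborel) = ennreal K"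
      proof -
        have "(\<integral>\<^sup>+x. ennreal K * indicator {s..s + 1} (x \<bullet> b) \<partial>lborel) =
            (\<integral>\<^sup>+x. ennreal K * indicator {s..s + 1} (x \<bullet> b) \<partial>distr lborel borel (\<lambda>\<tau>. \<tau> *\<^sub>R b))"
          by (subst lborel_one_dimensional[OF b]) simp
        also have "\<dots> = (\<integral>\<^sup>+\<tau>. ennreal K * indicator {s..s + 1} \<tau> \<partial>lborel)"
          by (subst nn_integral_distr) (auto simp: bb)
        also have "\<dots> = ennreal K" by (simp add: nn_integral_cmult_indicator)
        finally show ?thesis .
      qed
      also have "ennreal K + ennreal I = ennreal (K + I)" using K V2(3) by simp
      finally show ?thesis using K V2(3) by (subst (asm) ennreal_le_iff) auto
    qed
    finally show ?thesis .
  qed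
  \<comment> \<open>F is a primitive of f and H a primitive of F. So W is the average of f over
    [s, s + 1], B is F minus its own average there, and B' = f - W along b. Both are controlled by
    oscillations of F over unit intervals, hence by \<open>osc\<close>.\<close>
  define W where "W = (\<lambda>x::'a. (F (x \<bullet> b + 1) - F (x \<bullet> b)) *\<^sub>R b)"
  define B where "B = (\<lambda>x::'a. F (x \<bullet> b) - (H (x \<bullet> b + 1) - H (x \<bullet> b)))"
  show ?thesis
  proof (rule that)
    show "continuous_on UNIV W"
      unfolding W_def by (intro continuous_intros continuous_on_compose2[OF Fc[of UNIV]]) auto
    show "norm (W x) \<le> K + I" for x
      using osc[of "x \<bullet> b" "x \<bullet> b + 1"] by (simp add: W_def nb)
    show "\<bar>B x\<bar> \<le> K + I" for x
    proof -
      let ?s = "x \<bullet> b"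
      obtain \<xi> where \<xi>: "?s < \<xi>" "\<xi> < ?s + 1" "H (?s + 1) - H ?s = (?s + 1 - ?s) * F \<xi>"
        using MVT2[of ?s "?s + 1" H F] H by auto
      then have "B x = - (F \<xi> - F ?s)" by (simp add: B_def)
      then show ?thesis using osc[of ?s \<xi>] \<xi> by simp
    qed
    show "(B has_derivative (\<lambda>v. (V x - W x) \<bullet> v)) (at x)" for x
    proof -
      let ?s = "x \<bullet> b"
      have in_b: "((\<lambda>x. x \<bullet> b) has_derivative (\<lambda>v. v \<bullet> b)) (at x)"
        by (auto intro!: derivative_eq_intros)
      have sh: "((\<lambda>s. H (s + 1)) has_real_derivative F (?s + 1)) (at ?s)"
        using H[of "?s + 1"] by (simp add: DERIV_shift)
      have "((\<lambda>s. F s - (H (s + 1) - H s)) has_real_derivative f ?s - (F (?s + 1) - F ?s)) (at ?s)"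
        by (intro DERIV_diff F H sh)
      then have "((\<lambda>s. F s - (H (s + 1) - H s)) has_derivative (*) (f ?s - (F (?s + 1) - F ?s))) (at ?s)"
        by (simp add: has_field_derivative_def)
      from has_derivative_compose[OF in_b this]
      have "(B has_derivative (\<lambda>v. (f ?s - (F (?s + 1) - F ?s)) * (v \<bullet> b))) (at x)" by (simp add: B_def)
      moreover have "(\<lambda>v. (f ?s - (F (?s + 1) - F ?s)) * (v \<bullet> b)) = (\<lambda>v. (V x - W x) \<bullet> v)"
      proof
        fix v
        have "f ?s = V x \<bullet> b" unfolding f_def using rep[of x] by simp
        then have "(V x - W x) \<bullet> b = f ?s - (F (?s + 1) - F ?s)" by (simp add: W_def inner_diff_left bb)
        moreover have "(V x - W x) \<bullet> v = (V x - W x) \<bullet> ((v \<bullet> b) *\<^sub>R b)" using rep[of v] by simp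
        ultimately show "(f ?s - (F (?s + 1) - F ?s)) * (v \<bullet> b) = (V x - W x) \<bullet> v" by (simp add: mult.commute)
      qed
      ultimately show ?thesis by simp
    qed
  qed
qed

text \<open>The constants are produced before the fields, so they depend only on p, the dimension
  and the two norms. In dimension at least two the splitting is trivial, B = 0 and W = V; in
  dimension one W is bounded, which gives \<alpha> = 1.\<close>

lemma drift_decomposition:
  fixes p Ainf Ap :: real
  assumes p: "p > real DIM('a::euclidean_space)"
  obtains b0 \<alpha> \<Lambda> K where "b0 \<ge> 0" "\<alpha> > 0" "\<Lambda> \<ge> 0" "K \<ge> 0"
    "\<And>V1 V2 V :: 'a \<Rightarrow> 'a. continuous_on UNIV V1 \<Longrightarrow> continuous_on UNIV V2 \<Longrightarrow> (\<And>x. V x = V1 x + V2 x) \<Longrightarrow>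
      in_Linf lebesgue V1 \<Longrightarrow> in_Lp lebesgue p V2 \<Longrightarrow> Linf_norm lebesgue V1 = Ainf \<Longrightarrow> Lp_norm lebesgue p V2 = Ap \<Longrightarrow>
      \<exists>W B. continuous_on UNIV W \<and> (\<forall>x. (B has_derivative (\<lambda>v. (V x - W x) \<bullet> v)) (at x)) \<and>
        (\<forall>x. \<bar>B x\<bar> \<le> b0) \<and>
        (\<forall>z \<rho>. 0 < \<rho> \<longrightarrow> \<rho> \<le> 2 \<longrightarrow> (\<integral>\<^sup>+x. ennreal (1 + (norm (W x))\<^sup>2) * indicator (ball z \<rho>) x \<partial>lborel)
          \<le> ennreal (\<Lambda> * \<rho> powr (real DIM('a) - 2 + 2 * \<alpha>))) \<and>
        (AE x in lborel. 1 + (norm (W x))\<^sup>2 \<le> K + 2 * norm (V2 x) powr p)"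
proof (cases "DIM('a) \<ge> 2")
  case d: True
  let ?\<beta> = "unit_ball_vol (real DIM('a))"
  let ?I = "Ap powr p" and ?A = "\<bar>Ainf\<bar>"
  have \<beta>: "?\<beta> \<ge> 0" by (rule unit_ball_vol_nonneg) simp
  have p0: "p > 0" using p by (meson le_less_trans of_nat_0_le_iff)
  show ?thesis
  proof (rule that[of 0 "1 - real DIM('a) / p" "4 * (1 + 2 * ?A\<^sup>2) * ?\<beta> + 2 * (?\<beta> + ?I)" "3 + 2 * ?A\<^sup>2"])
    show "(0::real) \<ge> 0" by simp
    show "1 - real DIM('a) / p > 0" using p p0 by simp
    show "4 * (1 + 2 * ?A\<^sup>2) * ?\<beta> + 2 * (?\<beta> + ?I) \<ge> 0" using \<beta> by simp
    show "3 + 2 * ?A\<^sup>2 \<ge> 0" by simp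
    fix V1 V2 V :: "'a \<Rightarrow> 'a"
    assume c: "continuous_on UNIV V1" "continuous_on UNIV V2" and V: "\<And>x. V x = V1 x + V2 x"
      and V1: "in_Linf lebesgue V1" "Linf_norm lebesgue V1 = Ainf"
      and V2: "in_Lp lebesgue p V2" "Lp_norm lebesgue p V2 = Ap"
    have a: "AE x in lborel. norm (V1 x) \<le> ?A" using Linf_norm_AE[OF V1(1)] V1(2) by simp
    have i: "(\<integral>\<^sup>+x. ennreal (norm (V2 x) powr p) \<partial>lborel) = ennreal ?I"
      using in_Lp_nn_integral[OF V2(1) p0] V2(2) by simp
    have V': "V = (\<lambda>x. V1 x + V2 x)" using V by auto
    note dm = drift_morrey[OF d p a c(2) i]
    show "\<exists>W B. continuous_on UNIV W \<and> (\<forall>x. (B has_derivative (\<lambda>v. (V x - W x) \<bullet> v)) (at x)) \<and>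
        (\<forall>x. \<bar>B x\<bar> \<le> 0) \<and>
        (\<forall>z \<rho>. 0 < \<rho> \<longrightarrow> \<rho> \<le> 2 \<longrightarrow> (\<integral>\<^sup>+x. ennreal (1 + (norm (W x))\<^sup>2) * indicator (ball z \<rho>) x \<partial>lborel)
          \<le> ennreal ((4 * (1 + 2 * ?A\<^sup>2) * ?\<beta> + 2 * (?\<beta> + ?I)) * \<rho> powr (real DIM('a) - 2 + 2 * (1 - real DIM('a) / p)))) \<and>
        (AE x in lborel. 1 + (norm (W x))\<^sup>2 \<le> 3 + 2 * ?A\<^sup>2 + 2 * norm (V2 x) powr p)"
    proof (intro exI[of _ V] exI[of _ "\<lambda>x. 0"] conjI allI impI)
      show "continuous_on UNIV V" unfolding V' using c by (intro continuous_intros)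
    qed (use dm in \<open>simp_all add: V\<close>)
  qed
next
  case False
  then have d: "DIM('a) = 1" using DIM_positive[where 'a='a] by linarith
  then have p1: "p > 1" using p by simp
  let ?\<beta> = "unit_ball_vol (real DIM('a))"
  let ?I = "Ap powr p" and ?A = "\<bar>Ainf\<bar>"
  \<comment> \<open>The 1 comes from |V2| \<le> 1 + |V2|^p, valid because p > 1.\<close>
  let ?b = "?A + 1 + ?I"
  have \<beta>: "?\<beta> \<ge> 0" by (rule unit_ball_vol_nonneg) simp
  show ?thesis
  proof (rule that[of ?b 1 "(1 + ?b\<^sup>2) * ?\<beta>" "1 + ?b\<^sup>2"])
    show "?b \<ge> 0" by simp
    show "(1 + ?b\<^sup>2) * ?\<beta> \<ge> 0" using \<beta> by (intro mult_nonneg_nonneg add_nonneg_nonneg) auto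
    show "1 + ?b\<^sup>2 \<ge> 0" by (intro add_nonneg_nonneg) auto
    fix V1 V2 V :: "'a \<Rightarrow> 'a"
    assume c: "continuous_on UNIV V1" "continuous_on UNIV V2" and V: "\<And>x. V x = V1 x + V2 x"
      and V1: "in_Linf lebesgue V1" "Linf_norm lebesgue V1 = Ainf"
      and V2: "in_Lp lebesgue p V2" "Lp_norm lebesgue p V2 = Ap"
    have V': "V = (\<lambda>x. V1 x + V2 x)" using V by auto
    have Vc: "continuous_on UNIV V" unfolding V' using c by (intro continuous_intros)
    have "AE x in lborel. norm (V1 x) \<le> ?A" using Linf_norm_AE[OF V1(1)] V1(2) by simp
    then have a: "AE x in lborel. norm (V x) \<le> (?A + 1) + norm (V2 x) powr p"
    proof eventually_elim
      case (elim x)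
      have "norm (V2 x) \<le> 1 + norm (V2 x) powr p"
      proof (cases "norm (V2 x) \<le> 1")
        case False
        then have "norm (V2 x) powr 1 \<le> norm (V2 x) powr p" using p1 by (intro powr_mono) auto
        then show ?thesis by simp
      qed (simp add: add_increasing2)
      then show ?case using elim norm_triangle_ineq[of "V1 x" "V2 x"] unfolding V by linarith
    qed
    have i: "(\<integral>\<^sup>+x. ennreal (norm (V2 x) powr p) \<partial>lborel) = ennreal ?I"
      using in_Lp_nn_integral[OF V2(1)] V2(2) p1 by simp
    obtain W B where WB: "continuous_on UNIV W" "\<And>x. (B has_derivative (\<lambda>v. (V x - W x) \<bullet> v)) (at x)"
      "\<And>x. \<bar>B x\<bar> \<le> ?b" "\<And>x. norm (W x) \<le> ?b"
      using drift_one_dimensional[OF d Vc a _ c(2) i] by auto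
    have W2: "1 + (norm (W x))\<^sup>2 \<le> 1 + ?b\<^sup>2" for x using WB(4)[of x] by (intro add_left_mono power_mono) auto
    show "\<exists>W B. continuous_on UNIV W \<and> (\<forall>x. (B has_derivative (\<lambda>v. (V x - W x) \<bullet> v)) (at x)) \<and>
        (\<forall>x. \<bar>B x\<bar> \<le> ?b) \<and>
        (\<forall>z \<rho>. 0 < \<rho> \<longrightarrow> \<rho> \<le> 2 \<longrightarrow> (\<integral>\<^sup>+x. ennreal (1 + (norm (W x))\<^sup>2) * indicator (ball z \<rho>) x \<partial>lborel)
          \<le> ennreal ((1 + ?b\<^sup>2) * ?\<beta> * \<rho> powr (real DIM('a) - 2 + 2 * 1))) \<and>
        (AE x in lborel. 1 + (norm (W x))\<^sup>2 \<le> 1 + ?b\<^sup>2 + 2 * norm (V2 x) powr p)"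
    proof (intro exI[of _ W] exI[of _ B] conjI allI impI)
      fix z :: 'a and \<rho> :: real assume \<rho>: "0 < \<rho>" "\<rho> \<le> 2"
      have "(\<integral>\<^sup>+x. ennreal (1 + (norm (W x))\<^sup>2) * indicator (ball z \<rho>) x \<partial>lborel) \<le>
          (\<integral>\<^sup>+x. ennreal (1 + ?b\<^sup>2) * indicator (ball z \<rho>) x \<partial>lborel)"
        by (intro nn_integral_mono mult_right_mono ennreal_leI W2) auto
      also have "\<dots> = ennreal (1 + ?b\<^sup>2) * emeasure lborel (ball z \<rho>)"
        by (rule nn_integral_cmult_indicator) simp
      also have "emeasure lborel (ball z \<rho>) = ennreal (?\<beta> * \<rho>)"
        using emeasure_ball[of \<rho> z] \<rho> d by simp
      also have "ennreal (1 + ?b\<^sup>2) * ennreal (?\<beta> * \<rho>) = ennreal ((1 + ?b\<^sup>2) * ?\<beta> * \<rho> powr (real DIM('a) - 2 + 2 * 1))"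
      proof -
        have "0 \<le> 1 + ?b\<^sup>2" "0 \<le> ?\<beta> * \<rho>" using \<beta> \<rho> by (auto intro!: add_nonneg_nonneg)
        from ennreal_mult[OF this]
        have "ennreal (1 + ?b\<^sup>2) * ennreal (?\<beta> * \<rho>) = ennreal ((1 + ?b\<^sup>2) * ?\<beta> * \<rho>)"
          by (simp only: mult.assoc)
        moreover have "\<rho> powr (real DIM('a) - 2 + 2 * 1) = \<rho>" using d \<rho> by simp
        ultimately show ?thesis by (simp only:)
      qed
      finally show "(\<integral>\<^sup>+x. ennreal (1 + (norm (W x))\<^sup>2) * indicator (ball z \<rho>) x \<partial>lborel)
          \<le> ennreal ((1 + ?b\<^sup>2) * ?\<beta> * \<rho> powr (real DIM('a) - 2 + 2 * 1))" by simp
    next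
      show "AE x in lborel. 1 + (norm (W x))\<^sup>2 \<le> 1 + ?b\<^sup>2 + 2 * norm (V2 x) powr p"
        using W2 by (intro AE_I2) (simp add: add_increasing2)
    qed (use WB in auto)
  qed simp
qed

subsection \<open>The initial datum\<close>

lemma integral_lebesgue_on_le:
  fixes f :: "'a::euclidean_space \<Rightarrow> real"
  assumes f: "integrable lebesgue f" "\<And>x. f x \<ge> 0" and S: "S \<in> sets lebesgue"
  shows "integrable (lebesgue_on S) f" "(\<integral>x. f x \<partial>lebesgue_on S) \<le> (\<integral>x. f x \<partial>lebesgue)"
proof -
  have i: "integrable lebesgue (\<lambda>x. indicator S x *\<^sub>R f x)"
    by (rule integrable_mult_indicator[OF S f(1)])
  then show "integrable (lebesgue_on S) f"
    using S by (subst integrable_restrict_space) auto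
  have "(\<integral>x. f x \<partial>lebesgue_on S) = (\<integral>x. indicator S x *\<^sub>R f x \<partial>lebesgue)"
    using S by (subst integral_restrict_space) auto
  also have "\<dots> \<le> (\<integral>x. f x \<partial>lebesgue)"
    by (rule integral_mono[OF i f(1)]) (use f(2) in \<open>auto simp: indicator_def\<close>)
  finally show "(\<integral>x. f x \<partial>lebesgue_on S) \<le> (\<integral>x. f x \<partial>lebesgue)" .
qed

lemma AE_lborel_imp_AE_lebesgue_on:
  assumes "AE x in lborel. P x" "S \<in> sets lebesgue"
  shows "AE x in lebesgue_on S. P x"
  using AE_completion[OF assms(1)] assms(2) by (subst AE_restrict_space_iff) auto

text \<open>\<open>Lp_norm\<close> of a non-integrable function is 0, so smallness of that norm says
  something only together with integrability.\<close>

lemma initial_integrable: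
  fixes u0 w :: "'a::euclidean_space \<Rightarrow> real"
  assumes u0: "in_Linf lebesgue u0" and w: "continuous_on (cball 0 r) w" and q: "q \<ge> 1"
  shows "integrable (lebesgue_on (ball 0 r)) (\<lambda>x. \<bar>w x - u0 x\<bar> powr q)"
    and "integrable (lebesgue_on (ball 0 r)) (\<lambda>x. \<bar>u0 x\<bar> powr q)"
proof -
  let ?M = "lebesgue_on (ball (0::'a) r)"
  interpret finite_measure ?M by (rule finite_measure_lebesgue_on_ball)
  obtain K where K: "K > 0" "\<And>x. x \<in> cball 0 r \<Longrightarrow> norm (w x) \<le> K"
    using continuous_on_compact_bound[OF compact_cball[of 0 r] w] by metis
  have [measurable]: "u0 \<in> borel_measurable ?M"
    using u0 by (auto simp: in_Linf_def intro: measurable_restrict_space1)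
  have [measurable]: "w \<in> borel_measurable ?M"
    using continuous_cball_integrable_lebesgue_on_ball[OF w] by auto
  have a: "AE x in ?M. norm (u0 x) \<le> \<bar>Linf_norm lebesgue u0\<bar>"
    by (rule AE_lborel_imp_AE_lebesgue_on[OF Linf_norm_AE[OF u0]]) simp
  have b: "AE x in ?M. norm (w x) \<le> K"
    using K(2) by (intro AE_I2) (auto simp: space_restrict_space)
  show "integrable ?M (\<lambda>x. \<bar>w x - u0 x\<bar> powr q)"
  proof (rule integrable_const_bound)
    show "AE x in ?M. norm (\<bar>w x - u0 x\<bar> powr q) \<le> (K + \<bar>Linf_norm lebesgue u0\<bar>) powr q"
      using a b
    proof eventually_elim
      case (elim x)
      then have "\<bar>w x - u0 x\<bar> \<le> K + \<bar>Linf_norm lebesgue u0\<bar>" by simp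
      then have "\<bar>w x - u0 x\<bar> powr q \<le> (K + \<bar>Linf_norm lebesgue u0\<bar>) powr q"
        using q by (intro powr_mono2) auto
      then show ?case by simp
    qed
  qed measurable
  show "integrable ?M (\<lambda>x. \<bar>u0 x\<bar> powr q)"
  proof (rule integrable_const_bound)
    show "AE x in ?M. norm (\<bar>u0 x\<bar> powr q) \<le> \<bar>Linf_norm lebesgue u0\<bar> powr q"
      using a
    proof eventually_elim
      case (elim x)
      then have "\<bar>u0 x\<bar> powr q \<le> \<bar>Linf_norm lebesgue u0\<bar> powr q"
        using q by (intro powr_mono2) auto
      then show ?case by simp
    qed
  qed measurable
qed

lemma initial_close:
  fixes u :: "'a::euclidean_space \<Rightarrow> real \<Rightarrow> real"
  assumes lim: "((\<lambda>t. Lp_norm (lebesgue_on (ball 0 r)) q (\<lambda>x. u x t - u0 x)) \<longlongrightarrow> 0) (at_right 0)"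
    and q: "q \<ge> 1" and \<tau>: "\<tau> > 0" and \<eta>: "\<eta> > 0"
  obtains s where "0 < s" "s < \<tau>" "(\<integral>x. \<bar>u x s - u0 x\<bar> powr q \<partial>lebesgue_on (ball 0 r)) \<le> \<eta>"
proof -
  have "\<forall>\<^sub>F t in at_right 0. Lp_norm (lebesgue_on (ball 0 r)) q (\<lambda>x. u x t - u0 x) < \<eta> powr (1 / q)"
    using \<eta> by (intro order_tendstoD(2)[OF lim]) simp
  then obtain b where b: "b > 0" "\<And>t. 0 < t \<Longrightarrow> t < b \<Longrightarrow>
      Lp_norm (lebesgue_on (ball 0 r)) q (\<lambda>x. u x t - u0 x) < \<eta> powr (1 / q)"
    by (auto simp: eventually_at_right_field)
  define s where "s = min b \<tau> / 2"
  have s: "0 < s" "s < b" "s < \<tau>" using b(1) \<tau> by (auto simp: s_def)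
  have "(\<integral>x. \<bar>u x s - u0 x\<bar> powr q \<partial>lebesgue_on (ball 0 r)) \<le> \<eta>"
  proof (rule ccontr)
    assume "\<not> ?thesis"
    then have "\<eta> powr (1 / q) \<le> (\<integral>x. \<bar>u x s - u0 x\<bar> powr q \<partial>lebesgue_on (ball 0 r)) powr (1 / q)"
      using \<eta> q by (intro powr_mono2) auto
    then show False using b(2)[OF s(1,2)] by (simp add: Lp_norm_def)
  qed
  then show ?thesis using that s by blast
qed

lemma initial_mass:
  fixes u :: "'a::euclidean_space \<Rightarrow> real \<Rightarrow> real"
  assumes lim: "((\<lambda>t. Lp_norm (lebesgue_on (ball 0 r)) 1 (\<lambda>x. u x t - u0 x)) \<longlongrightarrow> 0) (at_right 0)"
    and u0: "in_Linf lebesgue u0" "in_Lp lebesgue 1 u0"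
    and u: "\<And>t. t > 0 \<Longrightarrow> continuous_on (cball 0 r) (\<lambda>x. u x t)"
    and \<tau>: "\<tau> > 0" and \<eta>: "\<eta> > 0"
  obtains s where "0 < s" "s < \<tau>" "(\<integral>x. u x s \<partial>lebesgue_on (ball 0 r)) \<le> Lp_norm lebesgue 1 u0 + \<eta>"
proof -
  let ?M = "lebesgue_on (ball (0::'a) r)"
  obtain s where s: "0 < s" "s < \<tau>" "(\<integral>x. \<bar>u x s - u0 x\<bar> powr 1 \<partial>?M) \<le> \<eta>"
    using initial_close[OF lim _ \<tau> \<eta>] by auto
  have i: "integrable ?M (\<lambda>x. \<bar>u x s - u0 x\<bar>)" "integrable ?M (\<lambda>x. \<bar>u0 x\<bar>)"
    using initial_integrable[OF u0(1) u[OF s(1)], of 1] by simp_all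
  have L1: "integrable lebesgue (\<lambda>x. \<bar>u0 x\<bar>)" "(\<integral>x. \<bar>u0 x\<bar> \<partial>lebesgue) = Lp_norm lebesgue 1 u0"
    using u0(2) by (simp_all add: in_Lp_def Lp_norm_def)
  have "(\<integral>x. u x s \<partial>?M) \<le> (\<integral>x. \<bar>u x s - u0 x\<bar> + \<bar>u0 x\<bar> \<partial>?M)"
    using i continuous_cball_integrable_lebesgue_on_ball[OF u[OF s(1)]] by (intro integral_mono) auto
  also have "\<dots> = (\<integral>x. \<bar>u x s - u0 x\<bar> \<partial>?M) + (\<integral>x. \<bar>u0 x\<bar> \<partial>?M)"
    using i by simp
  also have "\<dots> \<le> \<eta> + (\<integral>x. \<bar>u0 x\<bar> \<partial>lebesgue)"
    using s(3) integral_lebesgue_on_le(2)[OF L1(1), of "ball 0 r"] by (intro add_mono) auto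
  finally show ?thesis using that[OF s(1,2)] L1(2) by simp
qed

text \<open>Bounding |u0|^q by A^q |u0| brings in the L1 norm where a cruder estimate would bring in
  the volume of the ball. The factor 2^q and one plus the L1 norm are absorbed into L, which is
  therefore the same for all q, although s may vary with q.\<close>

lemma initial_power:
  fixes u :: "'a::euclidean_space \<Rightarrow> real \<Rightarrow> real"
  assumes lim: "((\<lambda>t. Lp_norm (lebesgue_on (ball 0 r)) (real q) (\<lambda>x. u x t - u0 x)) \<longlongrightarrow> 0) (at_right 0)"
    and q: "q \<ge> 1"
    and u0: "in_Linf lebesgue u0" "in_Lp lebesgue 1 u0"
    and u: "\<And>t. t > 0 \<Longrightarrow> continuous_on (cball 0 r) (\<lambda>x. u x t)"
    and nonneg: "\<And>x t. x \<in> ball 0 r \<Longrightarrow> t > 0 \<Longrightarrow> u x t \<ge> 0"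
    and \<tau>: "\<tau> > 0"
  defines "L \<equiv> 2 * (\<bar>Linf_norm lebesgue u0\<bar> + 1) * (1 + \<bar>Lp_norm lebesgue 1 u0\<bar>)"
  shows "\<exists>s. 0 < s \<and> s < \<tau> \<and> (\<integral>x. u x s ^ q \<partial>lebesgue_on (ball 0 r)) \<le> L ^ q"
proof -
  let ?M = "lebesgue_on (ball (0::'a) r)"
  let ?A = "\<bar>Linf_norm lebesgue u0\<bar> + 1" and ?m = "\<bar>Lp_norm lebesgue 1 u0\<bar>"
  have q': "real q \<ge> 1" using q by simp
  have pw: "\<bar>y\<bar> powr real q = \<bar>y\<bar> ^ q" for y :: real using q by (simp add: powr_realpow')
  obtain s where s: "0 < s" "s < \<tau>" "(\<integral>x. \<bar>u x s - u0 x\<bar> powr real q \<partial>?M) \<le> 1"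
    using initial_close[OF lim q' \<tau>, of 1] by auto
  have i: "integrable ?M (\<lambda>x. \<bar>u x s - u0 x\<bar> ^ q)" "integrable ?M (\<lambda>x. \<bar>u0 x\<bar> ^ q)"
    using initial_integrable[OF u0(1) u[OF s(1)] q'] by (simp_all add: pw)
  have L1: "integrable lebesgue (\<lambda>x. \<bar>u0 x\<bar>)" "(\<integral>x. \<bar>u0 x\<bar> \<partial>lebesgue) = Lp_norm lebesgue 1 u0"
    using u0(2) by (simp_all add: in_Lp_def Lp_norm_def)
  note L1M = integral_lebesgue_on_le[OF L1(1), of "ball 0 r"]
  have "(\<integral>x. \<bar>u0 x\<bar> ^ q \<partial>?M) \<le> (\<integral>x. ?A ^ q * \<bar>u0 x\<bar> \<partial>?M)"
  proof (rule integral_mono_AE[OF i(2)])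
    show "integrable ?M (\<lambda>x. ?A ^ q * \<bar>u0 x\<bar>)" using L1M(1) by simp
    have "AE x in ?M. norm (u0 x) \<le> \<bar>Linf_norm lebesgue u0\<bar>"
      by (rule AE_lborel_imp_AE_lebesgue_on[OF Linf_norm_AE[OF u0(1)]]) simp
    then show "AE x in ?M. \<bar>u0 x\<bar> ^ q \<le> ?A ^ q * \<bar>u0 x\<bar>"
    proof eventually_elim
      case (elim x)
      have "\<bar>u0 x\<bar> ^ q = \<bar>u0 x\<bar> ^ (q - 1) * \<bar>u0 x\<bar>" using q by (simp add: power_eq_if)
      also have "\<dots> \<le> ?A ^ (q - 1) * \<bar>u0 x\<bar>" using elim by (intro mult_right_mono power_mono) auto
      also have "\<dots> \<le> ?A ^ q * \<bar>u0 x\<bar>" by (intro mult_right_mono power_increasing) auto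
      finally show ?case .
    qed
  qed
  also have "\<dots> \<le> ?A ^ q * ?m"
  proof -
    have "(\<integral>x. \<bar>u0 x\<bar> \<partial>?M) \<le> ?m" using L1M(2) L1(2) by simp
    then have "?A ^ q * (\<integral>x. \<bar>u0 x\<bar> \<partial>?M) \<le> ?A ^ q * ?m" by (intro mult_left_mono) auto
    then show ?thesis by simp
  qed
  finally have u0q: "(\<integral>x. \<bar>u0 x\<bar> ^ q \<partial>?M) \<le> ?A ^ q * ?m" .
  have "(\<integral>x. u x s ^ q \<partial>?M) \<le> (\<integral>x. 2 ^ q * (\<bar>u x s - u0 x\<bar> ^ q + \<bar>u0 x\<bar> ^ q) \<partial>?M)"
  proof (rule integral_mono)
    show "integrable ?M (\<lambda>x. u x s ^ q)"
      by (intro continuous_cball_integrable_lebesgue_on_ball continuous_intros u[OF s(1)])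
    show "integrable ?M (\<lambda>x. 2 ^ q * (\<bar>u x s - u0 x\<bar> ^ q + \<bar>u0 x\<bar> ^ q))" using i by simp
    fix x assume "x \<in> space ?M"
    then have x: "u x s \<ge> 0" using nonneg[of x s] s(1) by (simp add: space_restrict_space)
    let ?a = "\<bar>u x s - u0 x\<bar>" and ?b = "\<bar>u0 x\<bar>"
    have "u x s \<le> ?a + ?b" by linarith
    also have "\<dots> \<le> max ?a ?b + max ?a ?b" by (intro add_mono max.cobounded1 max.cobounded2)
    finally have "u x s \<le> 2 * max ?a ?b" by (simp only: mult_2)
    then have "u x s ^ q \<le> (2 * max ?a ?b) ^ q" using x by (intro power_mono)
    also have "\<dots> = 2 ^ q * (max ?a ?b) ^ q" by (simp add: power_mult_distrib)
    also have "\<dots> \<le> 2 ^ q * (?a ^ q + ?b ^ q)" by (intro mult_left_mono) (auto simp: max_def)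
    finally show "u x s ^ q \<le> 2 ^ q * (?a ^ q + ?b ^ q)" .
  qed
  also have "\<dots> = 2 ^ q * ((\<integral>x. \<bar>u x s - u0 x\<bar> ^ q \<partial>?M) + (\<integral>x. \<bar>u0 x\<bar> ^ q \<partial>?M))"
    using i by simp
  also have "\<dots> \<le> 2 ^ q * (1 + ?A ^ q * ?m)"
    using s(3) u0q by (intro mult_left_mono add_mono) (auto simp: pw)
  also have "\<dots> \<le> 2 ^ q * (?A ^ q * (1 + ?m) ^ q)"
  proof (rule mult_left_mono)
    have "1 \<le> ?A ^ q" by (rule one_le_power) simp
    then have "1 + ?A ^ q * ?m \<le> ?A ^ q * (1 + ?m)" by (simp add: distrib_left)
    also have "\<dots> \<le> ?A ^ q * (1 + ?m) ^ q"
      using q power_increasing[of 1 q "1 + ?m"] by (intro mult_left_mono) auto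
    finally show "1 + ?A ^ q * ?m \<le> ?A ^ q * (1 + ?m) ^ q" .
  qed simp
  also have "\<dots> = L ^ q" by (simp only: L_def power_mult_distrib mult.assoc)
  finally show ?thesis using s by blast
qed

text \<open>On the set w \<ge> 1 the constant K is at most K w, so the mass replaces the volume of
  the ball; the rest is integrated over the whole space.\<close>

lemma tail_bound:
  fixes W V2 :: "'a::euclidean_space \<Rightarrow> 'a" and w :: "'a \<Rightarrow> real"
  assumes w: "continuous_on (cball 0 r) w" "\<And>x. x \<in> ball 0 r \<Longrightarrow> w x \<ge> 0"
    and mass: "(\<integral>x. w x \<partial>lebesgue_on (ball 0 r)) \<le> M1"
    and W: "continuous_on UNIV W" "AE x in lborel. 1 + (norm (W x))\<^sup>2 \<le> K + 2 * norm (V2 x) powr p"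
    and K: "K \<ge> 0" and V2: "in_Lp lebesgue p V2" and p: "p > 0"
  shows "integrable (lebesgue_on (ball 0 r)) (\<lambda>x. if w x \<ge> 1 then 1 + (norm (W x))\<^sup>2 else 0)"
    and "(\<integral>x. (if w x \<ge> 1 then 1 + (norm (W x))\<^sup>2 else 0) \<partial>lebesgue_on (ball 0 r)) \<le>
      K * M1 + 2 * Lp_norm lebesgue p V2 powr p"
proof -
  let ?M = "lebesgue_on (ball (0::'a) r)"
  have Wi: "integrable ?M (\<lambda>x. 1 + (norm (W x))\<^sup>2)"
    by (intro continuous_cball_integrable_lebesgue_on_ball continuous_intros continuous_on_subset[OF W(1)]) auto
  have wi: "integrable ?M w" by (rule continuous_cball_integrable_lebesgue_on_ball[OF w(1)])
  have [measurable]: "w \<in> borel_measurable ?M" "(\<lambda>x. 1 + (norm (W x))\<^sup>2) \<in> borel_measurable ?M"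
    using Wi wi by auto
  show int: "integrable ?M (\<lambda>x. if w x \<ge> 1 then 1 + (norm (W x))\<^sup>2 else 0)"
    by (rule Bochner_Integration.integrable_bound[OF Wi]) auto
  have Vi: "integrable lebesgue (\<lambda>x. norm (V2 x) powr p)" using V2 by (simp add: in_Lp_def)
  note ViM = integral_lebesgue_on_le[OF Vi, of "ball 0 r"]
  have "(\<integral>x. (if w x \<ge> 1 then 1 + (norm (W x))\<^sup>2 else 0) \<partial>?M) \<le> (\<integral>x. K * w x + 2 * norm (V2 x) powr p \<partial>?M)"
  proof (rule integral_mono_AE[OF int])
    show "integrable ?M (\<lambda>x. K * w x + 2 * norm (V2 x) powr p)" using wi ViM(1) by simp
    have "AE x in ?M. 1 + (norm (W x))\<^sup>2 \<le> K + 2 * norm (V2 x) powr p"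
      by (rule AE_lborel_imp_AE_lebesgue_on[OF W(2)]) simp
    moreover have "AE x in ?M. w x \<ge> 0"
      using w(2) by (intro AE_I2) (auto simp: space_restrict_space)
    ultimately show "AE x in ?M. (if w x \<ge> 1 then 1 + (norm (W x))\<^sup>2 else 0) \<le> K * w x + 2 * norm (V2 x) powr p"
    proof eventually_elim
      case (elim x)
      then show ?case using K mult_left_mono[of 1 "w x" K] by auto
    qed
  qed
  also have "\<dots> = K * (\<integral>x. w x \<partial>?M) + 2 * (\<integral>x. norm (V2 x) powr p \<partial>?M)"
    using wi ViM(1) by simp
  also have "\<dots> \<le> K * M1 + 2 * (\<integral>x. norm (V2 x) powr p \<partial>lebesgue)"
    using mass K ViM(2) by (intro add_mono mult_left_mono) auto
  also have "(\<integral>x. norm (V2 x) powr p \<partial>lebesgue) = Lp_norm lebesgue p V2 powr p"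
    using p by (simp add: Lp_norm_def powr_powr)
  finally show "(\<integral>x. (if w x \<ge> 1 then 1 + (norm (W x))\<^sup>2 else 0) \<partial>?M) \<le>
      K * M1 + 2 * Lp_norm lebesgue p V2 powr p" .
qed

text \<open>The order of the quantifiers expresses the dependence: R0 and C are chosen once m, p,
  the dimension and the values of the four norms are given, before \<epsilon>, the fields, the
  datum, the radius and the solution.\<close>

theorem theorem3p1:
  fixes m p A1 A2 M1 Minf :: real
  assumes "m > 1" and "p > real DIM('a::euclidean_space)"
  shows "\<exists>R0>0. \<exists>C. \<forall>\<epsilon>>0. \<forall>(u0 :: 'a \<Rightarrow> real) (V1 :: 'a \<Rightarrow> 'a) (V2 :: 'a \<Rightarrow> 'a) (V :: 'a \<Rightarrow> 'a).
    in_Lp lebesgue 1 u0 \<and> in_Linf lebesgue u0 \<and> (AE x in lebesgue. u0 x \<ge> 0) \<and>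
    admissible V \<and> (\<forall>x. V x = V1 x + V2 x) \<and>
    smooth_on UNIV V1 \<and> smooth_on UNIV V2 \<and>
    in_Linf lebesgue V1 \<and> in_Lp lebesgue p V2 \<and>
    Linf_norm lebesgue V1 = A1 \<and> Lp_norm lebesgue p V2 = A2 \<and>
    Lp_norm lebesgue 1 u0 = M1 \<and> Linf_norm lebesgue u0 = Minf \<longrightarrow>
    (\<forall>r\<ge>R0. \<forall>u. is_solution m \<epsilon> V u0 r u \<longrightarrow>
       (\<forall>x\<in>ball 0 r. \<forall>t>0. \<bar>u x t\<bar> \<le> C) \<and>
       (AE x in lebesgue. x \<in> ball 0 r \<longrightarrow> \<bar>u x 0\<bar> \<le> C))"
proof -
  have p0: "p > 0" using assms(2) by (meson le_less_trans of_nat_0_le_iff)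
  show ?thesis
  proof (rule drift_decomposition[OF assms(2), where Ainf = A1 and Ap = A2])
    fix b0 \<alpha> \<Lambda> K :: real
    assume b0: "b0 \<ge> 0" and \<alpha>: "\<alpha> > 0" and \<Lambda>: "\<Lambda> \<ge> 0" and K: "K \<ge> 0"
      and drift: "\<And>V1 V2 V :: 'a \<Rightarrow> 'a. continuous_on UNIV V1 \<Longrightarrow> continuous_on UNIV V2 \<Longrightarrow> (\<And>x. V x = V1 x + V2 x) \<Longrightarrow>
        in_Linf lebesgue V1 \<Longrightarrow> in_Lp lebesgue p V2 \<Longrightarrow> Linf_norm lebesgue V1 = A1 \<Longrightarrow> Lp_norm lebesgue p V2 = A2 \<Longrightarrow>
        \<exists>W B. continuous_on UNIV W \<and> (\<forall>x. (B has_derivative (\<lambda>v. (V x - W x) \<bullet> v)) (at x)) \<and>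
          (\<forall>x. \<bar>B x\<bar> \<le> b0) \<and>
          (\<forall>z \<rho>. 0 < \<rho> \<longrightarrow> \<rho> \<le> 2 \<longrightarrow> (\<integral>\<^sup>+x. ennreal (1 + (norm (W x))\<^sup>2) * indicator (ball z \<rho>) x \<partial>lborel)
            \<le> ennreal (\<Lambda> * \<rho> powr (real DIM('a) - 2 + 2 * \<alpha>))) \<and>
          (AE x in lborel. 1 + (norm (W x))\<^sup>2 \<le> K + 2 * norm (V2 x) powr p)"
    \<comment> \<open>L is the constant of \<open>initial_power\<close> for the prescribed norms;
      \<open>L'\<close> adds the factors that \<open>en_initial\<close> introduces.\<close>
    define L where "L = 2 * (\<bar>Minf\<bar> + 1) * (1 + \<bar>M1\<bar>)"
    define L' where "L' = exp b0 powr m * exp b0 * L"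
    define c0 where "c0 = K * \<bar>M1\<bar> + 2 * A2 powr p"
    let ?d = "DIM('a)"
    have c0: "c0 \<ge> 0" using K by (simp add: c0_def)
    have L: "L \<ge> 1"
    proof -
      have "1 * 1 \<le> (\<bar>Minf\<bar> + 1) * (1 + \<bar>M1\<bar>)" by (intro mult_mono) auto
      then show ?thesis unfolding L_def by linarith
    qed
    have L': "L' \<ge> 1"
    proof -
      have e: "exp b0 \<ge> 1" using b0 by simp
      then have "exp b0 powr m \<ge> 1" using assms(1) by (intro ge_one_powr_ge_zero) auto
      then have "1 * 1 * 1 \<le> exp b0 powr m * exp b0 * L" using e L by (intro mult_mono) auto
      then show ?thesis by (simp add: L'_def)
    qed
    have "moser_start ?d m b0 \<alpha> \<Lambda> c0 \<bar>M1\<bar> L' \<ge> 0"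
      unfolding moser_start_def Let_def by (rule max.coboundedI1) simp
    moreover have "moser_rate ?d m b0 \<alpha> \<Lambda> c0 \<ge> 0"
      unfolding moser_rate_def using moser_const_nonneg[OF \<Lambda> c0] by simp
    moreover have "2 powr moser_exponent ?d \<alpha> \<ge> (1::real)"
      by (rule ge_one_powr_ge_zero) (auto simp: moser_exponent_def add_nonneg_nonneg)
    ultimately obtain N where N: "N \<ge> 1"
      "\<And>k. moser_seq (moser_start ?d m b0 \<alpha> \<Lambda> c0 \<bar>M1\<bar> L') (moser_rate ?d m b0 \<alpha> \<Lambda> c0)
        (2 powr moser_exponent ?d \<alpha>) L' k \<le> N ^ (2 ^ (k + 2))"
      using moser_seq_bound[OF _ _ _ L'] by metis
    \<comment> \<open>The second entry covers time zero, where u is the datum almost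
      everywhere.\<close>
    define C where "C = max (exp b0 * (N + exp b0)) \<bar>Minf\<bar>"
    have main: "(\<forall>x\<in>ball 0 r. \<forall>t>0. \<bar>u x t\<bar> \<le> C) \<and> (AE x in lebesgue. x \<in> ball 0 r \<longrightarrow> \<bar>u x 0\<bar> \<le> C)"
      if sol: "is_solution m \<epsilon> V u0 r u" and r: "r \<ge> 1" and V: "\<forall>x. V x = V1 x + V2 x"
        and \<epsilon>: "\<epsilon> > 0" and u0: "in_Lp lebesgue 1 u0" "in_Linf lebesgue u0"
        and smooth: "smooth_on UNIV V1" "smooth_on UNIV V2"
        and V1: "in_Linf lebesgue V1" "Linf_norm lebesgue V1 = A1"
        and V2: "in_Lp lebesgue p V2" "Lp_norm lebesgue p V2 = A2"
        and norms: "Lp_norm lebesgue 1 u0 = M1" "Linf_norm lebesgue u0 = Minf"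
      for \<epsilon> r and u0 :: "'a \<Rightarrow> real" and V1 V2 V :: "'a \<Rightarrow> 'a" and u
    proof -
      have C1: "C1_on UNIV V1" "C1_on UNIV V2" using smooth smooth_on_UNIV_C1 by blast+
      have V': "V = (\<lambda>x. V1 x + V2 x)" using V by auto
      have VC1: "C1_on UNIV V" unfolding V' by (intro C1_on_add C1)
      show ?thesis
      proof (rule is_solution_pme_flow[OF sol assms(1) \<epsilon> r VC1])
        fix U :: "('a \<times> real) set" and g :: "'a \<times> real \<Rightarrow> real"
        assume gu: "\<And>x t. x \<in> cball 0 r \<Longrightarrow> t > 0 \<Longrightarrow> g (x, t) = u x t"
          and flow: "\<And>W B b0. continuous_on UNIV W \<Longrightarrow> (\<And>x. (B has_derivative (\<lambda>v. (V x - W x) \<bullet> v)) (at x)) \<Longrightarrow>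
            (\<And>x. \<bar>B x\<bar> \<le> b0) \<Longrightarrow> pme_flow m \<epsilon> r b0 U g V W B"
        obtain W B where W: "continuous_on UNIV W" and B: "\<And>x. (B has_derivative (\<lambda>v. (V x - W x) \<bullet> v)) (at x)"
            "\<And>x. \<bar>B x\<bar> \<le> b0"
          and morrey: "\<And>z \<rho>. 0 < \<rho> \<Longrightarrow> \<rho> \<le> 2 \<Longrightarrow> (\<integral>\<^sup>+x. ennreal (1 + (norm (W x))\<^sup>2) * indicator (ball z \<rho>) x \<partial>lborel)
              \<le> ennreal (\<Lambda> * \<rho> powr (real DIM('a) - 2 + 2 * \<alpha>))"
          and WK: "AE x in lborel. 1 + (norm (W x))\<^sup>2 \<le> K + 2 * norm (V2 x) powr p"
          using drift[OF C1_on_imp_continuous_on[OF C1(1)] C1_on_imp_continuous_on[OF C1(2)] V[rule_format] V1(1) V2(1) V1(2) V2(2)]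
          by blast
        have lim: "((\<lambda>t. Lp_norm (lebesgue_on (ball 0 r)) q (\<lambda>x. u x t - u0 x)) \<longlongrightarrow> 0) (at_right 0)" if "q \<ge> 1" for q
          using sol that by (simp add: is_solution_def)
        have nonneg: "u x t \<ge> 0" if "x \<in> cball 0 r" "t > 0" for x t
          using sol that by (simp add: is_solution_def)
        \<comment> \<open>The trivial splitting supplies the mass bound, which enters the tail
          estimate for the second splitting.\<close>
        interpret F0: pme_flow m \<epsilon> r 0 U g V V "\<lambda>x. 0"
          by (rule flow) (auto intro: C1_on_imp_continuous_on[OF VC1])
        interpret F: pme_flow m \<epsilon> r b0 U g V W B by (rule flow[OF W B])
        have M: "F0.M = lebesgue_on (ball 0 r)" by (rule F0.M_def)
        have uc: "continuous_on (cball 0 r) (\<lambda>x. u x t)" if "t > 0" for t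
          using continuous_on_eq[OF F0.g_slice_cont[OF that]] gu that by auto
        have int_eq: "(\<integral>x. g (x, t) ^ q \<partial>F0.M) = (\<integral>x. u x t ^ q \<partial>lebesgue_on (ball 0 r))" if "t > 0" for t q
          unfolding M using gu[OF _ that] by (intro Bochner_Integration.integral_cong) (auto simp: space_restrict_space)
        have mass: "(\<integral>x. g (x, t) \<partial>F0.M) \<le> \<bar>M1\<bar>" if t: "t > 0" for t
        \<comment> \<open>The mass at time s is only close to that of the datum, and s varies with
          the error; monotonicity in time removes the dependence on s.\<close>
        proof (rule field_le_epsilon)
          fix \<eta> :: real assume "\<eta> > 0"
          then obtain s where s: "0 < s" "s < t" "(\<integral>x. u x s \<partial>lebesgue_on (ball 0 r)) \<le> Lp_norm lebesgue 1 u0 + \<eta>"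
            using initial_mass[OF lim u0(2,1) uc t] by auto
          have "(\<integral>x. g (x, t) \<partial>F0.M) \<le> (\<integral>x. g (x, s) \<partial>F0.M)"
            by (rule F0.mass_decreasing) (use s in auto)
          also have "\<dots> \<le> M1 + \<eta>" using s int_eq[of s 1] norms(1) by simp
          finally show "(\<integral>x. g (x, t) \<partial>F0.M) \<le> \<bar>M1\<bar> + \<eta>" by linarith
        qed
        have tail: "integrable F0.M (\<lambda>x. if g (x, t) \<ge> 1 then 1 + (norm (W x))\<^sup>2 else 0)"
          "(\<integral>x. (if g (x, t) \<ge> 1 then 1 + (norm (W x))\<^sup>2 else 0) \<partial>F0.M) \<le> c0" if t: "t > 0" for t
          using tail_bound[OF F0.g_slice_cont[OF t] _ mass[OF t, unfolded M] W WK K V2(1) p0]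
            F0.g_nonneg[OF _ t] unfolding M c0_def V2(2) by auto
        interpret Mo: pme_moser m \<epsilon> r b0 U g V W B \<alpha> \<Lambda> c0
          by unfold_locales (use \<alpha> \<Lambda> morrey tail in auto)
        have init: "\<exists>s. 0 < s \<and> s < \<tau> \<and> (\<integral>x. g (x, s) ^ q \<partial>F0.M) \<le> L ^ q" if q: "q \<ge> 3" and \<tau>: "\<tau> > 0" for q \<tau>
        proof -
          have "q \<ge> 1" "real q \<ge> 1" using q by auto
          then obtain s where "0 < s" "s < \<tau>" "(\<integral>x. u x s ^ q \<partial>lebesgue_on (ball 0 r)) \<le> L ^ q"
            using initial_power[OF lim _ u0(2,1) uc _ \<tau>, of q] nonneg norms by (auto simp: L_def)
          then show ?thesis using int_eq by auto
        qed
        have "g (x, t) \<le> exp b0 * (N + exp b0)" if "x \<in> ball 0 r" "t > 0" for x t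
          by (rule Mo.sup_bound[OF mass L init N[unfolded L'_def, folded Mo.k0_def] that(2,1)])
        then have "\<bar>u x t\<bar> \<le> C" if "x \<in> ball 0 r" "t > 0" for x t
          using that gu[of x t] nonneg[of x t] by (fastforce simp: C_def)
        moreover have "AE x in lebesgue. x \<in> ball 0 r \<longrightarrow> \<bar>u x 0\<bar> \<le> C"
        proof -
          have "AE x in lebesgue. x \<in> ball 0 r \<longrightarrow> u x 0 = u0 x" using sol by (simp add: is_solution_def)
          moreover have "AE x in lebesgue. norm (u0 x) \<le> \<bar>Minf\<bar>"
            using AE_completion[OF Linf_norm_AE[OF u0(2)]] norms(2) by simp
          ultimately show ?thesis by eventually_elim (auto simp: C_def)
        qed
        ultimately show ?thesis by blast
      qed
    qed
    show ?thesis
      by (rule exI[of _ 1], rule conjI, simp, rule exI[of _ C], intro allI impI, elim conjE,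
          rule main; assumption)
  qed
qed

end
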